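(* Suppose that $M$ is RDD, we can sample from $|t|/\|t\|_1$ in $O(1)$ time, $\|t\|_1$, $\mathrm{nnz}(M)$ and $f_{\mathrm{row}}(M)$ are known, and $b=e_w$ for a given $w\in[n]$. Then there exists a randomized algorithm that computes $\hat x$ with $\Pr\{|\hat x-t^{\top}x^{\ast}|\le\varepsilon\|D_M^{-1}b\|_\infty\}\ge\frac34$ with average time complexity $$O\big(f_{\mathrm{row}}(M)^{1/3}(\mathrm{nnz}(M)/n)^{2/3}\|t\|_1^{2/3}L^{7/3}\varepsilon^{-2/3}\big),$$ where the average is over all choices of $w\in[n]$.
   Context: Setting: $M\in\mathbb{R}^{n\times n}$, $b\in\operatorname{range}(M)$, $t\in\mathbb{R}^n$, $t\ne0$, nonzero entries of absolute value in $[1/\mathrm{poly}(n),\mathrm{poly}(n)]$. RDD: positive diagonal and $M(j,j)\ge\sum_{k\ne j}|M(j,k)|$. Write $M=D_M-A_M^{\top}$ ($D_M$ diagonal part, $A_M^{\top}$ zero diagonal); $x^{\ast}:=\frac12\sum_{\ell\ge0}(\frac12(I+D_M^{-1}A_M^{\top}))^{\ell}D_M^{-1}b$. $\mathrm{nnz}(M)$ = number of nonzero entries. Access: diagonal of $M$ in $O(1)$; nonzero entries of rows/columns of $M$ in time linear in their number; entries of $b,t$ in $O(1)$. The algorithm is given $\varepsilon>0$, $0<\gamma\le\gamma_{\max}(M)$ with $\gamma_{\max}(M)=\max_{p\in[1,\infty]}\big(1-\|\frac12(I+D_M^{-1/q}A_M^{\top}D_M^{-1/p})|_{\operatorname{range}(I-D_M^{-1/q}A_M^{\top}D_M^{-1/p})}\|_p\big)$,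 $q$ conjugate to $p$; $L=\Theta\big(\frac1\gamma\log(\frac{1}{\gamma E}d_{\max}(M)\|t\|_0\|D_M^{-1}t\|_\infty\|b\|_0\|D_M^{-1}b\|_\infty)\big)$, $E$ the target accuracy, with suitable bounds on quantities in the log known. $f_{\mathrm{row}}(M)$: maximum time to simulate one step of the (possibly terminating) random walk with transition matrix $\frac12(I+D_M^{-1}|A_M^{\top}|)$. *)

theory Defs
  imports "Jordan_Normal_Form.Matrix" "HOL-Probability.SPMF"
begin

unbundle no vec_syntax
hide_const (open) Finite_Cartesian_Product.vec Finite_Cartesian_Product.mat
  Finite_Cartesian_Product.row Determinants.det
hide_type (open) Finite_Cartesian_Product.vec

section \<open>Matrices, norms and the quantity to be estimated\<close>

definition RDD :: "real mat \<Rightarrow> bool" where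
  "RDD M \<longleftrightarrow> (\<forall>j<dim_row M. 0 < M $$ (j,j) \<and>
     (\<Sum>k\<in>{..<dim_col M} - {j}. \<bar>M $$ (j,k)\<bar>) \<le> M $$ (j,j))"

definition diag_powr :: "real mat \<Rightarrow> real \<Rightarrow> real mat" where
  "diag_powr M s = Matrix.mat (dim_row M) (dim_row M)
     (\<lambda>(i,j). if i = j then M $$ (i,i) powr s else 0)"

definition diag_part :: "real mat \<Rightarrow> real mat" where
  "diag_part M = Matrix.mat (dim_row M) (dim_row M) (\<lambda>(i,j). if i = j then M $$ (i,i) else 0)"

text \<open>The matrix \<open>A\<^sub>M\<^sup>T\<close> in the splitting \<open>M = D\<^sub>M - A\<^sub>M\<^sup>T\<close>.\<close>

definition AT :: "real mat \<Rightarrow> real mat" where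
  "AT M = diag_part M - M"

definition x_star :: "real mat \<Rightarrow> real Matrix.vec \<Rightarrow> real Matrix.vec" where
  "x_star M b = (let W = (1/2) \<cdot>\<^sub>m (1\<^sub>m (dim_row M) + diag_powr M (-1) * AT M) in
     Matrix.vec (dim_row M)
       (\<lambda>i. 1/2 * (\<Sum>l. ((W ^\<^sub>m l) *\<^sub>v (diag_powr M (-1) *\<^sub>v b)) $ i)))"

definition mat_range :: "real mat \<Rightarrow> real Matrix.vec set" where
  "mat_range B = {B *\<^sub>v x | x. x \<in> carrier_vec (dim_col B)}"

definition pnorm :: "ereal \<Rightarrow> real Matrix.vec \<Rightarrow> real" where
  "pnorm p v = (if p = \<infinity> then Max ((\<lambda>i. \<bar>v $ i\<bar>) ` {..<dim_vec v})
     else (\<Sum>i<dim_vec v. \<bar>v $ i\<bar> powr real_of_ereal p) powr (1 / real_of_ereal p))"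

definition op_pnorm_on :: "ereal \<Rightarrow> real mat \<Rightarrow> real Matrix.vec set \<Rightarrow> real" where
  "op_pnorm_on p B S = (SUP v\<in>{v \<in> S. pnorm p v \<le> 1}. pnorm p (B *\<^sub>v v))"

text \<open>\<open>D\<^sub>M\<close> to the \<open>-1/q\<close>, times \<open>A\<^sub>M\<^sup>T\<close>, times \<open>D\<^sub>M\<close> to the \<open>-1/p\<close>, where \<open>1/q = 1 - 1/p\<close>
  and \<open>1/\<infinity> = 0\<close>.\<close>

definition scaled_AT :: "real mat \<Rightarrow> ereal \<Rightarrow> real mat" where
  "scaled_AT M p = (let u = real_of_ereal (1 / p) in
     diag_powr M (- (1 - u)) * AT M * diag_powr M (- u))"

text \<open>The supremum over \<open>p\<close> is a maximum: the operand depends continuously on \<open>1/p\<close>, which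
  ranges over \<open>[0,1]\<close>.\<close>

definition gamma_max :: "real mat \<Rightarrow> real" where
  "gamma_max M = (SUP p\<in>{1..\<infinity>}. 1 - op_pnorm_on p
     ((1/2) \<cdot>\<^sub>m (1\<^sub>m (dim_row M) + scaled_AT M p))
     (mat_range (1\<^sub>m (dim_row M) - scaled_AT M p)))"

definition nnz :: "real mat \<Rightarrow> nat" where
  "nnz M = card {(i,j). i < dim_row M \<and> j < dim_col M \<and> M $$ (i,j) \<noteq> 0}"

definition norm0 :: "real Matrix.vec \<Rightarrow> nat" where
  "norm0 v = card {i. i < dim_vec v \<and> v $ i \<noteq> 0}"

definition d_max :: "real mat \<Rightarrow> real" where
  "d_max M = Max ((\<lambda>j. M $$ (j,j)) ` {..<dim_row M})"

text \<open>The scale of the truncation length \<open>L\<close> for target accuracy \<open>E\<close>.  The logarithm is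
  cut off at 1 from below, since its argument may be smaller than 1 when \<open>E\<close> is large.\<close>

definition L_scale ::
    "real mat \<Rightarrow> real Matrix.vec \<Rightarrow> real Matrix.vec \<Rightarrow> real \<Rightarrow> real \<Rightarrow> real" where
  "L_scale M t b \<gamma> E = 1 / \<gamma> * max 1 (ln (1 / (\<gamma> * E) * d_max M
      * real (norm0 t) * pnorm \<infinity> (diag_powr M (-1) *\<^sub>v t)
      * real (norm0 b) * pnorm \<infinity> (diag_powr M (-1) *\<^sub>v b)))"

definition poly_bounded :: "real poly \<Rightarrow> nat \<Rightarrow> real set \<Rightarrow> bool" where
  "poly_bounded Q n S \<longleftrightarrow>
     (\<forall>a\<in>S. a \<noteq> 0 \<longrightarrow> 1 / poly Q (real n) \<le> \<bar>a\<bar> \<and> \<bar>a\<bar> \<le> poly Q (real n))"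

section \<open>Access to the input\<close>

text \<open>An implementation of the access to \<open>M\<close>: the order in which the nonzero positions of
  each row and column are listed, and the time needed to simulate one step of the random walk
  from each vertex.\<close>

record access =
  row_list :: "nat \<Rightarrow> nat list"
  col_list :: "nat \<Rightarrow> nat list"
  step_time :: "nat \<Rightarrow> nat"

definition valid_access :: "real mat \<Rightarrow> access \<Rightarrow> bool" where
  "valid_access M acc \<longleftrightarrow>
     (\<forall>j<dim_row M. distinct (row_list acc j) \<and>
        set (row_list acc j) = {k. k < dim_col M \<and> M $$ (j,k) \<noteq> 0}) \<and>
     (\<forall>k<dim_col M. distinct (col_list acc k) \<and>
        set (col_list acc k) = {j. j < dim_row M \<and> M $$ (j,k) \<noteq> 0}) \<and>
     (\<forall>j<dim_row M. 1 \<le> step_time acc j)"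

definition f_row :: "real mat \<Rightarrow> access \<Rightarrow> nat" where
  "f_row M acc = Max (step_time acc ` {..<dim_row M})"

text \<open>One step from \<open>j\<close> of the random walk with (substochastic) transition matrix
  \<open>1/2 (I + D\<^sub>M\<^sup>-\<^sup>1 |A\<^sub>M\<^sup>T|)\<close>; the missing mass is the probability of termination.\<close>

definition walk_step :: "real mat \<Rightarrow> nat \<Rightarrow> nat spmf" where
  "walk_step M j = embed_spmf (\<lambda>k. if k < dim_row M
     then 1/2 * ((if k = j then 1 else 0) + \<bar>AT M $$ (j,k)\<bar> / M $$ (j,j)) else 0)"

definition sample_abs :: "real Matrix.vec \<Rightarrow> nat pmf" where
  "sample_abs t = embed_pmf (\<lambda>j. if j < dim_vec t then \<bar>t $ j\<bar> / pnorm 1 t else 0)"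

section \<open>A randomized real RAM\<close>

text \<open>Registers and two-dimensional arrays hold natural numbers or reals.  On
  natural numbers only addition and (truncated) subtraction are available, on reals the field
  operations; reals cannot be rounded to natural numbers.  Register and array names are fixed in the
  program text, so that an expression is evaluated in constant time.\<close>

datatype iexp = INat nat | IReg nat | IArr nat iexp iexp | IAdd iexp iexp | ISub iexp iexp

datatype rexp = ROfNat iexp | RReg nat | RArr nat iexp iexp
  | RAdd rexp rexp | RSub rexp rexp | RMul rexp rexp | RDiv rexp rexp

datatype bexp = ILess iexp iexp | RLess rexp rexp | BNot bexp | BAnd bexp bexp

datatype com =
    Skip
  | ISet nat iexp
  | RSet nat rexp
  | IStore nat iexp iexp iexp
  | RStore nat iexp iexp rexp
  | Seq com com
  | Cond bexp com com
  | While bexp com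
  | Uniform nat iexp \<comment> \<open>a uniformly random element of \<open>{0..m}\<close>\<close>
  | GetDiag nat iexp
  | GetB nat iexp
  | GetT nat iexp
  | LoadRow nat nat iexp
  | LoadCol nat nat iexp
  | SampleT nat
  | Step nat nat iexp

record state =
  ireg :: "nat \<Rightarrow> nat"
  rreg :: "nat \<Rightarrow> real"
  iarr :: "nat \<Rightarrow> nat \<Rightarrow> nat \<Rightarrow> nat"
  rarr :: "nat \<Rightarrow> nat \<Rightarrow> nat \<Rightarrow> real"
  clock :: nat

primrec ival :: "iexp \<Rightarrow> state \<Rightarrow> nat" where
  "ival (INat k) s = k"
| "ival (IReg x) s = ireg s x"
| "ival (IArr a i j) s = iarr s a (ival i s) (ival j s)"
| "ival (IAdd e f) s = ival e s + ival f s"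
| "ival (ISub e f) s = ival e s - ival f s"

primrec rval :: "rexp \<Rightarrow> state \<Rightarrow> real" where
  "rval (ROfNat e) s = real (ival e s)"
| "rval (RReg x) s = rreg s x"
| "rval (RArr a i j) s = rarr s a (ival i s) (ival j s)"
| "rval (RAdd e f) s = rval e s + rval f s"
| "rval (RSub e f) s = rval e s - rval f s"
| "rval (RMul e f) s = rval e s * rval f s"
| "rval (RDiv e f) s = rval e s / rval f s"

primrec bval :: "bexp \<Rightarrow> state \<Rightarrow> bool" where
  "bval (ILess e f) s = (ival e s < ival f s)"
| "bval (RLess e f) s = (rval e s < rval f s)"
| "bval (BNot b) s = (\<not> bval b s)"
| "bval (BAnd b c) s = (bval b s \<and> bval c s)"

definition spend :: "nat \<Rightarrow> state \<Rightarrow> state" where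
  "spend k s = s\<lparr>clock := clock s + k\<rparr>"

definition set_ireg :: "nat \<Rightarrow> nat \<Rightarrow> state \<Rightarrow> state" where
  "set_ireg x v s = s\<lparr>ireg := (ireg s)(x := v)\<rparr>"

definition set_rreg :: "nat \<Rightarrow> real \<Rightarrow> state \<Rightarrow> state" where
  "set_rreg x v s = s\<lparr>rreg := (rreg s)(x := v)\<rparr>"

definition set_iarr :: "nat \<Rightarrow> nat \<Rightarrow> nat \<Rightarrow> nat \<Rightarrow> state \<Rightarrow> state" where
  "set_iarr a i j v s = s\<lparr>iarr := (iarr s)(a := (iarr s a)(i := (iarr s a i)(j := v)))\<rparr>"

definition set_rarr :: "nat \<Rightarrow> nat \<Rightarrow> nat \<Rightarrow> real \<Rightarrow> state \<Rightarrow> state" where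
  "set_rarr a i j v s = s\<lparr>rarr := (rarr s)(a := (rarr s a)(i := (rarr s a i)(j := v)))\<rparr>"

text \<open>Copies a list of indices and the corresponding matrix entries to row 0 of the arrays
  named \<open>a\<close>, stores the length of the list in register \<open>x\<close>, and takes time linear in it.\<close>

definition load_list :: "nat \<Rightarrow> nat \<Rightarrow> nat list \<Rightarrow> (nat \<Rightarrow> real) \<Rightarrow> state \<Rightarrow> state" where
  "load_list x a ks val s = spend (1 + length ks) (set_ireg x (length ks)
     (fold (\<lambda>i s'. set_iarr a 0 i (ks ! i) (set_rarr a 0 i (val (ks ! i)) s'))
        [0..<length ks] s))"

partial_function (spmf) while_spmf ::
    "('s \<Rightarrow> bool) \<Rightarrow> ('s \<Rightarrow> 's spmf) \<Rightarrow> 's \<Rightarrow> 's spmf" where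
  "while_spmf g c s = (if g s then bind_spmf (c s) (while_spmf g c) else return_spmf s)"

text \<open>The missing mass of \<open>exec M b t acc P s\<close> is the probability that the run diverges.
  A step of the random walk reports the new vertex \<open>k\<close> together with the matrix entry \<open>M(j,k)\<close> at
  the position it used (needed for its sign); termination of the walk is reported as vertex \<open>n\<close>.\<close>

primrec exec ::
    "real mat \<Rightarrow> real Matrix.vec \<Rightarrow> real Matrix.vec \<Rightarrow> access \<Rightarrow> com \<Rightarrow> state \<Rightarrow> state spmf"
where
  "exec M b t acc Skip s = return_spmf s"
| "exec M b t acc (ISet x e) s = return_spmf (spend 1 (set_ireg x (ival e s) s))"
| "exec M b t acc (RSet x e) s = return_spmf (spend 1 (set_rreg x (rval e s) s))"
| "exec M b t acc (IStore a i j e) s =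
     return_spmf (spend 1 (set_iarr a (ival i s) (ival j s) (ival e s) s))"
| "exec M b t acc (RStore a i j e) s =
     return_spmf (spend 1 (set_rarr a (ival i s) (ival j s) (rval e s) s))"
| "exec M b t acc (Seq c d) s = bind_spmf (exec M b t acc c s) (exec M b t acc d)"
| "exec M b t acc (Cond g c d) s =
     (if bval g s then exec M b t acc c (spend 1 s) else exec M b t acc d (spend 1 s))"
| "exec M b t acc (While g c) s =
     map_spmf (spend 1) (while_spmf (bval g) (\<lambda>s'. exec M b t acc c (spend 1 s')) s)"
| "exec M b t acc (Uniform x e) s =
     map_spmf (\<lambda>k. spend 1 (set_ireg x k s)) (spmf_of_set {..ival e s})"
| "exec M b t acc (GetDiag x e) s =
     return_spmf (spend 1 (set_rreg x (M $$ (ival e s, ival e s)) s))"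
| "exec M b t acc (GetB x e) s = return_spmf (spend 1 (set_rreg x (b $ ival e s) s))"
| "exec M b t acc (GetT x e) s = return_spmf (spend 1 (set_rreg x (t $ ival e s) s))"
| "exec M b t acc (LoadRow x a e) s = (let j = ival e s in
     return_spmf (load_list x a (row_list acc j) (\<lambda>k. M $$ (j,k)) s))"
| "exec M b t acc (LoadCol x a e) s = (let k = ival e s in
     return_spmf (load_list x a (col_list acc k) (\<lambda>j. M $$ (j,k)) s))"
| "exec M b t acc (SampleT x) s =
     map_spmf (\<lambda>j. spend 1 (set_ireg x j s)) (spmf_of_pmf (sample_abs t))"
| "exec M b t acc (Step x y e) s = (let j = ival e s in
     map_spmf (\<lambda>r. spend (step_time acc j) (case r of
         None \<Rightarrow> set_ireg x (dim_row M) (set_rreg y 0 s)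
       | Some k \<Rightarrow> set_ireg x k (set_rreg y (M $$ (j,k)) s)))
     (spmf_of_pmf (walk_step M j)))"

text \<open>The known quantities are \<open>n\<close>, \<open>w\<close>, \<open>L\<close>, \<open>nnz(M)\<close>, \<open>f\<^sub>r\<^sub>o\<^sub>w(M)\<close> (natural) and
  \<open>\<epsilon>\<close>, \<open>\<gamma>\<close>, the 1-norm of \<open>t\<close> (real); the estimate is left in real register 0.\<close>

definition initial ::
    "real mat \<Rightarrow> real Matrix.vec \<Rightarrow> access \<Rightarrow> nat \<Rightarrow> nat \<Rightarrow> real \<Rightarrow> real \<Rightarrow> state" where
  "initial M t acc w L \<epsilon> \<gamma> =
     \<lparr>ireg = (\<lambda>_. 0)(0 := dim_row M, 1 := w, 2 := L, 3 := nnz M, 4 := f_row M acc),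
      rreg = (\<lambda>_. 0)(0 := \<epsilon>, 1 := \<gamma>, 2 := pnorm 1 t),
      iarr = (\<lambda>_ _ _. 0), rarr = (\<lambda>_ _ _. 0), clock = 0\<rparr>"

definition result :: "state \<Rightarrow> real" where
  "result s = rreg s 0"

text \<open>All runs halt within time \<open>T\<close>: an infinite run would have a finite prefix of positive
  probability that takes longer than \<open>T\<close>.\<close>

definition halts_within :: "state spmf \<Rightarrow> nat \<Rightarrow> bool" where
  "halts_within p T \<longleftrightarrow> lossless_spmf p \<and> (\<forall>s\<in>set_spmf p. clock s \<le> T)"

end

theory Submission
  imports Defs
begin

text \<open>
  Let \<open>W = 1/2 (I + D\<^sup>-\<^sup>1 A\<^sup>T)\<close>, a matrix whose rows have absolute sum at most 1.  By the definition of
  \<open>gamma_max\<close> the series for \<open>x\<^sup>*\<close> may be truncated after \<open>L\<close> terms, so it suffices to estimate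
  \<open>t\<^sup>T (\<Sum>l<L. W\<^sup>l v)\<close> for \<open>v = D\<^sup>-\<^sup>1 e\<^sub>w\<close>.  Keep a residual vector \<open>u\<^sub>l\<close> for each level \<open>l\<close>, initially
  \<open>u\<^sub>0 = v\<close>.  Pushing an entry of \<open>u\<^sub>l\<close> adds its contribution to an exact partial result and moves it
  through \<open>W\<close> into \<open>u\<^sub>l\<^sub>+\<^sub>1\<close>.  Entries are pushed while they exceed \<open>1 / (h d)\<close>, where \<open>d = M(w,w)\<close>.  A push
  at \<open>(l,k)\<close> consumes more than \<open>1/h\<close> of the weight \<open>(|W|\<^sup>l)(k,w)\<close>, and these weights sum to at most 1
  over \<open>w\<close>, so on average over \<open>w\<close> the pushes cost at most \<open>L (h - 1) nnz(M) / n\<close>.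

  What is left is \<open>t\<^sup>T (\<Sum>j + l < L. W\<^sup>j u\<^sub>l)\<close>.  It is the mean of \<open>\<parallel>t\<parallel>\<^sub>1 L\<^sup>2 \<sigma> u\<^sub>l(X\<^sub>j)\<close>, or 0 if \<open>j + l \<ge> L\<close>,
  over independent uniform \<open>j, l < L\<close> and a signed random walk \<open>X\<close> started from \<open>|t| / \<parallel>t\<parallel>\<^sub>1\<close>.  Since
  \<open>|u\<^sub>l| \<le> 1 / (h d)\<close>, Chebyshev's inequality asks for \<open>4 (\<parallel>t\<parallel>\<^sub>1 L\<^sup>2 / (h \<epsilon>))\<^sup>2\<close> walks; if
  \<open>\<parallel>t\<parallel>\<^sub>1 L\<^sup>2 \<le> h \<epsilon>\<close>, the remainder is negligible and no walk is made.  The two costs balance at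
  \<open>h\<^sup>3 = \<parallel>t\<parallel>\<^sub>1\<^sup>2 L\<^sup>4 f\<^sub>r\<^sub>o\<^sub>w n / (nnz(M) \<epsilon>\<^sup>2)\<close>.
\<close>

section \<open>Expectation bounds for terminating programs\<close>

text \<open>Taking \<open>f\<close> to be the indicator of failure, \<open>v\<close> bounds the failure probability.\<close>

definition ensures :: "'a spmf \<Rightarrow> ('a \<Rightarrow> bool) \<Rightarrow> ('a \<Rightarrow> real) \<Rightarrow> real \<Rightarrow> bool" where
  "ensures p Q f v \<longleftrightarrow> (\<exists>p'. p = spmf_of_pmf p' \<and> finite (set_pmf p') \<and>
     (\<forall>s\<in>set_pmf p'. Q s) \<and> measure_pmf.expectation p' f \<le> v)"

lemma ensures_return: "Q s \<Longrightarrow> f s \<le> v \<Longrightarrow> ensures (return_spmf s) Q f v"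
  unfolding ensures_def
  by (rule exI[of _ "return_pmf s"]) auto

lemma ensures_pmf:
  assumes "finite A" "set_pmf p \<subseteq> A" "\<And>s. s \<in> set_pmf p \<Longrightarrow> Q s" "(\<Sum>a\<in>A. pmf p a * f a) \<le> v"
  shows "ensures (spmf_of_pmf p) Q f v"
  unfolding ensures_def
proof (intro exI conjI ballI)
  show "finite (set_pmf p)" using assms finite_subset by blast
  have "measure_pmf.expectation p f = (\<Sum>a\<in>A. f a * pmf p a)"
    by (rule integral_measure_pmf_real[OF assms(1)]) (use assms in auto)
  then show "measure_pmf.expectation p f \<le> v" using assms(4) by (simp add: mult.commute)
qed (use assms in auto)

text \<open>The law of total expectation: \<open>g s\<close> is the value promised for the
  continuation from \<open>s\<close>, and its mean bounds the mean of \<open>f\<close>. Finite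
  supports turn all expectations into finite sums.\<close>

lemma ensures_bind:
  assumes p: "ensures p R g v" and q: "\<And>s. R s \<Longrightarrow> ensures (q s) Q f (g s)"
  shows "ensures (bind_spmf p q) Q f v"
proof -
  obtain p' where p': "p = spmf_of_pmf p'" "finite (set_pmf p')" "\<forall>s\<in>set_pmf p'. R s"
      "measure_pmf.expectation p' g \<le> v"
    using p unfolding ensures_def by blast
  have "\<forall>s. \<exists>q'. R s \<longrightarrow> q s = spmf_of_pmf q' \<and> finite (set_pmf q') \<and>
     (\<forall>s\<in>set_pmf q'. Q s) \<and> measure_pmf.expectation q' f \<le> g s"
    using q unfolding ensures_def by blast
  then obtain q' where q': "\<And>s. R s \<Longrightarrow> q s = spmf_of_pmf (q' s) \<and> finite (set_pmf (q' s)) \<and>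
     (\<forall>s\<in>set_pmf (q' s). Q s) \<and> measure_pmf.expectation (q' s) f \<le> g s"
    by metis
  have "bind_spmf p q = bind_pmf p' (\<lambda>s. spmf_of_pmf (q' s))"
    unfolding p'(1) bind_spmf_of_pmf
    by (rule bind_pmf_cong) (use p' q' in auto)
  then have eq: "bind_spmf p q = spmf_of_pmf (bind_pmf p' q')"
    by (simp add: spmf_of_pmf_bind)
  have "measure_pmf.expectation (bind_pmf p' q') f
      = (\<Sum>a\<in>set_pmf p'. pmf p' a *\<^sub>R measure_pmf.expectation (q' a) f)"
    by (rule pmf_expectation_bind) (use p' q' in auto)
  also have "\<dots> \<le> (\<Sum>a\<in>set_pmf p'. pmf p' a * g a)"
    by (rule sum_mono) (use p' q' in \<open>simp add: mult_left_mono\<close>)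
  also have "\<dots> = (\<Sum>a\<in>set_pmf p'. g a * pmf p' a)"
    by (simp add: mult.commute)
  also have "\<dots> = measure_pmf.expectation p' g"
    by (rule integral_measure_pmf_real[symmetric]) (use p' in auto)
  finally show ?thesis
    unfolding ensures_def eq using p' q' by (intro exI[of _ "bind_pmf p' q'"]) auto
qed

text \<open>Linearity and monotonicity of expectation, with \<open>a\<close> nonnegative because
  \<open>ensures\<close> bounds means only from above. It serves to normalise a second moment for
  Chebyshev's inequality and to pass from a linear to a quadratic quantity in
  \<open>sample_loop_spec\<close>.\<close>

lemma ensures_affine:
  assumes p: "ensures p Q f v" and "\<And>s. Q s \<Longrightarrow> Q' s" "\<And>s. Q s \<Longrightarrow> f' s \<le> a * f s + b"
    "0 \<le> a" "a * v + b \<le> v'"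
  shows "ensures p Q' f' v'"
proof -
  obtain p' where p': "p = spmf_of_pmf p'" "finite (set_pmf p')" "\<forall>s\<in>set_pmf p'. Q s"
      "measure_pmf.expectation p' f \<le> v"
    using p unfolding ensures_def by blast
  have "measure_pmf.expectation p' f' \<le> measure_pmf.expectation p' (\<lambda>s. a * f s + b)"
    by (rule integral_mono_AE)
      (use p' assms in \<open>auto intro: integrable_measure_pmf_finite AE_pmfI\<close>)
  also have "\<dots> = a * measure_pmf.expectation p' f + b"
    using p' by (subst Bochner_Integration.integral_add)
      (auto intro: integrable_measure_pmf_finite)
  also have "\<dots> \<le> a * v + b" using p' assms by (simp add: mult_left_mono)
  finally show ?thesis unfolding ensures_def using p' assms by (intro exI[of _ p']) auto
qed

lemma ensures_conseq:
  assumes "ensures p Q f v" "\<And>s. Q s \<Longrightarrow> Q' s" "\<And>s. Q s \<Longrightarrow> f' s \<le> f s" "v \<le> v'"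
  shows "ensures p Q' f' v'"
  by (rule ensures_affine[where a = 1 and b = 0, OF assms(1)]) (use assms in auto)

lemma ensures_map:
  assumes "ensures p (\<lambda>s. Q (h s)) (\<lambda>s. f (h s)) v"
  shows "ensures (map_spmf h p) Q f v"
  unfolding map_spmf_conv_bind_spmf
  by (rule ensures_bind[OF assms]) (auto intro: ensures_return)

text \<open>Here \<open>f\<close> acts as a supermartingale. Since \<open>m\<close> falls on every
  outcome of the body, and not just on average, the number of rounds is bounded and the support
  stays finite.\<close>

lemma ensures_while:
  fixes m :: "'a \<Rightarrow> nat"
  assumes body: "\<And>s. I s \<Longrightarrow> g s \<Longrightarrow> ensures (c s) (\<lambda>s'. I s' \<and> m s' < m s) f (f s)"
    and "I s"
  shows "ensures (while_spmf g c s) (\<lambda>s'. I s' \<and> \<not> g s') f (f s)"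
  using \<open>I s\<close>
proof (induction "m s" arbitrary: s rule: less_induct)
  case less
  show ?case
  proof (cases "g s")
    case True
    show ?thesis
      unfolding while_spmf.simps[of g c s] using True
      by simp (rule ensures_bind[OF body], use less True in auto)
  next
    case False
    then show ?thesis
      unfolding while_spmf.simps[of g c s] using less by (auto intro: ensures_return)
  qed
qed

text \<open>The clock itself supplies the termination measure \<open>T - clock s\<close>, so a time
  bound contained in the invariant proves termination as well.\<close>

lemma ensures_exec_while:
  assumes body: "\<And>s. I s \<Longrightarrow> bval g s \<Longrightarrow>
      ensures (exec M b t acc c (spend 1 s)) (\<lambda>s'. I s' \<and> clock s < clock s') f (f s)"
    and bound: "\<And>s. I s \<Longrightarrow> clock s \<le> T" and "I s"
    and post: "\<And>s'. I s' \<Longrightarrow> \<not> bval g s' \<Longrightarrow> Q (spend 1 s') \<and> f' (spend 1 s') \<le> f s'"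
    and v: "f s \<le> v"
  shows "ensures (exec M b t acc (While g c) s) Q f' v"
  unfolding exec.simps
proof (rule ensures_map, rule ensures_conseq)
  show "ensures (while_spmf (bval g) (\<lambda>s'. exec M b t acc c (spend 1 s')) s)
      (\<lambda>s'. I s' \<and> \<not> bval g s') f (f s)"
  proof (rule ensures_while[where m = "\<lambda>s. T - clock s"])
    fix s assume "I s" "bval g s"
    show "ensures (exec M b t acc c (spend 1 s)) (\<lambda>s'. I s' \<and> T - clock s' < T - clock s) f (f s)"
      by (rule ensures_conseq[OF body[OF \<open>I s\<close> \<open>bval g s\<close>]])
        (use bound in \<open>fastforce intro: diff_less_mono2 less_le_trans\<close>)+
  qed fact
qed (use post v in auto)

lemma ensures_seq:
  assumes "ensures (exec M b t acc c s) R g v"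
    "\<And>s. R s \<Longrightarrow> ensures (exec M b t acc d s) Q f (g s)"
  shows "ensures (exec M b t acc (Seq c d) s) Q f v"
  using ensures_bind[OF assms] by simp

lemma ensures_halts_within:
  assumes "ensures p (\<lambda>s. clock s \<le> T) f v"
  shows "halts_within p T"
  using assms unfolding ensures_def halts_within_def by auto

lemma ensures_measure_ge:
  assumes "ensures p Q (\<lambda>s. if s \<in> A then 0 else 1) v"
  shows "measure (measure_spmf p) A \<ge> 1 - v"
proof -
  obtain p' where p': "p = spmf_of_pmf p'" 
      "measure_pmf.expectation p' (\<lambda>s. if s \<in> A then 0 else 1) \<le> v"
    using assms unfolding ensures_def by blast
  have "(\<lambda>s. if s \<in> A then 0 else 1 :: real) = indicator (- A)" by (auto simp: indicator_def)
  then have "measure_pmf.prob p' (- A) \<le> v" using p'(2) by simp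
  moreover have "measure_pmf.prob p' (- A) = 1 - measure_pmf.prob p' A"
    using measure_pmf.prob_compl[of A p'] by (simp add: Compl_eq_Diff_UNIV)
  ultimately show ?thesis unfolding p'(1) by simp
qed

section \<open>Residuals and pushes\<close>

definition app :: "nat \<Rightarrow> (nat \<Rightarrow> nat \<Rightarrow> real) \<Rightarrow> (nat \<Rightarrow> real) \<Rightarrow> nat \<Rightarrow> real" where
  "app n W f i = (\<Sum>k<n. W i k * f k)"

text \<open>This is \<open>t^T (I + W + ... + W^(m-1)) f\<close>, a truncated Neumann series.
  Vectors are plain functions so that rows of the program's residual array can be inserted
  directly.\<close>

definition walk_sum :: "nat \<Rightarrow> (nat \<Rightarrow> nat \<Rightarrow> real) \<Rightarrow> (nat \<Rightarrow> real) \<Rightarrow> nat \<Rightarrow> (nat \<Rightarrow> real) \<Rightarrow> real" where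
  "walk_sum n W t m f = (\<Sum>j<m. \<Sum>i<n. t i * (app n W ^^ j) f i)"

definition substochastic :: "nat \<Rightarrow> (nat \<Rightarrow> nat \<Rightarrow> real) \<Rightarrow> bool" where
  "substochastic n W \<longleftrightarrow> (\<forall>i<n. (\<Sum>k<n. \<bar>W i k\<bar>) \<le> 1)"

lemma app_lin: "app n W (\<lambda>i. f i + c * g i) = (\<lambda>i. app n W f i + c * app n W g i)"
  by (auto simp: app_def sum.distrib sum_distrib_left algebra_simps intro!: ext)

lemma app_pow_lin:
  "(app n W ^^ j) (\<lambda>i. f i + c * g i) = (\<lambda>i. (app n W ^^ j) f i + c * (app n W ^^ j) g i)"
  by (induction j) (auto simp: app_lin)

text \<open>The form \<open>f + c * g\<close> fits a push, which removes a multiple of a unit vector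
  at one level and adds a multiple of a column of \<open>W\<close> at the next.\<close>

lemma walk_sum_lin:
  "walk_sum n W t m (\<lambda>i. f i + c * g i) = walk_sum n W t m f + c * walk_sum n W t m g"
  by (simp add: walk_sum_def app_pow_lin sum.distrib sum_distrib_left algebra_simps)

text \<open>Splitting off \<open>j = 0\<close> leaves a shorter sum that starts from
  \<open>W f\<close>; this exchange is what a push performs.\<close>

lemma walk_sum_Suc:
  "walk_sum n W t (Suc m) f = (\<Sum>i<n. t i * f i) + walk_sum n W t m (app n W f)"
  by (simp add: walk_sum_def sum.lessThan_Suc_shift funpow_swap1 del: sum.lessThan_Suc)

text \<open>Absolute row sums at most 1 make \<open>W\<close> nonexpansive in the maximum
  norm.\<close>

lemma app_pow_bound:
  assumes "substochastic n W" "\<And>i. i < n \<Longrightarrow> \<bar>f i\<bar> \<le> c" "0 \<le> c" "i < n"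
  shows "\<bar>(app n W ^^ j) f i\<bar> \<le> c"
  using \<open>i < n\<close>
proof (induction j arbitrary: i)
  case (Suc j)
  have "\<bar>(app n W ^^ Suc j) f i\<bar> \<le> (\<Sum>k<n. \<bar>W i k * (app n W ^^ j) f k\<bar>)"
    by (simp add: app_def)
  also have "\<dots> \<le> (\<Sum>k<n. \<bar>W i k\<bar> * c)"
    by (rule sum_mono) (use Suc in \<open>auto simp: abs_mult intro: mult_left_mono\<close>)
  also have "\<dots> = (\<Sum>k<n. \<bar>W i k\<bar>) * c" by (simp add: sum_distrib_right)
  also have "\<dots> \<le> 1 * c"
    using assms(1,3) Suc.prems by (intro mult_right_mono) (auto simp: substochastic_def)
  finally show ?case by simp
qed (use assms in auto)

lemma weighted_app_pow_bound:
  assumes "substochastic n W" "\<And>i. i < n \<Longrightarrow> \<bar>f i\<bar> \<le> c" "0 \<le> c"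
  shows "\<bar>\<Sum>i<n. t i * (app n W ^^ j) f i\<bar> \<le> (\<Sum>i<n. \<bar>t i\<bar>) * c"
proof -
  have "\<bar>\<Sum>i<n. t i * (app n W ^^ j) f i\<bar> \<le> (\<Sum>i<n. \<bar>t i * (app n W ^^ j) f i\<bar>)"
    by (rule sum_abs)
  also have "\<dots> \<le> (\<Sum>i<n. \<bar>t i\<bar> * c)"
    by (rule sum_mono) (use assms in \<open>auto simp: abs_mult intro!: mult_left_mono app_pow_bound\<close>)
  finally show ?thesis by (simp add: sum_distrib_right)
qed

lemma walk_sum_bound:
  assumes "substochastic n W" "\<And>i. i < n \<Longrightarrow> \<bar>f i\<bar> \<le> c" "0 \<le> c"
  shows "\<bar>walk_sum n W t m f\<bar> \<le> real m * ((\<Sum>i<n. \<bar>t i\<bar>) * c)"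
proof -
  have "\<bar>walk_sum n W t m f\<bar> \<le> (\<Sum>j<m. \<bar>\<Sum>i<n. t i * (app n W ^^ j) f i\<bar>)"
    unfolding walk_sum_def by (rule sum_abs)
  also have "\<dots> \<le> (\<Sum>j<m. (\<Sum>i<n. \<bar>t i\<bar>) * c)"
    by (rule sum_mono) (rule weighted_app_pow_bound[OF assms])
  finally show ?thesis by simp
qed

text \<open>A residual at level \<open>l\<close> has already made \<open>l\<close> steps, so only
  \<open>L - l\<close> terms of the series remain for it. Level \<open>L\<close> contributes an
  empty sum but receives what is pushed from level \<open>L - 1\<close>.\<close>

definition potential ::
    "nat \<Rightarrow> (nat \<Rightarrow> nat \<Rightarrow> real) \<Rightarrow> (nat \<Rightarrow> real) \<Rightarrow> nat \<Rightarrow> (nat \<Rightarrow> nat \<Rightarrow> real) \<Rightarrow> real" where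
  "potential n W t L u = (\<Sum>l\<le>L. walk_sum n W t (L - l) (u l))"

definition push_upd ::
    "(nat \<Rightarrow> nat \<Rightarrow> real) \<Rightarrow> nat \<Rightarrow> nat \<Rightarrow> real \<Rightarrow> (nat \<Rightarrow> nat \<Rightarrow> real) \<Rightarrow> nat \<Rightarrow> nat \<Rightarrow> real" where
  "push_upd W l k x u = u(l := (u l)(k := 0), Suc l := (\<lambda>j. u (Suc l) j + x * W j k))"

lemma potential_initial:
  "potential n W t L (\<lambda>l. if l = 0 then f else (\<lambda>_. 0)) = walk_sum n W t L f"
proof -
  have z: "walk_sum n W t m (\<lambda>_. 0) = 0" for m
    using walk_sum_lin[of n W t m f "-1" f] by simp
  have "potential n W t L (\<lambda>l. if l = 0 then f else (\<lambda>_. 0))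
      = (\<Sum>l\<le>L. if l = 0 then walk_sum n W t L f else 0)"
    unfolding potential_def by (rule sum.cong) (auto simp: z)
  then show ?thesis by simp
qed

text \<open>By linearity only the unit vector at \<open>k\<close> matters: its sum of length
  \<open>L - l\<close> equals \<open>t k\<close> plus the sum of length \<open>L - Suc l\<close>
  started from column \<open>k\<close> of \<open>W\<close>.\<close>

lemma potential_push:
  assumes "l < L" "k < n"
  shows "t k * u l k + potential n W t L (push_upd W l k (u l k) u) = potential n W t L u"
proof -
  let ?x = "u l k" and ?e = "\<lambda>i. if i = k then 1 else (0::real)"
  let ?u' = "push_upd W l k ?x u"
  have A: "{..L} = insert l (insert (Suc l) ({..L} - {l, Suc l}))" using assms by auto
  have split: "potential n W t L v = walk_sum n W t (L - l) (v l) + walk_sum n W t (L - Suc l) (v (Suc l))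
      + (\<Sum>i\<in>{..L} - {l, Suc l}. walk_sum n W t (L - i) (v i))" for v
    unfolding potential_def by (subst A) (simp add: add.assoc)
  have rest: "(\<Sum>i\<in>{..L} - {l, Suc l}. walk_sum n W t (L - i) (?u' i))
      = (\<Sum>i\<in>{..L} - {l, Suc l}. walk_sum n W t (L - i) (u i))"
    by (rule sum.cong) (auto simp: push_upd_def)
  have l: "u l = (\<lambda>i. ?u' l i + ?x * ?e i)" by (auto simp: push_upd_def)
  have sl: "?u' (Suc l) = (\<lambda>j. u (Suc l) j + ?x * app n W ?e j)"
    using assms by (auto simp: push_upd_def app_def if_distrib[of "\<lambda>x. _ * x"] cong: if_cong)
  have "L - l = Suc (L - Suc l)" using assms by simp
  then have "walk_sum n W t (L - l) ?e = t k + walk_sum n W t (L - Suc l) (app n W ?e)"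
    using assms by (simp add: walk_sum_Suc if_distrib[of "\<lambda>x. _ * x"] cong: if_cong)
  moreover have "walk_sum n W t (L - l) (u l) = walk_sum n W t (L - l) (?u' l) + ?x * walk_sum n W t (L - l) ?e"
    by (subst l) (rule walk_sum_lin)
  moreover have "walk_sum n W t (L - Suc l) (?u' (Suc l)) =
      walk_sum n W t (L - Suc l) (u (Suc l)) + ?x * walk_sum n W t (L - Suc l) (app n W ?e)"
    by (subst sl) (rule walk_sum_lin)
  ultimately show ?thesis
    unfolding split[of u] split[of ?u'] rest by (simp add: algebra_simps)
qed

text \<open>Extending the triangle \<open>j + l < L\<close> by zeros to a square allows
  \<open>j\<close> and \<open>l\<close> to be drawn independently.\<close>

lemma potential_eq:
  "potential n W t L u = (\<Sum>l<L. \<Sum>j<L. if j + l < L then \<Sum>i<n. t i * (app n W ^^ j) (u l) i else 0)"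
proof -
  have "walk_sum n W t (L - l) (u l)
      = (\<Sum>j<L. if j + l < L then \<Sum>i<n. t i * (app n W ^^ j) (u l) i else 0)" for l
    unfolding walk_sum_def
    by (rule sum.mono_neutral_cong_left) auto
  moreover have "potential n W t L u = (\<Sum>l<L. walk_sum n W t (L - l) (u l))"
    unfolding potential_def
    by (rule sum.mono_neutral_right) (auto simp: walk_sum_def)
  ultimately show ?thesis by simp
qed

lemma potential_bound:
  assumes "substochastic n W" "\<And>l i. l < L \<Longrightarrow> i < n \<Longrightarrow> \<bar>u l i\<bar> \<le> c" "0 \<le> c"
  shows "\<bar>potential n W t L u\<bar> \<le> (real L)\<^sup>2 * ((\<Sum>i<n. \<bar>t i\<bar>) * c)"
proof -
  let ?B = "(\<Sum>i<n. \<bar>t i\<bar>) * c"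
  have B: "0 \<le> ?B" using assms by (simp add: sum_nonneg)
  have "\<bar>potential n W t L u\<bar>
      \<le> (\<Sum>l<L. \<Sum>j<L. \<bar>if j + l < L then \<Sum>i<n. t i * (app n W ^^ j) (u l) i else 0\<bar>)"
    unfolding potential_eq by (rule order.trans[OF sum_abs sum_mono]) (rule sum_abs)
  also have "\<dots> \<le> (\<Sum>l<L. \<Sum>j<L. ?B)"
    by (intro sum_mono) (use B assms in \<open>auto intro!: weighted_app_pow_bound\<close>)
  finally show ?thesis by (simp add: power2_eq_square)
qed

section \<open>Hitting weights and the number of pushes\<close>

definition hit :: "nat \<Rightarrow> (nat \<Rightarrow> nat \<Rightarrow> real) \<Rightarrow> nat \<Rightarrow> nat \<Rightarrow> nat \<Rightarrow> real" where
  "hit n W l k w = (app n (\<lambda>i j. \<bar>W i j\<bar>) ^^ l) (\<lambda>i. if i = w then 1 else 0) k"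

lemma hit_nonneg: "0 \<le> hit n W l k w"
  unfolding hit_def by (induction l arbitrary: k) (auto simp: app_def intro!: sum_nonneg)

lemma hit_Suc: "hit n W (Suc l) k w = (\<Sum>i<n. \<bar>W k i\<bar> * hit n W l i w)"
  by (simp add: hit_def app_def)

text \<open>Row sums of the powers of \<open>|W|\<close> stay at most 1. The row \<open>k\<close> is
  fixed and the column \<open>w\<close> varies, so this controls an average over \<open>w\<close>
  rather than a single \<open>w\<close>.\<close>

lemma sum_hit_le_1:
  assumes "substochastic n W" "k < n"
  shows "(\<Sum>w<n. hit n W l k w) \<le> 1"
  using \<open>k < n\<close>
proof (induction l arbitrary: k)
  case 0
  then show ?case by (simp add: hit_def)
next
  case (Suc l)
  have "(\<Sum>w<n. hit n W (Suc l) k w) = (\<Sum>i<n. \<bar>W k i\<bar> * (\<Sum>w<n. hit n W l i w))"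
    unfolding hit_Suc by (subst sum.swap) (simp add: sum_distrib_left)
  also have "\<dots> \<le> (\<Sum>i<n. \<bar>W k i\<bar> * 1)"
    by (intro sum_mono mult_left_mono) (use Suc in auto)
  also have "\<dots> \<le> 1" using assms(1) Suc.prems by (simp add: substochastic_def)
  finally show ?case .
qed

text \<open>The largest natural number strictly below \<open>h\<close> times the hitting weight.  Strictness makes the sum over
  \<open>w\<close> at most \<open>h - 1\<close>, so that nothing is charged to the pushes when \<open>h = 1\<close>.\<close>

definition push_bound :: "nat \<Rightarrow> (nat \<Rightarrow> nat \<Rightarrow> real) \<Rightarrow> nat \<Rightarrow> nat \<Rightarrow> nat \<Rightarrow> nat \<Rightarrow> nat" where
  "push_bound n W h w l k = nat (\<lceil>real h * hit n W l k w\<rceil> - 1)"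

lemma le_push_bound: "real p < real h * hit n W l k w \<Longrightarrow> p \<le> push_bound n W h w l k"
  unfolding push_bound_def by linarith

lemma push_bound_less: "0 < push_bound n W h w l k \<Longrightarrow> real (push_bound n W h w l k) < real h * hit n W l k w"
  unfolding push_bound_def by linarith

text \<open>If some bound is positive, its strict inequality makes the whole integer sum less than
  \<open>h\<close>; otherwise all terms vanish.\<close>

lemma sum_push_bound:
  assumes "substochastic n W" "k < n" "1 \<le> h"
  shows "(\<Sum>w<n. push_bound n W h w l k) \<le> h - 1"
proof (cases "\<exists>w<n. 0 < push_bound n W h w l k")
  case False
  then show ?thesis by simp
next
  case True
  then obtain w where w: "w < n" "0 < push_bound n W h w l k" by auto
  have le: "real (push_bound n W h w l k) \<le> real h * hit n W l k w" for w
    using push_bound_less[of n W h w l k] hit_nonneg[of n W l k w]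
    by (cases "push_bound n W h w l k = 0") (auto intro: less_imp_le)
  have "(\<Sum>w<n. real (push_bound n W h w l k)) < (\<Sum>w<n. real h * hit n W l k w)"
    by (rule sum_strict_mono_ex1) (use le push_bound_less[OF w(2)] w in auto)
  also have "\<dots> \<le> real h * 1"
    unfolding sum_distrib_left[symmetric]
    by (rule mult_left_mono[OF sum_hit_le_1]) (use assms in auto)
  finally have "real (\<Sum>w<n. push_bound n W h w l k) < real h" by simp
  then show ?thesis by linarith
qed

text \<open>Ghost variables: \<open>p l k\<close> counts the pushes at \<open>(l,k)\<close>, and \<open>g l k\<close> is the total absolute value
  pushed there, in units of the initial residual \<open>1/d\<close>.\<close>

definition mass_inv ::
  "nat \<Rightarrow> (nat \<Rightarrow> nat \<Rightarrow> real) \<Rightarrow> nat \<Rightarrow> real \<Rightarrow> nat \<Rightarrow> (nat \<Rightarrow> nat \<Rightarrow> real) \<Rightarrow>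
   (nat \<Rightarrow> nat \<Rightarrow> nat) \<Rightarrow> (nat \<Rightarrow> nat \<Rightarrow> real) \<Rightarrow> bool" where
  "mass_inv n W h d w u p g \<longleftrightarrow>
     (\<forall>l k. p l k = 0 \<or> real (p l k) < real h * g l k) \<and> (\<forall>l k. 0 \<le> g l k) \<and>
     (\<forall>k. d * \<bar>u 0 k\<bar> + g 0 k \<le> (if k = w then 1 else 0)) \<and>
     (\<forall>l k. d * \<bar>u (Suc l) k\<bar> + g (Suc l) k \<le> (\<Sum>i<n. \<bar>W k i\<bar> * g l i))"

lemma mass_inv_initial:
  assumes "0 < d"
  shows "mass_inv n W h d w (\<lambda>l. if l = 0 then (\<lambda>_. 0)(w := 1 / d) else (\<lambda>_. 0)) (\<lambda>_ _. 0) (\<lambda>_ _. 0)"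
  using assms by (auto simp: mass_inv_def)

text \<open>By induction on the level, the last clause of \<open>mass_inv\<close> gives
  \<open>g l \<le> |W|^l e_w\<close> entrywise, so the pushed mass never exceeds the hitting
  weight.\<close>

lemma mass_inv_le_push_bound:
  assumes "mass_inv n W h d w u p g" "0 < d"
  shows "p l k \<le> push_bound n W h w l k"
proof -
  have g: "g l k \<le> hit n W l k w"
  proof (induction l arbitrary: k)
    case 0
    have "d * \<bar>u 0 k\<bar> + g 0 k \<le> (if k = w then 1 else 0)" "0 \<le> d * \<bar>u 0 k\<bar>"
      using assms by (auto simp: mass_inv_def)
    then show ?case by (simp add: hit_def)
  next
    case (Suc l)
    have "d * \<bar>u (Suc l) k\<bar> + g (Suc l) k \<le> (\<Sum>i<n. \<bar>W k i\<bar> * g l i)" "0 \<le> d * \<bar>u (Suc l) k\<bar>"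
      using assms by (auto simp: mass_inv_def)
    moreover have "(\<Sum>i<n. \<bar>W k i\<bar> * g l i) \<le> hit n W (Suc l) k w"
      unfolding hit_Suc by (rule sum_mono) (use Suc in \<open>auto intro: mult_left_mono\<close>)
    ultimately show ?case by linarith
  qed
  show ?thesis
  proof (cases "p l k = 0")
    case False
    have "p l k = 0 \<or> real (p l k) < real h * g l k" using assms(1) unfolding mass_inv_def by blast
    then have "real (p l k) < real h * g l k" using False by simp
    also have "\<dots> \<le> real h * hit n W l k w" using g by (simp add: mult_left_mono)
    finally show ?thesis by (rule le_push_bound)
  qed simp
qed

text \<open>A push moves the mass \<open>d * |u l k|\<close> from the residual to
  \<open>g l k\<close>, leaving their sum unchanged. It adds at most \<open>|W j k|\<close> times
  this mass at node \<open>j\<close> of the next level, where the right-hand side grows by the same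
  amount. The size condition makes \<open>h * g l k\<close> grow by more than 1 while the count
  grows by 1.\<close>

lemma mass_inv_push:
  assumes inv: "mass_inv n W h d w u p g" and "0 < d" "k < n" and big: "1 < d * \<bar>u l k\<bar> * real h"
  shows "mass_inv n W h d w (push_upd W l k (u l k) u) (p(l := (p l)(k := Suc (p l k))))
    (g(l := (g l)(k := g l k + d * \<bar>u l k\<bar>)))"
proof -
  let ?x = "d * \<bar>u l k\<bar>"
  let ?u = "push_upd W l k (u l k) u" and ?g = "g(l := (g l)(k := g l k + ?x))"
  have x: "0 \<le> ?x" using assms by simp
  have g0: "0 \<le> g l k" for l k using inv by (auto simp: mass_inv_def)
  have c0: "d * \<bar>u 0 j\<bar> + g 0 j \<le> (if j = w then 1 else 0)" for j
    using inv by (auto simp: mass_inv_def)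
  have cS: "d * \<bar>u (Suc m) j\<bar> + g (Suc m) j \<le> (\<Sum>i<n. \<bar>W j i\<bar> * g m i)" for m j
    using inv by (auto simp: mass_inv_def)
  have grow: "(\<Sum>i<n. \<bar>W j i\<bar> * ?g m i) = (\<Sum>i<n. \<bar>W j i\<bar> * g m i) + (if m = l then \<bar>W j k\<bar> * ?x else 0)" for m j
  proof -
    have "(\<Sum>i<n. \<bar>W j i\<bar> * ?g m i)
        = (\<Sum>i<n. \<bar>W j i\<bar> * g m i + (if i = k then if m = l then \<bar>W j k\<bar> * ?x else 0 else 0))"
      by (rule sum.cong) (auto simp: algebra_simps)
    then show ?thesis using assms by (simp add: sum.distrib)
  qed
  have P: "Suc (p l k) = 0 \<or> real (Suc (p l k)) < real h * (g l k + ?x)"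
  proof -
    have "p l k = 0 \<or> real (p l k) < real h * g l k" using inv unfolding mass_inv_def by blast
    then have "real (p l k) \<le> real h * g l k" using g0[of l k] by auto
    then show ?thesis using big by (simp add: algebra_simps)
  qed
  have same: "d * \<bar>?u m j\<bar> + ?g m j \<le> d * \<bar>u m j\<bar> + g m j" if "m \<noteq> Suc l" for m j
    using that x by (auto simp: push_upd_def)
  have suc: "d * \<bar>?u (Suc l) j\<bar> + ?g (Suc l) j \<le> d * \<bar>u (Suc l) j\<bar> + g (Suc l) j + \<bar>W j k\<bar> * ?x" for j
  proof -
    have "d * \<bar>u (Suc l) j + u l k * W j k\<bar> \<le> d * (\<bar>u (Suc l) j\<bar> + \<bar>u l k * W j k\<bar>)"
      using assms by (intro mult_left_mono) auto
    then show ?thesis by (simp add: push_upd_def abs_mult algebra_simps)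
  qed
  show ?thesis
    unfolding mass_inv_def
  proof (intro conjI allI)
    fix m j
    show "(p(l := (p l)(k := Suc (p l k)))) m j = 0 \<or>
      real ((p(l := (p l)(k := Suc (p l k)))) m j) < real h * ?g m j"
      using P inv by (auto simp: mass_inv_def)
    show "0 \<le> ?g m j" using g0 x by (auto intro: add_nonneg_nonneg)
    show "d * \<bar>?u 0 j\<bar> + ?g 0 j \<le> (if j = w then 1 else 0)"
      using same[of 0 j] c0[of j] by linarith
    show "d * \<bar>?u (Suc m) j\<bar> + ?g (Suc m) j \<le> (\<Sum>i<n. \<bar>W j i\<bar> * ?g m i)"
      unfolding grow using same[of "Suc m" j] suc[of j] cS[of m j]
      by (cases "m = l") auto
  qed
qed

section \<open>The estimator\<close>

lemma state_simps [simp]: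
  "ireg (spend k s) = ireg s" "rreg (spend k s) = rreg s" "iarr (spend k s) = iarr s"
  "rarr (spend k s) = rarr s" "clock (spend k s) = clock s + k"
  "ireg (set_ireg x v s) = (ireg s)(x := v)" "rreg (set_ireg x v s) = rreg s"
  "iarr (set_ireg x v s) = iarr s" "rarr (set_ireg x v s) = rarr s"
  "clock (set_ireg x v s) = clock s"
  "ireg (set_rreg x r s) = ireg s" "rreg (set_rreg x r s) = (rreg s)(x := r)"
  "iarr (set_rreg x r s) = iarr s" "rarr (set_rreg x r s) = rarr s"
  "clock (set_rreg x r s) = clock s"
  "ireg (set_iarr a i j v s) = ireg s" "rreg (set_iarr a i j v s) = rreg s"
  "iarr (set_iarr a i j v s) = (iarr s)(a := (iarr s a)(i := (iarr s a i)(j := v)))"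
  "rarr (set_iarr a i j v s) = rarr s" "clock (set_iarr a i j v s) = clock s"
  "ireg (set_rarr a i j r s) = ireg s" "rreg (set_rarr a i j r s) = rreg s"
  "rarr (set_rarr a i j r s) = (rarr s)(a := (rarr s a)(i := (rarr s a i)(j := r)))"
  "iarr (set_rarr a i j r s) = iarr s" "clock (set_rarr a i j r s) = clock s"
  by (simp_all add: spend_def set_ireg_def set_rreg_def set_iarr_def set_rarr_def)

lemma load_list_fold:
  fixes a :: nat and val :: "nat \<Rightarrow> real" and s :: state
  assumes "m \<le> length ks"
  defines "s' \<equiv> fold (\<lambda>i s'. set_iarr a 0 i (ks ! i) (set_rarr a 0 i (val (ks ! i)) s')) [0..<m] s"
  shows "ireg s' = ireg s \<and> rreg s' = rreg s \<and> clock s' = clock s \<and>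
    (\<forall>a'. a' \<noteq> a \<longrightarrow> iarr s' a' = iarr s a' \<and> rarr s' a' = rarr s a') \<and>
    (\<forall>i<m. iarr s' a 0 i = ks ! i \<and> rarr s' a 0 i = val (ks ! i))"
  using assms(1) unfolding s'_def
  by (induction m) (auto simp: less_Suc_eq)

lemma load_list_simps:
  "ireg (load_list x a ks val s) = (ireg s)(x := length ks)"
  "rreg (load_list x a ks val s) = rreg s"
  "clock (load_list x a ks val s) = clock s + 1 + length ks"
  "a' \<noteq> a \<Longrightarrow> iarr (load_list x a ks val s) a' = iarr s a'"
  "a' \<noteq> a \<Longrightarrow> rarr (load_list x a ks val s) a' = rarr s a'"
  "i < length ks \<Longrightarrow> iarr (load_list x a ks val s) a 0 i = ks ! i"
  "i < length ks \<Longrightarrow> rarr (load_list x a ks val s) a 0 i = val (ks ! i)"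
  using load_list_fold[of "length ks" ks a val s] by (auto simp: load_list_def)

lemma ensures_bind_pmf:
  assumes "finite A" "set_pmf p \<subseteq> A" "\<And>a. a \<in> set_pmf p \<Longrightarrow> ensures (q a) Q f (g a)"
    "(\<Sum>a\<in>A. pmf p a * g a) \<le> v"
  shows "ensures (bind_spmf (spmf_of_pmf p) q) Q f v"
proof (rule ensures_bind)
  show "ensures (spmf_of_pmf p) (\<lambda>a. a \<in> set_pmf p) g v"
    by (rule ensures_pmf[OF assms(1,2)]) (use assms(4) in auto)
qed (use assms in auto)

lemma ensures_seq_Uniform:
  assumes "\<And>k. k \<le> ival e s \<Longrightarrow> ensures (exec M b t acc d (spend 1 (set_ireg x k s))) Q f (g k)"
    "(\<Sum>k\<le>ival e s. g k) / real (Suc (ival e s)) \<le> v"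
  shows "ensures (exec M b t acc (Seq (Uniform x e) d) s) Q f v"
proof -
  have "exec M b t acc (Seq (Uniform x e) d) s =
      bind_spmf (spmf_of_pmf (pmf_of_set {..ival e s})) (\<lambda>k. exec M b t acc d (spend 1 (set_ireg x k s)))"
    by (simp add: bind_map_spmf o_def del: bind_spmf_of_pmf)
  moreover have "ensures \<dots> Q f v"
    by (rule ensures_bind_pmf[where A = "{..ival e s}" and g = g])
      (use assms in \<open>auto simp: sum_divide_distrib\<close>)
  ultimately show ?thesis by simp
qed

section \<open>The program: threshold search, pushes, sampling\<close>

abbreviation seq_infix :: "com \<Rightarrow> com \<Rightarrow> com" (infixr ";;" 60) where
  "c ;; d \<equiv> Seq c d"

text \<open>Natural registers: 5 is \<open>h\<close>, the inverse of the push threshold; 6 the stack height; 7 and 8 the level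
  and node being pushed; 9 and 10 the position in its column and the neighbour there; 11 the number of
  samples; 12 the position of the walk; 13 its remaining length; 14 the sampled level.
  Real registers: 3 is \<open>M(w,w)\<close>, 4 the accumulated exact part, 5 the residual being pushed, 9 the
  required number of samples, 10 the sum of the samples, 12 the sign of the walk.
  Real array 0 holds the residual of level \<open>l\<close> at node \<open>k\<close> in position \<open>(l,k)\<close>; rows 0 and 1 of natural
  array 0 hold the levels and nodes on the stack; the arrays 1 hold the loaded column.\<close>

definition scale_search :: com where
  "scale_search = ISet 5 (INat 1) ;;
     While (RLess (RMul (RMul (ROfNat (IReg 5)) (RMul (ROfNat (IReg 5)) (ROfNat (IReg 5))))
                    (RMul (ROfNat (IReg 3)) (RMul (RReg 0) (RReg 0))))
              (RMul (RMul (RReg 2) (RReg 2))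
                 (RMul (RMul (RMul (ROfNat (IReg 2)) (ROfNat (IReg 2)))
                             (RMul (ROfNat (IReg 2)) (ROfNat (IReg 2))))
                       (RMul (ROfNat (IReg 4)) (ROfNat (IReg 0))))))
       (ISet 5 (IAdd (IReg 5) (INat 1)))"

text \<open>Columns are traversed backwards. Real register 8 receives \<open>W j k\<close>; equality
  of the two nodes has to be expressed by two negated comparisons. Each changed residual is stacked
  unconditionally and tested only when popped.\<close>

definition push_edge :: com where
  "push_edge = ISet 9 (ISub (IReg 9) (INat 1)) ;; ISet 10 (IArr 1 (INat 0) (IReg 9)) ;;
     GetDiag 7 (IReg 10) ;;
     Cond (BAnd (BNot (ILess (IReg 10) (IReg 8))) (BNot (ILess (IReg 8) (IReg 10))))
       (RSet 8 (RDiv (ROfNat (INat 1)) (ROfNat (INat 2))))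
       (RSet 8 (RDiv (RSub (ROfNat (INat 0)) (RArr 1 (INat 0) (IReg 9)))
                  (RMul (ROfNat (INat 2)) (RReg 7)))) ;;
     RStore 0 (IAdd (IReg 7) (INat 1)) (IReg 10)
       (RAdd (RArr 0 (IAdd (IReg 7) (INat 1)) (IReg 10)) (RMul (RReg 5) (RReg 8))) ;;
     IStore 0 (INat 0) (IReg 6) (IAdd (IReg 7) (INat 1)) ;;
     IStore 0 (INat 1) (IReg 6) (IReg 10) ;;
     ISet 6 (IAdd (IReg 6) (INat 1))"

definition push_column :: com where
  "push_column = While (ILess (INat 0) (IReg 9)) push_edge"

definition push_start :: com where
  "push_start = GetT 6 (IReg 8) ;; RSet 4 (RAdd (RReg 4) (RMul (RReg 6) (RReg 5))) ;;
     RStore 0 (IReg 7) (IReg 8) (ROfNat (INat 0)) ;; LoadCol 9 1 (IReg 8)"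

definition pop :: com where
  "pop = ISet 6 (ISub (IReg 6) (INat 1)) ;; ISet 7 (IArr 0 (INat 0) (IReg 6)) ;;
     ISet 8 (IArr 0 (INat 1) (IReg 6)) ;; RSet 5 (RArr 0 (IReg 7) (IReg 8))"

text \<open>The condition is \<open>\<bar>u\<bar> d h > 1\<close>, squared to avoid the absolute value.\<close>

definition push_test :: bexp where
  "push_test = BAnd (ILess (IReg 7) (IReg 2)) (RLess (ROfNat (INat 1))
     (RMul (RMul (RReg 5) (RMul (RReg 3) (ROfNat (IReg 5)))) (RMul (RReg 5) (RMul (RReg 3) (ROfNat (IReg 5))))))"

definition push_init :: com where
  "push_init = GetDiag 3 (IReg 1) ;; RStore 0 (INat 0) (IReg 1) (RDiv (ROfNat (INat 1)) (RReg 3)) ;;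
     RSet 4 (ROfNat (INat 0)) ;; IStore 0 (INat 0) (INat 0) (INat 0) ;;
     IStore 0 (INat 1) (INat 0) (IReg 1) ;; ISet 6 (INat 1)"

definition push_loop :: com where
  "push_loop = While (ILess (INat 0) (IReg 6))
     (pop ;; Cond push_test (push_start ;; push_column) Skip)"

text \<open>Off the diagonal \<open>W\<close> has the sign opposite to \<open>M\<close>, so a proper
  move along a positive entry flips the sign. A lazy step keeps it although the reported diagonal
  entry is positive, and termination sets it to 0.\<close>

definition walk_body :: com where
  "walk_body = ISet 13 (ISub (IReg 13) (INat 1)) ;; Step 15 13 (IReg 12) ;;
     Cond (ILess (IReg 15) (IReg 0))
       (Cond (BAnd (BNot (ILess (IReg 15) (IReg 12))) (BNot (ILess (IReg 12) (IReg 15)))) Skip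
          (Cond (RLess (ROfNat (INat 0)) (RReg 13)) (RSet 12 (RSub (ROfNat (INat 0)) (RReg 12))) Skip))
       (RSet 12 (ROfNat (INat 0))) ;;
     ISet 12 (IReg 15)"

definition walk :: com where
  "walk = While (BAnd (ILess (INat 0) (IReg 13)) (ILess (IReg 12) (IReg 0))) walk_body"

text \<open>Pairs with \<open>j + l \<ge> L\<close> get sign 0 before the walk starts; they are the
  zero terms of \<open>potential_eq\<close>.\<close>

definition sample_body :: com where
  "sample_body = SampleT 12 ;; GetT 11 (IReg 12) ;;
     Cond (RLess (ROfNat (INat 0)) (RReg 11)) (RSet 12 (ROfNat (INat 1)))
       (RSet 12 (RSub (ROfNat (INat 0)) (ROfNat (INat 1)))) ;;
     Uniform 13 (ISub (IReg 2) (INat 1)) ;; Uniform 14 (ISub (IReg 2) (INat 1)) ;;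
     Cond (ILess (IAdd (IReg 13) (IReg 14)) (IReg 2)) Skip (RSet 12 (ROfNat (INat 0))) ;;
     walk ;;
     RSet 10 (RAdd (RReg 10) (RMul (RReg 12) (RArr 0 (IReg 14) (IReg 12)))) ;;
     ISet 11 (IAdd (IReg 11) (INat 1))"

definition sample_loop :: com where
  "sample_loop = While (RLess (ROfNat (IReg 11)) (RReg 9)) sample_body"

definition walk_weight :: rexp where
  "walk_weight = RMul (RReg 2) (RMul (ROfNat (IReg 2)) (ROfNat (IReg 2)))"

text \<open>Real register 9 first holds the quotient that decides whether to sample, then the
  required number of samples. The final division by 2 is the factor 1/2 in
  \<open>x_star\<close>.\<close>

definition sampling :: com where
  "sampling = RSet 9 (RDiv walk_weight (RMul (ROfNat (IReg 5)) (RReg 0))) ;;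
     Cond (RLess (ROfNat (INat 1)) (RReg 9))
       (RSet 9 (RMul (ROfNat (INat 4)) (RMul (RReg 9) (RReg 9))) ;; RSet 10 (ROfNat (INat 0)) ;;
        ISet 11 (INat 0) ;; sample_loop ;;
        RSet 0 (RDiv (RAdd (RReg 4) (RDiv (RMul walk_weight (RReg 10)) (ROfNat (IReg 11))))
                  (ROfNat (INat 2))))
       (RSet 0 (RDiv (RReg 4) (ROfNat (INat 2))))"

text \<open>If \<open>L\<close> times the 1-norm of \<open>t\<close> is at most
  \<open>\<epsilon>\<close>, then 0 is accurate enough. In the remaining case the quantity
  \<open>F\<close> of \<open>average_cost\<close> is at least 1.\<close>

definition estimator :: com where
  "estimator = Cond (RLess (RReg 0) (RMul (ROfNat (IReg 2)) (RReg 2)))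
     (scale_search ;; push_init ;; push_loop ;; sampling)
     (RSet 0 (ROfNat (INat 0)))"

text \<open>The entries of \<open>1/2 (I + D^-1 A^T)\<close>, where \<open>A^T\<close> has zero
  diagonal and the entries of \<open>-M\<close> elsewhere. Padding with 0 lets statements about
  residuals range over all indices.\<close>

definition walk_mat :: "real mat \<Rightarrow> nat \<Rightarrow> nat \<Rightarrow> real" where
  "walk_mat M i k = (if i < dim_row M \<and> k < dim_row M then
     if i = k then 1/2 else - (M $$ (i,k)) / (2 * M $$ (i,i)) else 0)"

text \<open>The threshold parameter \<open>h\<close> is fixed in advance;
  \<open>scale_search_spec\<close> shows that the program finds it.\<close>

locale rdd_instance =
  fixes M :: "real mat" and t :: "real Matrix.vec" and acc :: access
    and n w L h :: nat and \<epsilon> :: real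
  assumes M: "M \<in> carrier_mat n n" and t: "t \<in> carrier_vec n" and t0: "t \<noteq> 0\<^sub>v n"
    and RDD: "RDD M" and access: "valid_access M acc" and eps: "0 < \<epsilon>" and w: "w < n" and L: "0 < L"
    and h1: "1 \<le> h"
begin

abbreviation "W \<equiv> walk_mat M"
abbreviation "d \<equiv> M $$ (w,w)"
abbreviation "\<tau> \<equiv> \<Sum>i<n. \<bar>t $ i\<bar>"
abbreviation "t_fun \<equiv> \<lambda>i. t $ i"
abbreviation "b \<equiv> unit_vec n w"
abbreviation "f\<^sub>r \<equiv> f_row M acc"
abbreviation "v0 \<equiv> (\<lambda>_. 0)(w := 1 / d)"
abbreviation "target \<equiv> walk_sum n W t_fun L v0"
abbreviation "run c s \<equiv> exec M b t acc c s"

definition base :: "state \<Rightarrow> bool" where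
  "base s \<longleftrightarrow> ireg s 0 = n \<and> ireg s 1 = w \<and> ireg s 2 = L \<and> ireg s 3 = nnz M \<and> ireg s 4 = f\<^sub>r \<and>
     rreg s 0 = \<epsilon> \<and> rreg s 2 = \<tau>"

lemma dims: "dim_row M = n" "dim_col M = n" "dim_vec t = n"
  using M t by auto

lemma diag_pos: "i < n \<Longrightarrow> 0 < M $$ (i,i)"
  using RDD by (auto simp: RDD_def dims)

lemma d_pos: "0 < d"
  using diag_pos w by simp

text \<open>Laziness contributes 1/2, and diagonal dominance bounds the off-diagonal part by the
  other 1/2.\<close>

lemma substochastic_W: "substochastic n W"
  unfolding substochastic_def
proof (intro allI impI)
  fix i assume i: "i < n"
  have "(\<Sum>k<n. \<bar>W i k\<bar>) = \<bar>W i i\<bar> + (\<Sum>k\<in>{..<n} - {i}. \<bar>W i k\<bar>)"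
    using i by (subst sum.remove[of _ i]) auto
  also have "\<dots> = 1/2 + (\<Sum>k\<in>{..<n} - {i}. \<bar>M $$ (i,k)\<bar> / (2 * M $$ (i,i)))"
    using i diag_pos[OF i] by (auto simp: walk_mat_def dims abs_mult intro!: sum.cong)
  also have "\<dots> = 1/2 + (\<Sum>k\<in>{..<n} - {i}. \<bar>M $$ (i,k)\<bar>) / (2 * M $$ (i,i))"
    by (simp add: sum_divide_distrib)
  also have "\<dots> \<le> 1"
    using RDD i diag_pos[OF i] by (auto simp: RDD_def dims field_simps)
  finally show "(\<Sum>k<n. \<bar>W i k\<bar>) \<le> 1" .
qed

text \<open>Reals cannot be rounded to naturals, so the least admissible \<open>h\<close> is found
  by counting up. The linear search takes time \<open>2 * h\<close>, which the final bound absorbs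
  through \<open>h \<le> 2 * F\<close>.\<close>

lemma scale_search_spec:
  assumes s: "base s" and rarr: "rarr s = (\<lambda>_ _ _. 0)"
    and good: "\<tau>^2 * real L^4 * real f\<^sub>r * real n \<le> real h^3 * real (nnz M) * \<epsilon>^2"
    and least: "\<And>m. 1 \<le> m \<Longrightarrow> m < h \<Longrightarrow> real m^3 * real (nnz M) * \<epsilon>^2 < \<tau>^2 * real L^4 * real f\<^sub>r * real n"
  shows "ensures (run scale_search s)
    (\<lambda>s'. base s' \<and> rarr s' = (\<lambda>_ _ _. 0) \<and> ireg s' 5 = h \<and> clock s' \<le> clock s + 2 * h) (\<lambda>_. c) c"
proof -
  define g where "g = RLess (RMul (RMul (ROfNat (IReg 5)) (RMul (ROfNat (IReg 5)) (ROfNat (IReg 5))))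
                    (RMul (ROfNat (IReg 3)) (RMul (RReg 0) (RReg 0))))
              (RMul (RMul (RReg 2) (RReg 2))
                 (RMul (RMul (RMul (ROfNat (IReg 2)) (ROfNat (IReg 2)))
                             (RMul (ROfNat (IReg 2)) (ROfNat (IReg 2))))
                       (RMul (ROfNat (IReg 4)) (ROfNat (IReg 0)))))"
  have g: "bval g s' \<longleftrightarrow> real (ireg s' 5)^3 * real (nnz M) * \<epsilon>^2 < \<tau>^2 * real L^4 * real f\<^sub>r * real n"
    if "base s'" for s'
    using that unfolding g_def base_def
    by (simp add: power2_eq_square power3_eq_cube power4_eq_xxxx mult.assoc)
  \<comment> \<open>Each round costs a test and an assignment; the summand 1 reserves time for the
    final test.\<close>
  let ?I = "\<lambda>s'. base s' \<and> rarr s' = (\<lambda>_ _ _. 0) \<and> 1 \<le> ireg s' 5 \<and> ireg s' 5 \<le> h \<and>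
    clock s' + 1 = clock s + 2 * ireg s' 5"
  have "ensures (run (While g (ISet 5 (IAdd (IReg 5) (INat 1)))) (spend 1 (set_ireg 5 1 s)))
      (\<lambda>s'. base s' \<and> rarr s' = (\<lambda>_ _ _. 0) \<and> ireg s' 5 = h \<and> clock s' \<le> clock s + 2 * h) (\<lambda>_. c) c"
  proof (rule ensures_exec_while[where I = ?I and T = "clock s + 2 * h" and f = "\<lambda>_. c"])
    fix s' assume s': "?I s'" "bval g s'"
    then have "ireg s' 5 \<noteq> h" using good g[of s'] by auto
    then show "ensures (run (ISet 5 (IAdd (IReg 5) (INat 1))) (spend 1 s'))
        (\<lambda>s''. ?I s'' \<and> clock s' < clock s'') (\<lambda>_. c) c"
      using s' by (auto simp: base_def intro!: ensures_return)
  next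
    show "?I (spend 1 (set_ireg 5 1 s))" using s rarr h1 by (auto simp: base_def)
  next
    fix s' assume s': "?I s'" "\<not> bval g s'"
    then have "ireg s' 5 = h" using least[of "ireg s' 5"] g[of s'] by force
    then show "(base (spend 1 s') \<and> rarr (spend 1 s') = (\<lambda>_ _ _. 0) \<and> ireg (spend 1 s') 5 = h \<and>
        clock (spend 1 s') \<le> clock s + 2 * h) \<and> c \<le> c"
      using s' by (auto simp: base_def)
  qed auto
  then show ?thesis by (simp add: scale_search_def g_def)
qed

end

section \<open>Correctness and cost of the push phase\<close>

context rdd_instance
begin

text \<open>With \<open>len\<close> the column length, a push takes at most
  \<open>11 + 12 * len\<close> units and stacks \<open>len\<close> pairs, each prepaid with 10
  units; the popped pair releases its own 10. The constants leave room.\<close>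

definition push_cost :: "nat \<Rightarrow> nat" where
  "push_cost k = 10 + 30 * length (col_list acc k)"

definition push_budget :: "(nat \<Rightarrow> nat \<Rightarrow> nat) \<Rightarrow> nat" where
  "push_budget p = (\<Sum>l<L. \<Sum>k<n. (push_bound n W h w l k - p l k) * push_cost k)"

text \<open>The bound on \<open>Suc (p l k)\<close> keeps the truncated subtraction from saturating,
  so exactly one push cost is released.\<close>

lemma push_budget_Suc:
  assumes "l < L" "k < n" "Suc (p l k) \<le> push_bound n W h w l k"
  shows "push_budget p = push_budget (p(l := (p l)(k := Suc (p l k)))) + push_cost k"
proof -
  let ?p' = "p(l := (p l)(k := Suc (p l k)))"
  have rows: "(\<Sum>j<n. (push_bound n W h w m j - p m j) * push_cost j) =
      (\<Sum>j<n. (push_bound n W h w m j - ?p' m j) * push_cost j) + (if m = l then push_cost k else 0)" for m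
  proof -
    have "(push_bound n W h w m j - p m j) * push_cost j =
        (push_bound n W h w m j - ?p' m j) * push_cost j + (if j = k then if m = l then push_cost k else 0 else 0)" for j
    proof (cases "m = l \<and> j = k")
      case True
      then have "push_bound n W h w l k - p l k = Suc (push_bound n W h w l k - Suc (p l k))"
        using assms by simp
      then show ?thesis using True by simp
    qed auto
    then have "(\<Sum>j<n. (push_bound n W h w m j - p m j) * push_cost j) =
      (\<Sum>j<n. (push_bound n W h w m j - ?p' m j) * push_cost j + (if j = k then if m = l then push_cost k else 0 else 0))"
      by simp
    then show ?thesis using assms by (simp only: sum.distrib) simp
  qed
  show ?thesis
    unfolding push_budget_def rows using assms by (simp add: sum.distrib)
qed

definition big :: "(nat \<Rightarrow> nat \<Rightarrow> real) \<Rightarrow> nat \<Rightarrow> nat \<Rightarrow> bool" where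
  "big u l k \<longleftrightarrow> 1 < d * \<bar>u l k\<bar> * real h"

text \<open>A pair may occur several times; a copy whose residual has become small is discarded by
  the test after popping.\<close>

definition on_stack :: "state \<Rightarrow> nat \<Rightarrow> nat \<Rightarrow> bool" where
  "on_stack s l k \<longleftrightarrow> (\<exists>i<ireg s 6. iarr s 0 0 i = l \<and> iarr s 0 1 i = k)"

definition push_base :: "state \<Rightarrow> bool" where
  "push_base s \<longleftrightarrow> base s \<and> ireg s 5 = h \<and> rreg s 3 = d \<and> (\<forall>i<ireg s 6. iarr s 0 1 i < n)"

text \<open>Amortised accounting: each stacked pair holds 10 units for its removal, and
  \<open>push_budget\<close> holds the cost of pushes to come. The ghosts \<open>p\<close> and
  \<open>g\<close> are quantified because the machine does not store them.\<close>

definition push_inv :: "nat \<Rightarrow> state \<Rightarrow> bool" where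
  "push_inv T s \<longleftrightarrow> push_base s \<and>
     rreg s 4 + potential n W t_fun L (rarr s 0) = target \<and>
     (\<forall>l<L. \<forall>k<n. big (rarr s 0) l k \<longrightarrow> on_stack s l k) \<and>
     (\<exists>p g. mass_inv n W h d w (rarr s 0) p g \<and> clock s + 10 * ireg s 6 + push_budget p \<le> T)"

lemma col_list:
  assumes "k < n"
  shows "distinct (col_list acc k)" "\<And>j. j \<in> set (col_list acc k) \<longleftrightarrow> j < n \<and> M $$ (j,k) \<noteq> 0"
  using access assms by (auto simp: valid_access_def dims)

text \<open>The loaded list contains every \<open>j\<close> with \<open>W j k\<close> nonzero,
  including \<open>k\<close> itself since \<open>M(k,k)\<close> is positive. Hence every residual
  changed by the push is both updated and stacked.\<close>

lemma push_column_spec: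
  fixes u l k x a
  assumes k: "k < n" and s: "push_base s" "rreg s 4 = a" "rarr s 0 = u"
    "ireg s 7 = l" "ireg s 8 = k" "rreg s 5 = x" "ireg s 9 = length (col_list acc k)"
    "\<And>i. i < length (col_list acc k) \<Longrightarrow> iarr s 1 0 i = col_list acc k ! i"
    "\<And>i. i < length (col_list acc k) \<Longrightarrow> rarr s 1 0 i = M $$ (col_list acc k ! i, k)"
  shows "ensures (run push_column s)
    (\<lambda>s'. push_base s' \<and> rreg s' 4 = a \<and>
      rarr s' 0 = u(Suc l := (\<lambda>j. u (Suc l) j + x * W j k)) \<and>
      ireg s' 6 = ireg s 6 + length (col_list acc k) \<and>
      (\<forall>l' k'. on_stack s l' k' \<longrightarrow> on_stack s' l' k') \<and>
      (\<forall>j. W j k \<noteq> 0 \<longrightarrow> on_stack s' (Suc l) j) \<and>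
      clock s' \<le> clock s + 1 + 11 * length (col_list acc k) \<and> clock s \<le> clock s') (\<lambda>_. c) c"
proof -
  define ks where "ks = col_list acc k"
  have dist: "distinct ks" and ks: "\<And>j. j \<in> set ks \<longleftrightarrow> j < n \<and> M $$ (j,k) \<noteq> 0"
    using col_list[OF k] by (auto simp: ks_def)
  \<comment> \<open>The counter runs down, so dropping that many entries leaves the processed part
    of the column.\<close>
  define I where "I s' \<longleftrightarrow> push_base s' \<and> rreg s' 4 = a \<and> ireg s' 7 = l \<and> ireg s' 8 = k \<and> rreg s' 5 = x \<and>
    ireg s' 9 \<le> length ks \<and>
    (\<forall>i<length ks. iarr s' 1 0 i = ks ! i \<and> rarr s' 1 0 i = M $$ (ks ! i, k)) \<and>
    rarr s' 0 = u(Suc l := (\<lambda>j. u (Suc l) j + (if j \<in> set (drop (ireg s' 9) ks) then x * W j k else 0))) \<and>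
    ireg s' 6 + ireg s' 9 = ireg s 6 + length ks \<and>
    (\<forall>l' k'. on_stack s l' k' \<longrightarrow> on_stack s' l' k') \<and>
    (\<forall>j\<in>set (drop (ireg s' 9) ks). on_stack s' (Suc l) j) \<and>
    clock s' + 11 * ireg s' 9 \<le> clock s + 11 * length ks \<and> clock s \<le> clock s'" for s'
  have push_row: "u(Suc l := (\<lambda>j. u (Suc l) j + (if j \<in> set ks then x * W j k else 0)))
      = u(Suc l := (\<lambda>j. u (Suc l) j + x * W j k))"
  proof -
    have "(if j \<in> set ks then x * W j k else 0) = x * W j k" for j
      using k diag_pos[OF k] by (auto simp: ks walk_mat_def dims)
    then show ?thesis by simp
  qed
  have Wks: "W j k \<noteq> 0 \<Longrightarrow> j \<in> set ks" for j
    using k diag_pos[OF k] by (auto simp: ks walk_mat_def dims split: if_splits)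
  have body: "ensures (run push_edge (spend 1 s')) (\<lambda>s''. I s'' \<and> clock s' < clock s'') (\<lambda>_. c) c"
    if I: "I s'" and g: "0 < ireg s' 9" for s'
  proof -
    define m where "m = ireg s' 9 - 1"
    have m: "ireg s' 9 = Suc m" "m < length ks" using g I by (auto simp: m_def I_def)
    define j where "j = ks ! m"
    have dm: "drop m ks = j # drop (Suc m) ks" using m by (simp add: Cons_nth_drop_Suc j_def)
    have jn: "j \<in> set ks" using m by (simp add: j_def)
    have notin: "j \<notin> set (drop (Suc m) ks)"
      using dist distinct_drop[of ks m] dm by simp
    have jk: "j < n" "j \<noteq> k \<Longrightarrow> W j k = - (M $$ (j,k)) / (2 * M $$ (j,j))" "W k k = 1/2"
      using jn ks k by (auto simp: walk_mat_def dims)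
    have iarr: "iarr s' (Suc 0) 0 m = j" "rarr s' (Suc 0) 0 m = M $$ (j,k)"
      using I m by (auto simp: I_def j_def)
    have r: "ireg s' 7 = l" "ireg s' 8 = k" "rreg s' 5 = x" using I by (auto simp: I_def)
    have "\<exists>s''. run push_edge (spend 1 s') = return_spmf s'' \<and>
        ireg s'' = (ireg s')(9 := m, 10 := j, 6 := Suc (ireg s' 6)) \<and>
        rreg s'' = (rreg s')(7 := M $$ (j,j), 8 := W j k) \<and>
        rarr s'' = (rarr s')(0 := (rarr s' 0)(Suc l := (rarr s' 0 (Suc l))(j := rarr s' 0 (Suc l) j + x * W j k))) \<and>
        iarr s'' = (iarr s')(0 := (iarr s' 0)(0 := (iarr s' 0 0)(ireg s' 6 := Suc l),
            1 := (iarr s' 0 1)(ireg s' 6 := j))) \<and>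
        clock s'' = clock s' + 10"
      by (cases "j = k") (simp_all add: push_edge_def r m(1) iarr jk fun_eq_iff)
    then obtain s'' where s'': "run push_edge (spend 1 s') = return_spmf s''"
      and f: "ireg s'' = (ireg s')(9 := m, 10 := j, 6 := Suc (ireg s' 6))"
        "rreg s'' = (rreg s')(7 := M $$ (j,j), 8 := W j k)"
        "rarr s'' = (rarr s')(0 := (rarr s' 0)(Suc l := (rarr s' 0 (Suc l))(j := rarr s' 0 (Suc l) j + x * W j k)))"
        "iarr s'' = (iarr s')(0 := (iarr s' 0)(0 := (iarr s' 0 0)(ireg s' 6 := Suc l),
            1 := (iarr s' 0 1)(ireg s' 6 := j)))"
        "clock s'' = clock s' + 10"
      by blast
    have st: "on_stack s'' l' k' \<longleftrightarrow> on_stack s' l' k' \<or> l' = Suc l \<and> k' = j" for l' k'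
      unfolding on_stack_def f by (auto simp: Ex_less_Suc cong: conj_cong)
    have rarr: "rarr s'' 0 = u(Suc l := (\<lambda>i. u (Suc l) i + (if i \<in> set (drop m ks) then x * W i k else 0)))"
      using I notin unfolding f dm by (auto simp: I_def m intro!: ext)
    have "I s''"
      unfolding I_def
    proof (intro conjI)
      show "push_base s''" using I jk(1) unfolding I_def push_base_def base_def f
        by (auto simp: less_Suc_eq)
      show "rarr s'' 0 = u(Suc l := (\<lambda>j. u (Suc l) j + (if j \<in> set (drop (ireg s'' 9) ks) then x * W j k else 0)))"
        using rarr by (simp add: f)
      show "\<forall>j\<in>set (drop (ireg s'' 9) ks). on_stack s'' (Suc l) j"
        using I by (auto simp: f(1) dm st I_def m)
      show "\<forall>l' k'. on_stack s l' k' \<longrightarrow> on_stack s'' l' k'" using I by (auto simp: st I_def)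
    qed (use I m in \<open>auto simp: I_def f\<close>)
    then show ?thesis unfolding s'' by (intro ensures_return) (auto simp: f)
  qed
  show ?thesis
    unfolding push_column_def
  proof (rule ensures_exec_while[where I = I and T = "clock s + 11 * length ks"])
    show "I s" using s by (auto simp: I_def ks_def)
    fix s' assume "I s'" "\<not> bval (ILess (INat 0) (IReg 9)) s'"
    then have *: "I s'" "ireg s' 9 = 0" by auto
    have st: "on_stack (spend 1 s') = on_stack s'" by (auto simp: on_stack_def fun_eq_iff)
    show "(push_base (spend 1 s') \<and> rreg (spend 1 s') 4 = a \<and>
      rarr (spend 1 s') 0 = u(Suc l := (\<lambda>j. u (Suc l) j + x * W j k)) \<and>
      ireg (spend 1 s') 6 = ireg s 6 + length (col_list acc k) \<and>
      (\<forall>l' k'. on_stack s l' k' \<longrightarrow> on_stack (spend 1 s') l' k') \<and>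
      (\<forall>j. W j k \<noteq> 0 \<longrightarrow> on_stack (spend 1 s') (Suc l) j) \<and>
      clock (spend 1 s') \<le> clock s + 1 + 11 * length (col_list acc k) \<and> clock s \<le> clock (spend 1 s')) \<and> c \<le> c"
      unfolding st using * Wks by (auto simp: I_def push_row ks_def[symmetric] push_base_def base_def)
  next
    fix s' assume "I s'" then show "clock s' \<le> clock s + 11 * length ks" by (auto simp: I_def)
  qed (use body in auto)
qed

text \<open>The offset 16 is 6 units for the initialisation and 10 for the single stacked
  pair.\<close>

lemma push_init_spec:
  assumes s: "base s" "rarr s = (\<lambda>_ _ _. 0)" "ireg s 5 = h"
    and T: "clock s + 16 + push_budget (\<lambda>_ _. 0) \<le> T"
  shows "ensures (run push_init s) (push_inv T) (\<lambda>_. c) c"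
proof -
  have "\<exists>s'. run push_init s = return_spmf s' \<and> ireg s' = (ireg s)(6 := 1) \<and>
      rreg s' = (rreg s)(3 := d, 4 := 0) \<and> rarr s' = (rarr s)(0 := (\<lambda>l. if l = 0 then v0 else (\<lambda>_. 0))) \<and>
      iarr s' 0 0 0 = 0 \<and> iarr s' 0 1 0 = w \<and> clock s' = clock s + 6"
    using s by (auto simp: push_init_def base_def fun_eq_iff)
  then obtain s' where s': "run push_init s = return_spmf s'"
    and f: "ireg s' = (ireg s)(6 := 1)" "rreg s' = (rreg s)(3 := d, 4 := 0)"
      "rarr s' = (rarr s)(0 := (\<lambda>l. if l = 0 then v0 else (\<lambda>_. 0)))"
      "iarr s' 0 0 0 = 0" "iarr s' 0 1 0 = w" "clock s' = clock s + 6"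
    by blast
  have u: "rarr s' 0 = (\<lambda>l. if l = 0 then v0 else (\<lambda>_. 0))" by (simp add: f)
  have "push_inv T s'"
    unfolding push_inv_def
  proof (intro conjI)
    show "push_base s'" using s w f(5) by (auto simp: push_base_def base_def f(1,2))
    show "rreg s' 4 + potential n W t_fun L (rarr s' 0) = target"
      unfolding u potential_initial by (simp add: f)
    show "\<forall>l<L. \<forall>k<n. big (rarr s' 0) l k \<longrightarrow> on_stack s' l k"
      unfolding u using f(5) by (auto simp: big_def on_stack_def f(1,4) split: if_splits)
    show "\<exists>p g. mass_inv n W h d w (rarr s' 0) p g \<and> clock s' + 10 * ireg s' 6 + push_budget p \<le> T"
      unfolding u
      by (intro exI[of _ "\<lambda>_ _. 0"] conjI mass_inv_initial d_pos) (use T in \<open>simp add: f\<close>)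
  qed
  then show ?thesis unfolding s' by (rule ensures_return) simp
qed

text \<open>A popped pair either needs no push, so that removing it is harmless, or its residual
  becomes 0. In the latter case only entries at the next level can newly become large, and those
  have been stacked.\<close>

lemma push_step_spec:
  assumes inv: "push_inv T s" and g: "0 < ireg s 6"
  shows "ensures (run (pop ;; Cond push_test (push_start ;; push_column) Skip) (spend 1 s))
    (\<lambda>s'. push_inv T s' \<and> clock s < clock s') (\<lambda>_. c) c"
proof -
  define m where "m = ireg s 6 - 1"
  have m: "ireg s 6 = Suc m" using g by (simp add: m_def)
  define l k where "l = iarr s 0 0 m" and "k = iarr s 0 1 m"
  define u x where "u = rarr s 0" and "x = u l k"
  have kn: "k < n" using inv m by (auto simp: push_inv_def push_base_def k_def)
  obtain p g where mass: "mass_inv n W h d w u p g" and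
    T: "clock s + 10 * Suc m + push_budget p \<le> T"
    using inv m by (auto simp: push_inv_def u_def)
  \<comment> \<open>Every large residual other than that of the popped pair keeps a copy below the
    top.\<close>
  have stk: "l' = l \<and> k' = k \<or> (\<exists>i<m. iarr s 0 0 i = l' \<and> iarr s 0 1 i = k')"
    if "l' < L" "k' < n" "big u l' k'" for l' k'
  proof -
    have "on_stack s l' k'" using inv that by (auto simp: push_inv_def u_def)
    then show ?thesis unfolding on_stack_def m l_def k_def by (auto simp: less_Suc_eq)
  qed
  have nodes: "\<forall>i<m. iarr s 0 1 i < n" using inv m by (auto simp: push_inv_def push_base_def)
  have pot: "rreg s 4 + potential n W t_fun L u = target" using inv by (simp add: push_inv_def u_def)
  have bs: "base s" "ireg s 5 = h" "rreg s 3 = d" using inv by (auto simp: push_inv_def push_base_def)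
  have "\<exists>s1. run pop (spend 1 s) = return_spmf s1 \<and> ireg s1 = (ireg s)(6 := m, 7 := l, 8 := k) \<and>
      rreg s1 = (rreg s)(5 := x) \<and> rarr s1 = rarr s \<and> iarr s1 = iarr s \<and> clock s1 = clock s + 5"
    by (simp add: pop_def m l_def k_def x_def u_def)
  then obtain s1 where s1: "run pop (spend 1 s) = return_spmf s1"
    and f1: "ireg s1 = (ireg s)(6 := m, 7 := l, 8 := k)" "rreg s1 = (rreg s)(5 := x)"
      "rarr s1 = rarr s" "iarr s1 = iarr s" "clock s1 = clock s + 5" by blast
  have sq: "1 < (x * (d * real h)) * (x * (d * real h)) \<longleftrightarrow> 1 < d * \<bar>x\<bar> * real h"
  proof -
    have "1 < (x * (d * real h)) * (x * (d * real h)) \<longleftrightarrow> 1 < \<bar>x * (d * real h)\<bar>"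
      using abs_square_less_1 by (metis abs_square_le_1 linorder_not_le power2_eq_square)
    then show ?thesis using d_pos by (simp add: abs_mult mult_ac)
  qed
  have test: "bval push_test s1 \<longleftrightarrow> l < L \<and> big u l k"
    using bs by (simp add: push_test_def f1 base_def big_def x_def[symmetric] sq)
  show ?thesis
  proof (cases "l < L \<and> big u l k")
    case False
    have "push_inv T (spend 1 s1)"
      unfolding push_inv_def
    proof (intro conjI)
      show "push_base (spend 1 s1)" using bs nodes by (simp add: push_base_def base_def f1)
      show "rreg (spend 1 s1) 4 + potential n W t_fun L (rarr (spend 1 s1) 0) = target"
        using pot by (simp add: f1 u_def)
      show "\<forall>l<L. \<forall>k<n. big (rarr (spend 1 s1) 0) l k \<longrightarrow> on_stack (spend 1 s1) l k"
        using False stk by (fastforce simp: f1 on_stack_def u_def[symmetric])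
      show "\<exists>p g. mass_inv n W h d w (rarr (spend 1 s1) 0) p g \<and>
          clock (spend 1 s1) + 10 * ireg (spend 1 s1) 6 + push_budget p \<le> T"
        using mass T by (auto simp: f1 u_def[symmetric] intro!: exI[of _ p] exI[of _ g])
    qed
    then show ?thesis using False test by (auto simp: s1[simplified] f1 intro!: ensures_return)
  next
    case True
    define len where "len = length (col_list acc k)"
    define u1 where "u1 = u(l := (u l)(k := 0))"
    define s2 where "s2 = spend 1 (set_rarr 0 l k 0 (spend 1 (set_rreg 4 (rreg s 4 + t $ k * x)
      (spend 1 (set_rreg 6 (t $ k) (spend 1 s1))))))"
    define s3 where "s3 = load_list 9 1 (col_list acc k) (\<lambda>j. M $$ (j,k)) s2"
    have run: "run (push_start ;; push_column) (spend 1 s1) = run push_column s3"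
      by (simp add: push_start_def f1 s2_def s3_def)
    have f2: "ireg s2 = ireg s1" "rreg s2 = (rreg s)(5 := x, 6 := t $ k, 4 := rreg s 4 + t $ k * x)"
      "rarr s2 0 = u1" "iarr s2 = iarr s" "clock s2 = clock s + 9"
      by (simp_all add: s2_def f1 u1_def u_def fun_eq_iff)
    have f3: "ireg s3 = (ireg s2)(9 := len)" "rreg s3 = rreg s2" "rarr s3 0 = u1"
      "iarr s3 0 = iarr s 0" "clock s3 = clock s + 10 + len"
      by (simp_all add: s3_def load_list_simps f2 len_def)
    let ?u' = "push_upd W l k x u"
    have u': "?u' = u1(Suc l := (\<lambda>j. u1 (Suc l) j + x * W j k))"
      by (simp add: push_upd_def u1_def)
    let ?p = "p(l := (p l)(k := Suc (p l k)))"
    have mass': "mass_inv n W h d w ?u' ?p (g(l := (g l)(k := g l k + d * \<bar>u l k\<bar>)))"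
      unfolding x_def by (rule mass_inv_push[OF mass d_pos kn]) (use True in \<open>simp add: big_def\<close>)
    \<comment> \<open>Applying the bound to the ghosts after the push shows that the budget still
      contained this push.\<close>
    have "Suc (p l k) \<le> push_bound n W h w l k"
      using mass_inv_le_push_bound[OF mass' d_pos, of l k] by simp
    then have bud: "push_budget p = push_budget ?p + push_cost k"
      using True kn by (intro push_budget_Suc) auto
    have "ensures (run push_column s3)
      (\<lambda>s'. push_base s' \<and> rreg s' 4 = rreg s 4 + t $ k * x \<and>
        rarr s' 0 = u1(Suc l := (\<lambda>j. u1 (Suc l) j + x * W j k)) \<and>
        ireg s' 6 = ireg s3 6 + length (col_list acc k) \<and>
        (\<forall>l' k'. on_stack s3 l' k' \<longrightarrow> on_stack s' l' k') \<and>
        (\<forall>j. W j k \<noteq> 0 \<longrightarrow> on_stack s' (Suc l) j) \<and>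
        clock s' \<le> clock s3 + 1 + 11 * length (col_list acc k) \<and> clock s3 \<le> clock s') (\<lambda>_. c) c"
    proof (rule push_column_spec[OF kn])
      show "push_base s3" using bs nodes by (simp add: push_base_def base_def f1 f2 f3)
    qed (simp_all add: f1 f2 f3 len_def, simp_all add: s3_def load_list_simps)
    then have "ensures (run push_column s3) (\<lambda>s'. push_inv T s' \<and> clock s < clock s') (\<lambda>_. c) c"
    proof (rule ensures_conseq)
      fix s' assume *: "push_base s' \<and> rreg s' 4 = rreg s 4 + t $ k * x \<and>
        rarr s' 0 = u1(Suc l := (\<lambda>j. u1 (Suc l) j + x * W j k)) \<and>
        ireg s' 6 = ireg s3 6 + length (col_list acc k) \<and>
        (\<forall>l' k'. on_stack s3 l' k' \<longrightarrow> on_stack s' l' k') \<and>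
        (\<forall>j. W j k \<noteq> 0 \<longrightarrow> on_stack s' (Suc l) j) \<and>
        clock s' \<le> clock s3 + 1 + 11 * length (col_list acc k) \<and> clock s3 \<le> clock s'"
      then have r: "rarr s' 0 = ?u'" by (simp add: u')
      have "push_inv T s'"
        unfolding push_inv_def
      proof (intro conjI)
        show "rreg s' 4 + potential n W t_fun L (rarr s' 0) = target"
          unfolding r using * pot potential_push[of l L k n t_fun u W] True kn by (simp add: x_def)
        show "\<forall>l<L. \<forall>k<n. big (rarr s' 0) l k \<longrightarrow> on_stack s' l k"
          unfolding r
        proof (intro allI impI)
          fix l' k' assume a: "l' < L" "k' < n" "big ?u' l' k'"
          show "on_stack s' l' k'"
          proof (cases "l' = Suc l \<and> W k' k \<noteq> 0")
            case False
            then have "?u' l' k' = (if l' = l \<and> k' = k then 0 else u l' k')"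
              by (auto simp: push_upd_def)
            then have "big u l' k'" "\<not> (l' = l \<and> k' = k)"
              using a(3) by (auto simp: big_def split: if_splits)
            then have "on_stack s3 l' k'" using stk[OF a(1,2)] by (auto simp: on_stack_def f1 f2 f3)
            then show ?thesis using * by blast
          qed (use * in blast)
        qed
        show "\<exists>p g. mass_inv n W h d w (rarr s' 0) p g \<and> clock s' + 10 * ireg s' 6 + push_budget p \<le> T"
          unfolding r
          by (intro exI conjI, rule mass') (use * T bud in \<open>simp add: f1 f2 f3 len_def push_cost_def\<close>)
      qed (use * in simp)
      then show "push_inv T s' \<and> clock s < clock s'" using * by (simp add: f3)
    qed auto
    then show ?thesis using True test by (simp add: s1[simplified] run[simplified])
  qed
qed

text \<open>With an empty stack, the coverage clause of \<open>push_inv\<close> leaves no large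
  residual below level \<open>L\<close>.\<close>

lemma push_loop_spec:
  assumes "push_inv T s"
  shows "ensures (run push_loop s)
    (\<lambda>s'. base s' \<and> ireg s' 5 = h \<and> rreg s' 4 + potential n W t_fun L (rarr s' 0) = target \<and>
       (\<forall>l<L. \<forall>k<n. \<bar>rarr s' 0 l k\<bar> \<le> 1 / (d * real h)) \<and> clock s' \<le> T + 1) (\<lambda>_. c) c"
  unfolding push_loop_def
proof (rule ensures_exec_while[where I = "push_inv T" and T = T and f = "\<lambda>_. c"])
  fix s' assume inv: "push_inv T s'" "\<not> bval (ILess (INat 0) (IReg 6)) s'"
  have "\<bar>rarr s' 0 l k\<bar> \<le> 1 / (d * real h)" if "l < L" "k < n" for l k
  proof -
    have "\<not> big (rarr s' 0) l k" using inv that by (auto simp: push_inv_def on_stack_def)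
    then show ?thesis using d_pos h1 by (simp add: big_def field_simps)
  qed
  then show "(base (spend 1 s') \<and> ireg (spend 1 s') 5 = h \<and>
      rreg (spend 1 s') 4 + potential n W t_fun L (rarr (spend 1 s') 0) = target \<and>
      (\<forall>l<L. \<forall>k<n. \<bar>rarr (spend 1 s') 0 l k\<bar> \<le> 1 / (d * real h)) \<and> clock (spend 1 s') \<le> T + 1) \<and> c \<le> c"
    using inv by (auto simp: push_inv_def push_base_def base_def)
next
  fix s' assume "push_inv T s'" "bval (ILess (INat 0) (IReg 6)) s'"
  then show "ensures (run (pop ;; Cond push_test (push_start ;; push_column) Skip) (spend 1 s'))
      (\<lambda>s''. push_inv T s'' \<and> clock s' < clock s'') (\<lambda>_. c) c"
    by (intro push_step_spec) auto
next
  fix s' assume "push_inv T s'"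
  then show "clock s' \<le> T" by (auto simp: push_inv_def)
qed (use assms in auto)

end

section \<open>Correctness and cost of the sampling phase\<close>

context rdd_instance
begin

section \<open>Laws of the random primitives\<close>

lemma walk_step_prob: "k < n \<Longrightarrow> j < n \<Longrightarrow>
    1/2 * ((if k = j then 1 else 0) + \<bar>AT M $$ (j,k)\<bar> / M $$ (j,j)) = \<bar>W j k\<bar>"
  using diag_pos[of j] by (auto simp: AT_def diag_part_def walk_mat_def dims abs_mult)

lemma pmf_walk_step:
  assumes "j < n"
  shows "pmf (walk_step M j) (Some k) = (if k < n then \<bar>W j k\<bar> else 0)"
proof -
  let ?f = "\<lambda>k. if k < n then \<bar>W j k\<bar> else 0"
  have eq: "walk_step M j = embed_spmf ?f"
    unfolding walk_step_def using walk_step_prob[OF _ assms]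
    by (intro arg_cong[of _ _ embed_spmf] ext) (simp add: dims)
  have "(\<integral>\<^sup>+ x. ennreal (?f x) \<partial>count_space UNIV) = (\<Sum>x<n. ennreal (?f x))"
    by (rule nn_integral_count_space') auto
  also have "\<dots> = ennreal (\<Sum>k<n. \<bar>W j k\<bar>)" by simp
  also have "\<dots> \<le> 1" using substochastic_W assms by (simp add: substochastic_def)
  finally show ?thesis unfolding eq by (simp add: spmf_embed_spmf)
qed

lemma pnorm_1: "pnorm 1 t = \<tau>"
proof -
  have "(1::ereal) \<noteq> \<infinity>" by simp
  then show ?thesis by (simp add: pnorm_def dims)
qed

lemma \<tau>_pos: "0 < \<tau>"
proof -
  obtain i where "i < n" "t $ i \<noteq> 0" using t0 t by (metis dims(3) eq_vecI index_zero_vec(1,2))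
  then show ?thesis by (intro sum_pos2[of _ i]) auto
qed

lemma pmf_sample_abs: "pmf (sample_abs t) j = (if j < n then \<bar>t $ j\<bar> / \<tau> else 0)"
proof -
  let ?f = "\<lambda>j. if j < n then \<bar>t $ j\<bar> / \<tau> else 0"
  have eq: "sample_abs t = embed_pmf ?f" unfolding sample_abs_def pnorm_1 dims ..
  have "(\<integral>\<^sup>+ x. ennreal (?f x) \<partial>count_space UNIV) = (\<Sum>x<n. ennreal (?f x))"
    by (rule nn_integral_count_space') auto
  also have "\<dots> = ennreal (\<Sum>x<n. ?f x)" using \<tau>_pos by (intro sum_ennreal) auto
  also have "(\<Sum>x<n. ?f x) = 1" using \<tau>_pos by (simp add: sum_divide_distrib[symmetric])
  finally show ?thesis unfolding eq using \<tau>_pos by (subst pmf_embed_pmf) auto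
qed

lemma ensures_seq_SampleT:
  assumes "\<And>k. k < n \<Longrightarrow> ensures (run c (spend 1 (set_ireg x k s))) Q f (g k)"
    "(\<Sum>k<n. \<bar>t $ k\<bar> / \<tau> * g k) \<le> v"
  shows "ensures (run (SampleT x ;; c) s) Q f v"
proof -
  have "run (SampleT x ;; c) s = bind_spmf (spmf_of_pmf (sample_abs t)) (\<lambda>k. run c (spend 1 (set_ireg x k s)))"
    by (simp add: bind_map_pmf spmf_of_pmf_def bind_spmf_def map_bind_pmf)
  moreover have "ensures \<dots> Q f v"
    by (rule ensures_bind_pmf[where A = "{..<n}" and g = g])
      (use assms in \<open>auto simp: set_pmf_eq pmf_sample_abs split: if_splits\<close>)
  ultimately show ?thesis by simp
qed

text \<open>The termination branch is given value 0, so the deficit of row \<open>j\<close> adds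
  nothing to the mean.\<close>

lemma ensures_seq_Step:
  assumes j: "ival e s = j" "j < n"
    and Some: "\<And>k. k < n \<Longrightarrow>
      ensures (run c (spend (step_time acc j) (set_ireg x k (set_rreg y (M $$ (j,k)) s)))) Q f (g k)"
    and None: "ensures (run c (spend (step_time acc j) (set_ireg x n (set_rreg y 0 s)))) Q f 0"
    and v: "(\<Sum>k<n. \<bar>W j k\<bar> * g k) \<le> v"
  shows "ensures (run (Step x y e ;; c) s) Q f v"
proof -
  have "run (Step x y e ;; c) s = bind_spmf (spmf_of_pmf (walk_step M j))
      (\<lambda>r. run c (spend (step_time acc j) (case r of
         None \<Rightarrow> set_ireg x n (set_rreg y 0 s)
       | Some k \<Rightarrow> set_ireg x k (set_rreg y (M $$ (j,k)) s))))"
    by (simp add: bind_map_pmf spmf_of_pmf_def bind_spmf_def map_bind_pmf j dims cong: option.case_cong)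
  moreover have "ensures \<dots> Q f v"
  proof (rule ensures_bind_pmf[where A = "insert None (Some ` {..<n})" and g = "case_option 0 g"])
    show "set_pmf (walk_step M j) \<subseteq> insert None (Some ` {..<n})"
    proof
      fix r assume r: "r \<in> set_pmf (walk_step M j)"
      then show "r \<in> insert None (Some ` {..<n})"
        using pmf_walk_step[OF j(2)] by (cases r) (auto simp: set_pmf_eq split: if_splits)
    qed
    then show "ensures (run c (spend (step_time acc j) (case r of
         None \<Rightarrow> set_ireg x n (set_rreg y 0 s)
       | Some k \<Rightarrow> set_ireg x k (set_rreg y (M $$ (j,k)) s)))) Q f (case_option 0 g r)"
      if "r \<in> set_pmf (walk_step M j)" for r
      using that Some None by (cases r) auto
    have "(\<Sum>a\<in>insert None (Some ` {..<n}). pmf (walk_step M j) a * case_option 0 g a)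
        = (\<Sum>k<n. \<bar>W j k\<bar> * g k)"
      by (subst sum.insert) (auto simp: sum.reindex pmf_walk_step[OF j(2)])
    then show "(\<Sum>a\<in>insert None (Some ` {..<n}). pmf (walk_step M j) a * case_option 0 g a) \<le> v"
      using v by simp
  qed simp
  ultimately show ?thesis by simp
qed

definition walk_base :: "real \<Rightarrow> (nat \<Rightarrow> nat \<Rightarrow> real) \<Rightarrow> real \<Rightarrow> real \<Rightarrow> nat \<Rightarrow> state \<Rightarrow> bool" where
  "walk_base a u R S i s \<longleftrightarrow> base s \<and> ireg s 5 = h \<and> rreg s 4 = a \<and> rarr s 0 = u \<and>
     rreg s 9 = R \<and> rreg s 10 = S \<and> ireg s 11 = i"

lemma step_time_le: "j < n \<Longrightarrow> step_time acc j \<le> f\<^sub>r"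
  unfolding f_row_def by (rule Max_ge) (auto simp: dims)

text \<open>With \<open>m\<close> the remaining length, the sign times \<open>(W^m u_l)(X)\<close>
  is a martingale. The factor \<open>c\<close> of arbitrary sign makes the one-sided
  \<open>ensures\<close> yield both bounds on the mean.\<close>

lemma walk_spec:
  assumes s: "walk_base a u R S i s" "ireg s 14 = l" "\<bar>rreg s 12\<bar> \<le> 1" "ireg s 12 < n"
  shows "ensures (run walk s)
    (\<lambda>s'. walk_base a u R S i s' \<and> ireg s' 14 = l \<and> \<bar>rreg s' 12\<bar> \<le> 1 \<and>
       (ireg s' 12 < n \<or> rreg s' 12 = 0) \<and>
       clock s' \<le> clock s + 1 + ireg s 13 * (10 + f\<^sub>r) \<and> clock s \<le> clock s')
    (\<lambda>s'. c * (rreg s' 12 * u l (ireg s' 12)))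
    (c * (rreg s 12 * (app n W ^^ ireg s 13) (u l) (ireg s 12)))"
proof -
  define I where "I s' \<longleftrightarrow> walk_base a u R S i s' \<and> ireg s' 14 = l \<and> \<bar>rreg s' 12\<bar> \<le> 1 \<and>
       (ireg s' 12 < n \<or> rreg s' 12 = 0) \<and>
       clock s' + ireg s' 13 * (10 + f\<^sub>r) \<le> clock s + ireg s 13 * (10 + f\<^sub>r) \<and> clock s \<le> clock s'" for s'
  define V where "V s' = c * (rreg s' 12 * (app n W ^^ ireg s' 13) (u l) (ireg s' 12))" for s' :: state
  have body: "ensures (run walk_body (spend 1 s')) (\<lambda>s''. I s'' \<and> clock s' < clock s'') V (V s')"
    if I: "I s'" and g: "0 < ireg s' 13" "ireg s' 12 < n" for s'
  proof -
    define m X \<sigma> where "m = ireg s' 13 - 1" and "X = ireg s' 12" and "\<sigma> = rreg s' 12"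
    have m: "ireg s' 13 = Suc m" and X: "X < n" using g by (auto simp: m_def X_def)
    have st: "step_time acc X \<le> f\<^sub>r" using step_time_le X by simp
    define s1 where "s1 = spend 1 (set_ireg 13 m (spend 1 s'))"
    define \<sigma>' where "\<sigma>' k = (if k \<noteq> X \<and> 0 < M $$ (X,k) then - \<sigma> else \<sigma>)" for k
    define fin where "fin = Cond (ILess (IReg 15) (IReg 0))
       (Cond (BAnd (BNot (ILess (IReg 15) (IReg 12))) (BNot (ILess (IReg 12) (IReg 15)))) Skip
          (Cond (RLess (ROfNat (INat 0)) (RReg 13)) (RSet 12 (RSub (ROfNat (INat 0)) (RReg 12))) Skip))
       (RSet 12 (ROfNat (INat 0))) ;;
     ISet 12 (IReg 15)"
    have n: "ireg s' 0 = n" using I by (simp add: I_def walk_base_def base_def)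
    have "ensures (run (Step 15 13 (IReg 12) ;; fin) s1) (\<lambda>s''. I s'' \<and> clock s' < clock s'') V (V s')"
    proof (rule ensures_seq_Step[where j = X and g = "\<lambda>k. c * (\<sigma>' k * (app n W ^^ m) (u l) k)"])
      fix k assume k: "k < n"
      let ?s = "spend (step_time acc X) (set_ireg 15 k (set_rreg 13 (M $$ (X,k)) s1))"
      have "\<exists>s2 e. run fin ?s = return_spmf s2 \<and> e \<le> 7 \<and> 2 \<le> e \<and>
         ireg s2 = (ireg s')(13 := m, 15 := k, 12 := k) \<and> rreg s2 = (rreg s')(13 := M $$ (X,k), 12 := \<sigma>' k) \<and>
         rarr s2 = rarr s' \<and> clock s2 = clock s' + step_time acc X + e"
        using k n by (auto simp: fin_def s1_def X_def[symmetric] \<sigma>'_def \<sigma>_def fun_eq_iff)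
      then obtain s2 e where s2: "run fin ?s = return_spmf s2" and
        f: "ireg s2 = (ireg s')(13 := m, 15 := k, 12 := k)" "rreg s2 = (rreg s')(13 := M $$ (X,k), 12 := \<sigma>' k)"
         "rarr s2 = rarr s'" "clock s2 = clock s' + step_time acc X + e" "e \<le> 7" "2 \<le> e" by blast
      have "\<bar>\<sigma>' k\<bar> \<le> 1" using I by (simp add: I_def \<sigma>'_def \<sigma>_def)
      then have "I s2" using I k st f(5) by (simp add: I_def f(1-4) walk_base_def base_def m)
      then show "ensures (run fin ?s) (\<lambda>s''. I s'' \<and> clock s' < clock s'') V
          (c * (\<sigma>' k * (app n W ^^ m) (u l) k))"
        unfolding s2 using f(6) by (intro ensures_return) (simp_all add: V_def f(1-4))
    next
      let ?s = "spend (step_time acc X) (set_ireg 15 n (set_rreg 13 0 s1))"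
      have "\<exists>s2 e. run fin ?s = return_spmf s2 \<and> e \<le> 7 \<and> 2 \<le> e \<and>
         ireg s2 = (ireg s')(13 := m, 15 := n, 12 := n) \<and> rreg s2 = (rreg s')(13 := 0, 12 := 0) \<and>
         rarr s2 = rarr s' \<and> clock s2 = clock s' + step_time acc X + e"
        using n by (auto simp: fin_def s1_def fun_eq_iff)
      then obtain s2 e where s2: "run fin ?s = return_spmf s2" and
        f: "ireg s2 = (ireg s')(13 := m, 15 := n, 12 := n)" "rreg s2 = (rreg s')(13 := 0, 12 := 0)"
         "rarr s2 = rarr s'" "clock s2 = clock s' + step_time acc X + e" "e \<le> 7" "2 \<le> e" by blast
      have "I s2" using I st f(5) by (simp add: I_def f(1-4) walk_base_def base_def m)
      then show "ensures (run fin ?s) (\<lambda>s''. I s'' \<and> clock s' < clock s'') V 0"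
        unfolding s2 using f(6) by (intro ensures_return) (simp_all add: V_def f(1-4))
    next
      \<comment> \<open>The sign update turns the weight \<open>|W|\<close> of the walk into
        \<open>W\<close>; where \<open>W X k\<close> is 0 both sides vanish.\<close>
      have Wk: "\<bar>W X k\<bar> * \<sigma>' k = \<sigma> * W X k" if "k < n" for k
        using that X diag_pos[OF X]
        by (auto simp: walk_mat_def \<sigma>'_def dims abs_mult abs_if zero_less_divide_iff zero_less_mult_iff)
      have "(\<Sum>k<n. \<bar>W X k\<bar> * (c * (\<sigma>' k * (app n W ^^ m) (u l) k)))
          = (\<Sum>k<n. c * \<sigma> * (W X k * (app n W ^^ m) (u l) k))"
        using Wk by (intro sum.cong) (auto simp: algebra_simps)
      also have "\<dots> = V s'" by (simp add: V_def m app_def sum_distrib_left X_def \<sigma>_def mult_ac)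
      finally show "(\<Sum>k<n. \<bar>W X k\<bar> * (c * (\<sigma>' k * (app n W ^^ m) (u l) k))) \<le> V s'" by simp
    qed (use X in \<open>auto simp: s1_def X_def\<close>)
    moreover have "run walk_body (spend 1 s') = run (Step 15 13 (IReg 12) ;; fin) s1"
      by (simp add: walk_body_def fin_def s1_def m)
    ultimately show ?thesis by simp
  qed
  show ?thesis
    unfolding walk_def
  proof (rule ensures_exec_while[where I = I and T = "clock s + ireg s 13 * (10 + f\<^sub>r)" and f = V])
    fix s' assume I: "I s'" and g: "\<not> bval (BAnd (ILess (INat 0) (IReg 13)) (ILess (IReg 12) (IReg 0))) s'"
    have "ireg s' 0 = n" using I by (simp add: I_def walk_base_def base_def)
    \<comment> \<open>A walk stopped at vertex \<open>n\<close> has sign 0, so whatever the array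
      holds there is multiplied by 0.\<close>
    then have "ireg s' 13 = 0 \<or> rreg s' 12 = 0" using I g by (auto simp: I_def)
    then have "V s' = c * (rreg s' 12 * u l (ireg s' 12))" by (auto simp: V_def)
    then show "(walk_base a u R S i (spend 1 s') \<and> ireg (spend 1 s') 14 = l \<and> \<bar>rreg (spend 1 s') 12\<bar> \<le> 1 \<and>
       (ireg (spend 1 s') 12 < n \<or> rreg (spend 1 s') 12 = 0) \<and>
       clock (spend 1 s') \<le> clock s + 1 + ireg s 13 * (10 + f\<^sub>r) \<and> clock s \<le> clock (spend 1 s')) \<and>
       c * (rreg (spend 1 s') 12 * u l (ireg (spend 1 s') 12)) \<le> V s'"
      using I by (auto simp: I_def walk_base_def base_def)
  next
    fix s' assume "I s'" then show "clock s' \<le> clock s + ireg s 13 * (10 + f\<^sub>r)" by (auto simp: I_def)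
  next
    fix s' assume "I s'" "bval (BAnd (ILess (INat 0) (IReg 13)) (ILess (IReg 12) (IReg 0))) s'"
    then show "ensures (run walk_body (spend 1 s')) (\<lambda>s''. I s'' \<and> clock s' < clock s'') V (V s')"
      by (intro body) (auto simp: I_def walk_base_def base_def)
  qed (use s in \<open>auto simp: I_def V_def\<close>)
qed

definition sample_cost :: nat where
  "sample_cost = 30 + L * (10 + f\<^sub>r)"

definition sample_post :: "real \<Rightarrow> (nat \<Rightarrow> nat \<Rightarrow> real) \<Rightarrow> real \<Rightarrow> real \<Rightarrow> nat \<Rightarrow> real \<Rightarrow> nat \<Rightarrow> state \<Rightarrow> bool" where
  "sample_post a u R S i B T s' \<longleftrightarrow> (\<exists>Y. \<bar>Y\<bar> \<le> B \<and> walk_base a u R (S + Y) (Suc i) s') \<and>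
     T < clock s' \<and> clock s' + 15 \<le> T + sample_cost"

text \<open>Length and level are already drawn. A terminated walk or a pair outside the triangle has
  sign 0, so the bound \<open>B\<close> on the residuals bounds every sample.\<close>

lemma sample_tail_spec:
  assumes s: "walk_base a u R S i s" "ireg s 14 = l" "l < L" "ireg s 13 = j" "j < L"
    "rreg s 12 = \<sigma>" "\<bar>\<sigma>\<bar> \<le> 1" "ireg s 12 = X" "X < n" "T \<le> clock s" "clock s \<le> T + 10"
    and B: "\<And>l k. l < L \<Longrightarrow> k < n \<Longrightarrow> \<bar>u l k\<bar> \<le> B" "0 \<le> B"
  shows "ensures (run (Cond (ILess (IAdd (IReg 13) (IReg 14)) (IReg 2)) Skip (RSet 12 (ROfNat (INat 0))) ;;
     walk ;; RSet 10 (RAdd (RReg 10) (RMul (RReg 12) (RArr 0 (IReg 14) (IReg 12)))) ;;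
     ISet 11 (IAdd (IReg 11) (INat 1))) s) (sample_post a u R S i B T) (\<lambda>s'. c * (rreg s' 10 - S))
     (c * (if j + l < L then \<sigma> * (app n W ^^ j) (u l) X else 0))"
    (is "ensures (run (?cond ;; walk ;; ?fin) s) _ _ _")
proof -
  define \<sigma>' where "\<sigma>' = (if j + l < L then \<sigma> else 0)"
  have "\<exists>s1 e. run ?cond s = return_spmf s1 \<and> ireg s1 = ireg s \<and> rreg s1 = (rreg s)(12 := \<sigma>') \<and>
      rarr s1 = rarr s \<and> clock s1 = clock s + e \<and> e \<le> 2"
    using s by (auto simp: walk_base_def base_def \<sigma>'_def)
  then obtain s1 e where s1: "run ?cond s = return_spmf s1" and
    f: "ireg s1 = ireg s" "rreg s1 = (rreg s)(12 := \<sigma>')" "rarr s1 = rarr s" "clock s1 = clock s + e" "e \<le> 2"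
    by blast
  have tail: "ensures (run (walk ;; ?fin) s1) (sample_post a u R S i B T) (\<lambda>s'. c * (rreg s' 10 - S))
     (c * (rreg s1 12 * (app n W ^^ ireg s1 13) (u l) (ireg s1 12)))"
  proof (rule ensures_seq, rule walk_spec)
    show "walk_base a u R S i s1" using s by (simp add: walk_base_def base_def f)
  next
    fix s' assume s': "walk_base a u R S i s' \<and> ireg s' 14 = l \<and> \<bar>rreg s' 12\<bar> \<le> 1 \<and>
       (ireg s' 12 < n \<or> rreg s' 12 = 0) \<and>
       clock s' \<le> clock s1 + 1 + ireg s1 13 * (10 + f\<^sub>r) \<and> clock s1 \<le> clock s'"
    define Y where "Y = rreg s' 12 * u l (ireg s' 12)"
    define s'' where "s'' = spend 1 (set_ireg 11 (Suc i) (spend 1 (set_rreg 10 (S + Y) s')))"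
    have s'': "run ?fin s' = return_spmf s''"
      using s' by (simp add: s''_def Y_def walk_base_def)
    have "\<bar>Y\<bar> \<le> B"
    proof (cases "rreg s' 12 = 0")
      case False
      then have "\<bar>Y\<bar> \<le> 1 * B" unfolding Y_def abs_mult
        using s' s B by (intro mult_mono) auto
      then show ?thesis by simp
    qed (use B in \<open>simp add: Y_def\<close>)
    moreover have "clock s' \<le> 13 + T + L * (10 + f\<^sub>r)" "T \<le> clock s'"
    proof -
      have "j * (10 + f\<^sub>r) \<le> L * (10 + f\<^sub>r)" using s by (intro mult_right_mono) auto
      moreover have "clock s' \<le> clock s + e + 1 + j * (10 + f\<^sub>r)" "clock s + e \<le> clock s'"
        using s' s by (simp_all add: f)
      ultimately show "clock s' \<le> 13 + T + L * (10 + f\<^sub>r)" "T \<le> clock s'"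
        using s(10,11) f(5) by linarith+
    qed
    moreover have "walk_base a u R (S + Y) (Suc i) s''"
      using s' by (simp add: s''_def walk_base_def base_def)
    ultimately have "sample_post a u R S i B T s''"
      unfolding sample_post_def sample_cost_def by (auto simp: s''_def)
    then show "ensures (run ?fin s') (sample_post a u R S i B T) (\<lambda>s'. c * (rreg s' 10 - S))
        (c * (rreg s' 12 * u l (ireg s' 12)))"
      unfolding s'' by (rule ensures_return) (simp add: s''_def Y_def)
  qed (use s in \<open>auto simp: f \<sigma>'_def\<close>)
  have val: "rreg s1 12 * (app n W ^^ ireg s1 13) (u l) (ireg s1 12)
      = (if j + l < L then \<sigma> * (app n W ^^ j) (u l) X else 0)"
    using s by (simp add: f \<sigma>'_def)
  have cond: "run (?cond ;; walk ;; ?fin) s = run (walk ;; ?fin) s1"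
    by (subst exec.simps(6)) (simp only: s1 return_bind_spmf)
  show ?thesis unfolding cond using tail unfolding val .
qed

text \<open>Signs of \<open>t\<close> averaged against \<open>|t| / \<tau>\<close> give
  \<open>t / \<tau>\<close>, and the two uniform draws give the square of
  \<open>potential_eq\<close> with weight \<open>1 / L^2\<close>.\<close>

lemma sample_body_spec:
  assumes s: "walk_base a u R S i s"
    and B: "\<And>l k. l < L \<Longrightarrow> k < n \<Longrightarrow> \<bar>u l k\<bar> \<le> B" "0 \<le> B"
  shows "ensures (run sample_body s) (sample_post a u R S i B (clock s)) (\<lambda>s'. c * (rreg s' 10 - S))
     (c * (potential n W t_fun L u / (\<tau> * (real L)^2)))"
proof -
  define sg where "sg X = (if 0 < t $ X then 1 else - 1 :: real)" for X
  define v where "v X j l = c * (if j + l < L then sg X * (app n W ^^ j) (u l) X else 0)" for X j l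
  \<comment> \<open>\<open>Uniform\<close> includes its upper end, so drawing up to
    \<open>L - 1\<close> gives \<open>L\<close> outcomes; \<open>0 < L\<close> keeps the subtraction
    exact.\<close>
  have Lsum: "(\<Sum>k\<le>L - 1. f k) / real (Suc (L - 1)) = (\<Sum>k<L. f k) / real L" for f :: "nat \<Rightarrow> real"
  proof -
    have "{..L - 1} = {..<L}" "Suc (L - 1) = L" using L by auto
    then show ?thesis by simp
  qed
  have L2: "ireg s 2 = L" using s by (simp add: walk_base_def base_def)
  show ?thesis
    unfolding sample_body_def
  proof (rule ensures_seq_SampleT)
    fix X assume X: "X < n"
    define s1 where "s1 = spend 1 (set_rreg 12 (sg X) (spend 1 (spend 1
        (set_rreg 11 (t $ X) (spend 1 (set_ireg 12 X s))))))"
    let ?tail = "Cond (ILess (IAdd (IReg 13) (IReg 14)) (IReg 2)) Skip (RSet 12 (ROfNat (INat 0))) ;;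
     walk ;; RSet 10 (RAdd (RReg 10) (RMul (RReg 12) (RArr 0 (IReg 14) (IReg 12)))) ;;
     ISet 11 (IAdd (IReg 11) (INat 1))"
    have "ensures (run (Uniform 13 (ISub (IReg 2) (INat 1)) ;; Uniform 14 (ISub (IReg 2) (INat 1)) ;; ?tail) s1)
        (sample_post a u R S i B (clock s)) (\<lambda>s'. c * (rreg s' 10 - S))
        ((\<Sum>j<L. (\<Sum>l<L. v X j l) / real L) / real L)"
    proof (rule ensures_seq_Uniform[where g = "\<lambda>j. (\<Sum>l<L. v X j l) / real L"], goal_cases)
      case (1 j)
      then have j: "j < L" using L L2 by (simp add: s1_def)
      show ?case
      proof (rule ensures_seq_Uniform[where g = "v X j"], goal_cases)
        case (1 l)
        then have l: "l < L" using L L2 by (simp add: s1_def)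
        show ?case
          unfolding v_def
          by (rule sample_tail_spec)
            (use s B l j X in \<open>auto simp: s1_def walk_base_def base_def sg_def\<close>)
      next
        case 2
        then show ?case using Lsum[of "v X j"] by (simp add: s1_def L2)
      qed
    next
      case 2
      then show ?case using Lsum[of "\<lambda>j. (\<Sum>l<L. v X j l) / real L"] by (simp add: s1_def L2)
    qed
    moreover have "run (GetT 11 (IReg 12) ;;
     Cond (RLess (ROfNat (INat 0)) (RReg 11)) (RSet 12 (ROfNat (INat 1)))
       (RSet 12 (RSub (ROfNat (INat 0)) (ROfNat (INat 1)))) ;;
     Uniform 13 (ISub (IReg 2) (INat 1)) ;; Uniform 14 (ISub (IReg 2) (INat 1)) ;; ?tail)
       (spend 1 (set_ireg 12 X s)) =
      run (Uniform 13 (ISub (IReg 2) (INat 1)) ;; Uniform 14 (ISub (IReg 2) (INat 1)) ;; ?tail) s1"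
      by (simp add: s1_def sg_def)
    ultimately show "ensures (run (GetT 11 (IReg 12) ;;
     Cond (RLess (ROfNat (INat 0)) (RReg 11)) (RSet 12 (ROfNat (INat 1)))
       (RSet 12 (RSub (ROfNat (INat 0)) (ROfNat (INat 1)))) ;;
     Uniform 13 (ISub (IReg 2) (INat 1)) ;; Uniform 14 (ISub (IReg 2) (INat 1)) ;; ?tail)
       (spend 1 (set_ireg 12 X s))) (sample_post a u R S i B (clock s)) (\<lambda>s'. c * (rreg s' 10 - S))
        ((\<Sum>j<L. (\<Sum>l<L. v X j l) / real L) / real L)" by simp
  next
    \<comment> \<open>The sign is -1 where \<open>t $ X\<close> is 0, which the zero factor
      hides.\<close>
    have tsg: "\<bar>t $ X\<bar> * sg X = t $ X" for X by (simp add: sg_def)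
    have "(\<Sum>X<n. \<bar>t $ X\<bar> / \<tau> * ((\<Sum>j<L. (\<Sum>l<L. v X j l) / real L) / real L))
        = (\<Sum>X<n. \<Sum>j<L. \<Sum>l<L. \<bar>t $ X\<bar> * v X j l) / (\<tau> * (real L)^2)"
      by (simp add: sum_divide_distrib sum_distrib_left power2_eq_square mult_ac)
    also have "(\<Sum>X<n. \<Sum>j<L. \<Sum>l<L. \<bar>t $ X\<bar> * v X j l) =
        (\<Sum>j<L. \<Sum>X<n. \<Sum>l<L. \<bar>t $ X\<bar> * v X j l)"
      by (rule sum.swap)
    also have "\<dots> = (\<Sum>j<L. \<Sum>l<L. \<Sum>X<n. \<bar>t $ X\<bar> * v X j l)"
      by (rule sum.cong[OF refl], rule sum.swap)
    also have "\<dots> = (\<Sum>j<L. \<Sum>l<L. c * (if j + l < L then \<Sum>X<n. t $ X * (app n W ^^ j) (u l) X else 0))"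
    proof (intro sum.cong refl)
      fix j l
      have "\<bar>t $ X\<bar> * v X j l = c * (if j + l < L then t $ X * (app n W ^^ j) (u l) X else 0)" for X
        unfolding v_def by (subst (2) tsg[symmetric]) simp
      then show "(\<Sum>X<n. \<bar>t $ X\<bar> * v X j l) =
          c * (if j + l < L then \<Sum>X<n. t $ X * (app n W ^^ j) (u l) X else 0)"
        by (simp add: sum_distrib_left)
    qed
    also have "\<dots> = c * potential n W t_fun L u"
      unfolding potential_eq by (subst sum.swap) (simp add: sum_distrib_left)
    finally show "(\<Sum>X<n. \<bar>t $ X\<bar> / \<tau> * ((\<Sum>j<L. (\<Sum>l<L. v X j l) / real L) / real L))
        \<le> c * (potential n W t_fun L u / (\<tau> * (real L)^2))" by simp
  qed
qed

text \<open>For \<open>i\<close> samples with sum \<open>S\<close>, mean \<open>\<mu>\<close> and absolute values at most \<open>B\<close>, the process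
  \<open>(S - i \<mu>)\<^sup>2 - i B\<^sup>2\<close> is a supermartingale.\<close>

lemma sample_loop_spec:
  assumes s: "walk_base a u R 0 0 s"
    and B: "\<And>l k. l < L \<Longrightarrow> k < n \<Longrightarrow> \<bar>u l k\<bar> \<le> B" "0 \<le> B"
  defines "\<mu> \<equiv> potential n W t_fun L u / (\<tau> * (real L)^2)"
  shows "ensures (run sample_loop s)
    (\<lambda>s'. base s' \<and> rreg s' 4 = a \<and> ireg s' 11 = nat \<lceil>R\<rceil> \<and> clock s' \<le> clock s + 1 + nat \<lceil>R\<rceil> * sample_cost)
    (\<lambda>s'. (rreg s' 10 - real (nat \<lceil>R\<rceil>) * \<mu>)^2) (real (nat \<lceil>R\<rceil>) * B^2)"
proof -
  define N where "N = nat \<lceil>R\<rceil>"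
  define I where "I s' \<longleftrightarrow> (\<exists>S i. walk_base a u R S i s' \<and> i \<le> N \<and>
    clock s' + (N - i) * sample_cost \<le> clock s + N * sample_cost)" for s'
  \<comment> \<open>The shift by \<open>N * B^2\<close> makes the initial value the asserted bound
    and the value after \<open>N\<close> samples the plain square.\<close>
  define F where "F s' = (rreg s' 10 - real (ireg s' 11) * \<mu>)^2 - real (ireg s' 11) * B^2 + real N * B^2" for s' :: state
  show ?thesis
    unfolding sample_loop_def
  proof (rule ensures_exec_while[where I = I and T = "clock s + N * sample_cost" and f = F])
    fix s' assume I: "I s'" and g: "bval (RLess (ROfNat (IReg 11)) (RReg 9)) s'"
    then obtain S i where i: "walk_base a u R S i s'" "clock s' + (N - i) * sample_cost \<le> clock s + N * sample_cost"
      by (auto simp: I_def)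
    then have r: "real i < R" "ireg s' 11 = i" "rreg s' 10 = S" using g by (auto simp: walk_base_def)
    then have iN: "i < N" unfolding N_def by linarith
    define D where "D = S - real i * \<mu>"
    have ib: "walk_base a u R S i (spend 1 s')" using i(1) by (simp add: walk_base_def base_def)
    \<comment> \<open>The coefficient is that of the new sample \<open>Y\<close> in the expansion of
      \<open>(D - \<mu> + Y)^2\<close>; the square of \<open>Y\<close> is bounded separately by
      \<open>B^2\<close>.\<close>
    have "ensures (run sample_body (spend 1 s')) (sample_post a u R S i B (clock (spend 1 s')))
      (\<lambda>s''. (2 * D - 2 * \<mu>) * (rreg s'' 10 - S)) ((2 * D - 2 * \<mu>) * \<mu>)"
      unfolding \<mu>_def by (rule sample_body_spec[OF ib B])
    then show "ensures (run sample_body (spend 1 s')) (\<lambda>s''. I s'' \<and> clock s' < clock s'') F (F s')"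
    proof (rule ensures_affine[where a = 1 and b = "(D - \<mu>)^2 - real i * B^2 + real N * B^2"])
      fix s'' assume p: "sample_post a u R S i B (clock (spend 1 s')) s''"
      then obtain Y where Y: "\<bar>Y\<bar> \<le> B" "walk_base a u R (S + Y) (Suc i) s''" by (auto simp: sample_post_def)
      have "(N - i) * sample_cost = (N - Suc i) * sample_cost + sample_cost"
        using iN by (metis Suc_diff_Suc mult_Suc add.commute)
      then show "I s'' \<and> clock s' < clock s''"
        using p Y i(2) iN by (auto simp: I_def sample_post_def intro!: exI[of _ "S + Y"] exI[of _ "Suc i"])
      have "Y^2 \<le> B^2" using Y by (metis B(2) abs_le_square_iff abs_of_nonneg)
      moreover have "rreg s'' 10 = S + Y" "ireg s'' 11 = Suc i" using Y by (auto simp: walk_base_def)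
      ultimately show "F s'' \<le> 1 * ((2 * D - 2 * \<mu>) * (rreg s'' 10 - S)) + ((D - \<mu>)^2 - real i * B^2 + real N * B^2)"
        by (simp add: F_def D_def power2_eq_square algebra_simps)
    next
      show "1 * ((2 * D - 2 * \<mu>) * \<mu>) + ((D - \<mu>)^2 - real i * B^2 + real N * B^2) \<le> F s'"
      proof -
        have "(2 * D - 2 * \<mu>) * \<mu> + (D - \<mu>)^2 = D^2 - \<mu>^2" by (simp add: power2_eq_square algebra_simps)
        moreover have "F s' = D^2 - real i * B^2 + real N * B^2" by (simp add: F_def r D_def)
        ultimately show ?thesis using zero_le_power2[of \<mu>] by linarith
      qed
    qed simp
  next
    fix s' assume I: "I s'" and g: "\<not> bval (RLess (ROfNat (IReg 11)) (RReg 9)) s'"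
    then obtain S i where i: "walk_base a u R S i s'" "i \<le> N"
      "clock s' + (N - i) * sample_cost \<le> clock s + N * sample_cost"
      by (auto simp: I_def)
    then have "R \<le> real i" using g by (auto simp: walk_base_def)
    then have "i = N" using i(2) unfolding N_def by linarith
    then show "(base (spend 1 s') \<and> rreg (spend 1 s') 4 = a \<and> ireg (spend 1 s') 11 = nat \<lceil>R\<rceil> \<and>
       clock (spend 1 s') \<le> clock s + 1 + nat \<lceil>R\<rceil> * sample_cost) \<and>
       (rreg (spend 1 s') 10 - real (nat \<lceil>R\<rceil>) * \<mu>)^2 \<le> F s'"
      using i by (auto simp: walk_base_def base_def F_def N_def)
  next
    fix s' assume "I s'" then show "clock s' \<le> clock s + N * sample_cost" by (auto simp: I_def)
  next
    show "I s" using s by (auto simp: I_def intro!: exI[of _ 0])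
    show "F s \<le> real (nat \<lceil>R\<rceil>) * B^2" using s by (simp add: F_def walk_base_def N_def)
  qed
qed

text \<open>The worst-case size of the remainder left by the pushes, in units of
  \<open>\<epsilon> / d\<close>. It is also the quotient \<open>B / \<delta>\<close> of sample bound
  and tolerance in \<open>sampling_spec\<close>.\<close>

definition ratio :: real where
  "ratio = \<tau> * (real L)^2 / (real h * \<epsilon>)"

definition sampling_cost :: nat where
  "sampling_cost = 10 + (if 1 < ratio then nat \<lceil>4 * ratio^2\<rceil> * sample_cost else 0)"

text \<open>If \<open>ratio\<close> is at most 1, the remainder is within tolerance. Otherwise the
  second moment of \<open>N \<ge> 4 * ratio^2\<close> samples over the squared tolerance is at most
  \<open>ratio^2 / N \<le> 1/4\<close>. The other half of the error \<open>\<epsilon> / d\<close> is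
  left for truncation.\<close>

lemma sampling_spec:
  assumes s: "base s" "ireg s 5 = h" "rreg s 4 + potential n W t_fun L (rarr s 0) = target"
    and B: "\<And>l k. l < L \<Longrightarrow> k < n \<Longrightarrow> \<bar>rarr s 0 l k\<bar> \<le> 1 / (d * real h)"
  shows "ensures (run sampling s) (\<lambda>s'. clock s' \<le> clock s + sampling_cost)
    (\<lambda>s'. if \<bar>rreg s' 0 - target / 2\<bar> \<le> \<epsilon> / (2 * d) then 0 else 1) (1/4)"
proof -
  define a u P where "a = rreg s 4" and "u = rarr s 0" and "P = potential n W t_fun L u"
  define s1 where "s1 = spend 1 (spend 1 (set_rreg 9 ratio s))"
  have r: "rreg s 0 = \<epsilon>" "rreg s 2 = \<tau>" "ireg s 2 = L" using s by (auto simp: base_def)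
  have tgt: "target = a + P" using s by (simp add: a_def P_def u_def)
  have h0: "0 < real h" using h1 by simp
  have ratio: "rval (RDiv walk_weight (RMul (ROfNat (IReg 5)) (RReg 0))) s = ratio"
    by (simp add: walk_weight_def ratio_def r s power2_eq_square)
  show ?thesis
  proof (cases "1 < ratio")
    case False
    have "\<bar>P\<bar> \<le> (real L)^2 * (\<tau> * (1 / (d * real h)))"
      unfolding P_def by (rule potential_bound[OF substochastic_W]) (use B d_pos h0 in \<open>auto simp: u_def\<close>)
    also have "\<dots> = ratio * (\<epsilon> / d)" using eps by (simp add: ratio_def mult_ac)
    also have "\<dots> \<le> 1 * (\<epsilon> / d)" using False eps d_pos by (intro mult_right_mono) auto
    finally have "\<bar>a / 2 - target / 2\<bar> \<le> \<epsilon> / (2 * d)" by (simp add: tgt field_simps)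
    moreover have "run sampling s = return_spmf (spend 1 (set_rreg 0 (a / 2) s1))"
      using False by (simp add: sampling_def ratio[simplified] s1_def a_def)
    ultimately show ?thesis by (auto simp: s1_def sampling_cost_def intro!: ensures_return)
  next
    case True
    define R N where "R = 4 * ratio^2" and "N = nat \<lceil>R\<rceil>"
    define s2 where "s2 = spend 1 (set_ireg 11 0 (spend 1 (set_rreg 10 0 (spend 1 (set_rreg 9 R s1)))))"
    define \<mu> where "\<mu> = P / (\<tau> * (real L)^2)"
    define B where "B = 1 / (d * real h)"
    let ?fin = "RSet 0 (RDiv (RAdd (RReg 4) (RDiv (RMul walk_weight (RReg 10)) (ROfNat (IReg 11))))
                  (ROfNat (INat 2)))"
    have N: "R \<le> real N" "0 < R" using True unfolding N_def R_def by (linarith | simp)+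
    then have N0: "0 < real N" by linarith
    have \<tau>L: "0 < \<tau> * (real L)^2" using \<tau>_pos L by simp
    have run: "run sampling s = run (sample_loop ;; ?fin) s2"
      using True by (simp add: sampling_def ratio[simplified] s1_def s2_def R_def power2_eq_square)
    have B0: "0 \<le> B" using d_pos by (simp add: B_def)
    \<comment> \<open>The deviation of the sample mean from \<open>\<mu>\<close> that moves the
      output by \<open>\<epsilon> / (2 * d)\<close>.\<close>
    define \<delta> where "\<delta> = \<epsilon> / (d * (\<tau> * (real L)^2))"
    have \<delta>0: "0 < \<delta>" using eps d_pos \<tau>L by (simp add: \<delta>_def)
    have "ensures (run sample_loop s2)
      (\<lambda>s'. base s' \<and> rreg s' 4 = a \<and> ireg s' 11 = nat \<lceil>R\<rceil> \<and> clock s' \<le> clock s2 + 1 + nat \<lceil>R\<rceil> * sample_cost)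
      (\<lambda>s'. (rreg s' 10 - real (nat \<lceil>R\<rceil>) * (potential n W t_fun L u / (\<tau> * (real L)^2)))^2) (real (nat \<lceil>R\<rceil>) * B^2)"
      by (rule sample_loop_spec)
        (use s B0 assms(4) in \<open>auto simp: s2_def s1_def walk_base_def base_def a_def u_def B_def\<close>)
    then have loop: "ensures (run sample_loop s2)
      (\<lambda>s'. base s' \<and> rreg s' 4 = a \<and> ireg s' 11 = N \<and> clock s' \<le> clock s2 + 1 + N * sample_cost)
      (\<lambda>s'. (rreg s' 10 - real N * \<mu>)^2 / (real N * \<delta>)^2) (1/4)"
    proof (rule ensures_affine[where a = "1 / (real N * \<delta>)^2" and b = 0])
      have "B / \<delta> = ratio" using eps d_pos h0 \<tau>L by (simp add: B_def \<delta>_def ratio_def field_simps)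
      then have "1 / (real N * \<delta>)^2 * (real N * B^2) = ratio^2 / real N"
        using N0 \<delta>0 by (simp add: power2_eq_square field_simps)
      also have "\<dots> \<le> 1/4" using N N0 by (simp add: R_def field_simps)
      finally show "1 / (real N * \<delta>)^2 * (real (nat \<lceil>R\<rceil>) * B^2) + 0 \<le> 1/4" by (simp add: N_def)
    qed (auto simp: N_def \<mu>_def P_def)
    have fin: "ensures (run ?fin s') (\<lambda>s'. clock s' \<le> clock s + sampling_cost)
        (\<lambda>s'. if \<bar>rreg s' 0 - target / 2\<bar> \<le> \<epsilon> / (2 * d) then 0 else 1)
        ((rreg s' 10 - real N * \<mu>)^2 / (real N * \<delta>)^2)"
      if s': "base s' \<and> rreg s' 4 = a \<and> ireg s' 11 = N \<and> clock s' \<le> clock s2 + 1 + N * sample_cost" for s'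
    proof -
      define S where "S = rreg s' 10"
      define y where "y = (a + \<tau> * (real L)^2 * S / real N) / 2"
      have y: "run ?fin s' = return_spmf (spend 1 (set_rreg 0 y s'))"
        using s' by (simp add: walk_weight_def base_def y_def S_def power2_eq_square)
      have "(if \<bar>y - target / 2\<bar> \<le> \<epsilon> / (2 * d) then 0 else 1) \<le> (S - real N * \<mu>)^2 / (real N * \<delta>)^2"
      proof (cases "\<bar>y - target / 2\<bar> \<le> \<epsilon> / (2 * d)")
        case False
        have "P = \<tau> * (real L)^2 * \<mu>" unfolding \<mu>_def times_divide_eq_right
          by (rule nonzero_mult_div_cancel_left[symmetric]) (use \<tau>L in linarith)
        then have "y - target / 2 = \<tau> * (real L)^2 * (S - real N * \<mu>) / (2 * real N)"
          using N0 by (simp add: y_def tgt field_simps)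
        then have eq: "\<bar>y - target / 2\<bar> = \<tau> * (real L)^2 * \<bar>S - real N * \<mu>\<bar> / (2 * real N)"
          using N0 \<tau>L by (simp add: abs_mult)
        have "real N * \<delta> \<le> \<bar>S - real N * \<mu>\<bar>"
        proof -
          have "\<epsilon> / (2 * d) \<le> \<tau> * (real L)^2 * \<bar>S - real N * \<mu>\<bar> / (2 * real N)" using False eq by simp
          then have "\<epsilon> * real N \<le> d * (\<tau> * (real L)^2) * \<bar>S - real N * \<mu>\<bar>"
            using N0 d_pos by (simp add: field_simps)
          then show ?thesis using d_pos \<tau>L by (simp add: \<delta>_def field_simps)
        qed
        then have "(real N * \<delta>)^2 \<le> (S - real N * \<mu>)^2"
          using N0 \<delta>0 by (metis abs_le_square_iff abs_of_nonneg less_imp_le mult_pos_pos)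
        then show ?thesis using False N0 \<delta>0 by simp
      qed simp
      then show ?thesis
        unfolding y S_def[symmetric] using s' True
        by (intro ensures_return) (auto simp: s1_def s2_def sampling_cost_def N_def R_def)
    qed
    show ?thesis unfolding run by (rule ensures_seq[OF loop fin])
  qed
qed

definition push_time :: nat where
  "push_time = (\<Sum>l<L. \<Sum>k<n. push_bound n W h w l k * push_cost k)"

text \<open>The trivial answer 0 is justified by \<open>walk_sum_bound\<close>, which limits the
  absolute value of \<open>target\<close> to \<open>L * \<tau> / d\<close>.\<close>

lemma estimator_spec:
  assumes s: "base s" "rarr s = (\<lambda>_ _ _. 0)" "clock s = 0"
    and good: "\<tau>^2 * real L^4 * real f\<^sub>r * real n \<le> real h^3 * real (nnz M) * \<epsilon>^2"
    and least: "\<And>m. 1 \<le> m \<Longrightarrow> m < h \<Longrightarrow> real m^3 * real (nnz M) * \<epsilon>^2 < \<tau>^2 * real L^4 * real f\<^sub>r * real n"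
  shows "ensures (run estimator s)
    (\<lambda>s'. clock s' \<le> (if \<epsilon> < real L * \<tau> then 20 + 2 * h + push_time + sampling_cost else 2))
    (\<lambda>s'. if \<bar>rreg s' 0 - target / 2\<bar> \<le> \<epsilon> / (2 * d) then 0 else 1) (1/4)"
proof (cases "\<epsilon> < real L * \<tau>")
  case True
  have s1: "base (spend 1 s)" "rarr (spend 1 s) = (\<lambda>_ _ _. 0)" using s by (auto simp: base_def)
  have "ensures (run (scale_search ;; push_init ;; push_loop ;; sampling) (spend 1 s))
    (\<lambda>s'. clock s' \<le> 20 + 2 * h + push_time + sampling_cost)
    (\<lambda>s'. if \<bar>rreg s' 0 - target / 2\<bar> \<le> \<epsilon> / (2 * d) then 0 else 1) (1/4)"
  proof (rule ensures_seq[OF scale_search_spec[OF s1 good least]])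
    fix s2 assume s2: "base s2 \<and> rarr s2 = (\<lambda>_ _ _. 0) \<and> ireg s2 5 = h \<and> clock s2 \<le> clock (spend 1 s) + 2 * h"
    let ?T = "clock s2 + 16 + push_budget (\<lambda>_ _. 0)"
    have T: "?T \<le> 17 + 2 * h + push_time" using s2 s by (simp add: push_budget_def push_time_def)
    show "ensures (run (push_init ;; push_loop ;; sampling) s2)
      (\<lambda>s'. clock s' \<le> 20 + 2 * h + push_time + sampling_cost)
      (\<lambda>s'. if \<bar>rreg s' 0 - target / 2\<bar> \<le> \<epsilon> / (2 * d) then 0 else 1) (1/4)"
    proof (rule ensures_seq[OF push_init_spec[where T = ?T]])
      fix s3 assume "push_inv ?T s3"
      then show "ensures (run (push_loop ;; sampling) s3)
        (\<lambda>s'. clock s' \<le> 20 + 2 * h + push_time + sampling_cost)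
        (\<lambda>s'. if \<bar>rreg s' 0 - target / 2\<bar> \<le> \<epsilon> / (2 * d) then 0 else 1) (1/4)"
        by (rule ensures_seq[OF push_loop_spec])
          (rule ensures_conseq[OF sampling_spec], use T in auto)
    qed (use s2 in auto)
  qed auto
  then show ?thesis using True s by (simp add: estimator_def base_def)
next
  case False
  have "\<bar>target\<bar> \<le> real L * (\<tau> * (1 / d))"
    by (rule walk_sum_bound[OF substochastic_W]) (use d_pos in auto)
  also have "\<dots> \<le> \<epsilon> / d" using False d_pos by (simp add: divide_right_mono)
  finally have "\<bar>0 - target / 2\<bar> \<le> \<epsilon> / (2 * d)" by simp
  moreover have "run estimator s = return_spmf (spend 1 (set_rreg 0 0 (spend 1 s)))"
    using False s by (simp add: estimator_def base_def)
  ultimately show ?thesis using s False by (auto intro!: ensures_return)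
qed

end

section \<open>Norms of vectors and matrices\<close>

lemma app_pow_cong:
  assumes "\<And>i. i < n \<Longrightarrow> f i = g i" "i < n"
  shows "(app n W ^^ j) f i = (app n W ^^ j) g i"
  using \<open>i < n\<close> by (induction j arbitrary: i) (auto simp: assms app_def)

lemma index_mult_mat_vec_sum:
  assumes "A \<in> carrier_mat n m" "v \<in> carrier_vec m" "i < n"
  shows "(A *\<^sub>v v) $ i = (\<Sum>k<m. A $$ (i,k) * v $ k)"
  using assms by (auto simp: scalar_prod_def atLeast0LessThan intro!: sum.cong)

lemma pow_mat_mult_vec:
  assumes A: "A \<in> carrier_mat n n" and W: "\<And>i k. i < n \<Longrightarrow> k < n \<Longrightarrow> A $$ (i,k) = W i k"
    and "v \<in> carrier_vec n" "i < n"
  shows "((A ^\<^sub>m l) *\<^sub>v v) $ i = (app n W ^^ l) (\<lambda>k. v $ k) i"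
  using \<open>v \<in> carrier_vec n\<close>
proof (induction l arbitrary: v)
  case 0
  then show ?case using A \<open>i < n\<close> by simp
next
  case (Suc l)
  have "((A ^\<^sub>m Suc l) *\<^sub>v v) = (A ^\<^sub>m l) *\<^sub>v (A *\<^sub>v v)"
    using A Suc.prems by (simp add: assoc_mult_mat_vec[of _ n n _ n])
  also have "\<dots> $ i = (app n W ^^ l) (\<lambda>k. (A *\<^sub>v v) $ k) i"
    by (rule Suc.IH) (use A Suc.prems in auto)
  also have "\<dots> = (app n W ^^ l) (app n W (\<lambda>k. v $ k)) i"
    by (rule app_pow_cong)
      (use assms Suc.prems in \<open>auto simp: index_mult_mat_vec_sum[OF A] app_def simp del: index_mult_mat_vec\<close>)
  finally show ?case by (simp add: funpow_swap1)
qed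

lemma diag_powr_carrier: "M \<in> carrier_mat n n \<Longrightarrow> diag_powr M s \<in> carrier_mat n n"
  by (auto simp: diag_powr_def)

lemma AT_carrier: "M \<in> carrier_mat n n \<Longrightarrow> AT M \<in> carrier_mat n n"
  by (auto simp: AT_def diag_part_def)

lemma diag_powr_mult_vec:
  assumes "M \<in> carrier_mat n n" "v \<in> carrier_vec n" "i < n"
  shows "(diag_powr M s *\<^sub>v v) $ i = M $$ (i,i) powr s * v $ i"
proof -
  have "(diag_powr M s *\<^sub>v v) $ i = (\<Sum>k<n. (if i = k then M $$ (i,i) powr s * v $ i else 0))"
    unfolding index_mult_mat_vec_sum[OF diag_powr_carrier[OF assms(1)] assms(2,3)]
    by (rule sum.cong) (use assms in \<open>auto simp: diag_powr_def\<close>)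
  then show ?thesis using assms by simp
qed

lemma index_mult_mat_sum:
  assumes "A \<in> carrier_mat n m" "B \<in> carrier_mat m q" "i < n" "j < q"
  shows "(A * B) $$ (i,j) = (\<Sum>k<m. A $$ (i,k) * B $$ (k,j))"
  using assms by (auto simp: scalar_prod_def atLeast0LessThan intro!: sum.cong)

lemma diag_powr_mult_mat:
  assumes "M \<in> carrier_mat n n" "A \<in> carrier_mat n n" "i < n" "j < n"
  shows "(diag_powr M s * A) $$ (i,j) = M $$ (i,i) powr s * A $$ (i,j)"
proof -
  have "(diag_powr M s * A) $$ (i,j) = (\<Sum>k<n. (if i = k then M $$ (i,i) powr s * A $$ (i,j) else 0))"
    unfolding index_mult_mat_sum[OF diag_powr_carrier[OF assms(1)] assms(2-4)]
    by (rule sum.cong) (use assms in \<open>auto simp: diag_powr_def\<close>)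
  then show ?thesis using assms by simp
qed

lemma mat_mult_diag_powr:
  assumes "M \<in> carrier_mat n n" "A \<in> carrier_mat n n" "i < n" "j < n"
  shows "(A * diag_powr M s) $$ (i,j) = A $$ (i,j) * M $$ (j,j) powr s"
proof -
  have "(A * diag_powr M s) $$ (i,j) = (\<Sum>k<n. (if k = j then A $$ (i,j) * M $$ (j,j) powr s else 0))"
    unfolding index_mult_mat_sum[OF assms(2) diag_powr_carrier[OF assms(1)] assms(3,4)]
    by (rule sum.cong) (use assms in \<open>auto simp: diag_powr_def\<close>)
  then show ?thesis using assms by simp
qed

section \<open>Vector norms for exponents from 1 to infinity\<close>

lemma pnorm_nonneg: "0 < dim_vec v \<Longrightarrow> 0 \<le> pnorm p v"
  by (auto simp: pnorm_def intro: order.trans[OF _ Max_ge[of _ "\<bar>v $ 0\<bar>"]])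

lemma ereal_ge_1_cases:
  assumes "(1::ereal) \<le> p"
  obtains "p = \<infinity>" | r where "p = ereal r" "1 \<le> r"
  using assms by (cases p) auto

lemma abs_le_pnorm:
  assumes "1 \<le> p" "i < dim_vec v"
  shows "\<bar>v $ i\<bar> \<le> pnorm p v"
  using assms(1)
proof (cases rule: ereal_ge_1_cases)
  case 1
  then show ?thesis using assms by (auto simp: pnorm_def)
next
  case (2 r)
  have "\<bar>v $ i\<bar> powr r \<le> (\<Sum>i<dim_vec v. \<bar>v $ i\<bar> powr r)"
    by (rule member_le_sum) (use assms in auto)
  then have "(\<bar>v $ i\<bar> powr r) powr (1/r) \<le> (\<Sum>i<dim_vec v. \<bar>v $ i\<bar> powr r) powr (1/r)"
    using 2 by (intro powr_mono2) auto
  then show ?thesis using 2 by (simp add: pnorm_def powr_powr)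
qed

text \<open>Positive dimension keeps \<open>Max\<close> off the empty set when \<open>p\<close> is
  infinite.\<close>

lemma pnorm_smult:
  assumes "1 \<le> p" "0 < dim_vec v"
  shows "pnorm p (c \<cdot>\<^sub>v v) = \<bar>c\<bar> * pnorm p v"
  using assms(1)
proof (cases rule: ereal_ge_1_cases)
  case 1
  have "Max ((\<lambda>i. \<bar>(c \<cdot>\<^sub>v v) $ i\<bar>) ` {..<dim_vec v}) = Max ((\<lambda>x. \<bar>c\<bar> * x) ` (\<lambda>i. \<bar>v $ i\<bar>) ` {..<dim_vec v})"
    unfolding image_image by (intro arg_cong[of _ _ Max] image_cong) (auto simp: abs_mult)
  also have "\<dots> = \<bar>c\<bar> * Max ((\<lambda>i. \<bar>v $ i\<bar>) ` {..<dim_vec v})"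
    by (rule mono_Max_commute[symmetric]) (use assms in \<open>auto simp: mono_def mult_left_mono\<close>)
  finally show ?thesis using 1 by (simp add: pnorm_def)
next
  case (2 r)
  have "(\<Sum>i<dim_vec v. \<bar>(c \<cdot>\<^sub>v v) $ i\<bar> powr r) = \<bar>c\<bar> powr r * (\<Sum>i<dim_vec v. \<bar>v $ i\<bar> powr r)"
    unfolding sum_distrib_left by (rule sum.cong) (auto simp: abs_mult powr_mult)
  then have "pnorm p (c \<cdot>\<^sub>v v) = (\<bar>c\<bar> powr r * (\<Sum>i<dim_vec v. \<bar>v $ i\<bar> powr r)) powr (1/r)"
    using 2 by (simp add: pnorm_def)
  also have "\<dots> = \<bar>c\<bar> * (\<Sum>i<dim_vec v. \<bar>v $ i\<bar> powr r) powr (1/r)"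
    using 2 by (subst powr_mult) (auto simp: powr_powr sum_nonneg)
  finally show ?thesis using 2 by (simp add: pnorm_def)
qed

lemma pnorm_bounded:
  assumes "1 \<le> p" "0 < n" "0 \<le> K"
  shows "\<exists>C. \<forall>v\<in>carrier_vec n. (\<forall>i<n. \<bar>v $ i\<bar> \<le> K) \<longrightarrow> pnorm p v \<le> C"
  using assms(1)
proof (cases rule: ereal_ge_1_cases)
  case 1
  have "pnorm p v \<le> K" if "v \<in> carrier_vec n" "\<forall>i<n. \<bar>v $ i\<bar> \<le> K" for v
    using 1 that assms(2) by (auto simp: pnorm_def intro!: Max.boundedI)
  then show ?thesis by blast
next
  case (2 r)
  have "pnorm p v \<le> (\<Sum>i<n. K powr r) powr (1/r)" if "v \<in> carrier_vec n" "\<forall>i<n. \<bar>v $ i\<bar> \<le> K" for v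
  proof -
    have "(\<Sum>i<n. \<bar>v $ i\<bar> powr r) \<le> (\<Sum>i<n. K powr r)"
      using 2 that by (intro sum_mono powr_mono2) auto
    then show ?thesis using 2 that by (auto simp: pnorm_def intro!: powr_mono2 sum_nonneg)
  qed
  then show ?thesis by blast
qed

text \<open>All these norms agree on multiples of a unit vector, so the scaled right-hand side has
  an explicit norm even though \<open>p\<close> is unknown.\<close>

lemma pnorm_single:
  assumes "1 \<le> p" "v \<in> carrier_vec n" "w < n" "\<And>i. i < n \<Longrightarrow> v $ i = (if i = w then c else 0)"
  shows "pnorm p v = \<bar>c\<bar>"
  using assms(1)
proof (cases rule: ereal_ge_1_cases)
  case 1
  have "Max ((\<lambda>i. \<bar>v $ i\<bar>) ` {..<n}) = \<bar>c\<bar>"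
    by (rule Max_eqI) (use assms(3,4) in \<open>auto intro!: image_eqI[of _ _ w]\<close>)
  then show ?thesis using 1 assms by (simp add: pnorm_def)
next
  case (2 r)
  have "(\<Sum>i<n. \<bar>v $ i\<bar> powr r) = (\<Sum>i<n. if i = w then \<bar>c\<bar> powr r else 0)"
    by (rule sum.cong) (use assms in auto)
  then show ?thesis using 2 assms by (simp add: pnorm_def powr_powr)
qed

section \<open>Restricted operator norms and geometric tails\<close>

lemma op_pnorm_on_bdd:
  assumes "1 \<le> p" "0 < n" "B \<in> carrier_mat n n" "S \<subseteq> carrier_vec n"
  shows "bdd_above ((\<lambda>v. pnorm p (B *\<^sub>v v)) ` {v \<in> S. pnorm p v \<le> 1})"
proof -
  define K where "K = (\<Sum>i<n. \<Sum>k<n. \<bar>B $$ (i,k)\<bar>)"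
  obtain C where C: "\<forall>v\<in>carrier_vec n. (\<forall>i<n. \<bar>v $ i\<bar> \<le> K) \<longrightarrow> pnorm p v \<le> C"
    using pnorm_bounded[OF assms(1,2), of K] by (auto simp: K_def sum_nonneg)
  have "pnorm p (B *\<^sub>v v) \<le> C" if v: "v \<in> S" "pnorm p v \<le> 1" for v
  proof -
    have vc: "v \<in> carrier_vec n" using v assms by auto
    have v1: "\<bar>v $ k\<bar> \<le> 1" if "k < n" for k
      using abs_le_pnorm[OF assms(1), of k v] v vc that by auto
    have "\<bar>(B *\<^sub>v v) $ i\<bar> \<le> K" if "i < n" for i
    proof -
      have "\<bar>(B *\<^sub>v v) $ i\<bar> \<le> (\<Sum>k<n. \<bar>B $$ (i,k) * v $ k\<bar>)"
        unfolding index_mult_mat_vec_sum[OF assms(3) vc that] by (rule sum_abs)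
      also have "\<dots> \<le> (\<Sum>k<n. \<bar>B $$ (i,k)\<bar>)"
        by (rule sum_mono) (use v1 in \<open>auto simp: abs_mult intro: mult_left_le\<close>)
      also have "\<dots> \<le> K" unfolding K_def
        by (rule member_le_sum[of i _ "\<lambda>i. \<Sum>k<n. \<bar>B $$ (i,k)\<bar>"]) (use that in \<open>auto intro: sum_nonneg\<close>)
      finally show ?thesis .
    qed
    then show ?thesis using C assms(3) vc by auto
  qed
  then show ?thesis by (intro bdd_aboveI[of _ C]) auto
qed

text \<open>The zero vector is a competitor in the supremum, which is bounded above by
  \<open>op_pnorm_on_bdd\<close>.\<close>

lemma op_pnorm_on_nonneg:
  assumes "1 \<le> p" "0 < n" "B \<in> carrier_mat n n" "S \<subseteq> carrier_vec n" "0\<^sub>v n \<in> S"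
  shows "0 \<le> op_pnorm_on p B S"
proof -
  have "pnorm p (0\<^sub>v n) = \<bar>0\<bar>" by (rule pnorm_single[OF assms(1) _ assms(2)]) auto
  then have "pnorm p (B *\<^sub>v 0\<^sub>v n) \<le> op_pnorm_on p B S"
    unfolding op_pnorm_on_def
    by (intro cSUP_upper op_pnorm_on_bdd[OF assms(1-4)]) (use assms in auto)
  moreover have "0 \<le> pnorm p (B *\<^sub>v 0\<^sub>v n)" by (rule pnorm_nonneg) (use assms in auto)
  ultimately show ?thesis by linarith
qed

text \<open>Homogeneity reduces the claim to norm 1, and closure of \<open>S\<close> under scaling
  keeps the normalised vector in \<open>S\<close>. A vector of norm 0 is zero and is treated
  apart.\<close>

lemma op_pnorm_on_le:
  assumes p: "1 \<le> p" and n: "0 < n" and B: "B \<in> carrier_mat n n" and S: "S \<subseteq> carrier_vec n"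
    and scale: "\<And>c v. v \<in> S \<Longrightarrow> c \<cdot>\<^sub>v v \<in> S" and v: "v \<in> S"
  shows "pnorm p (B *\<^sub>v v) \<le> op_pnorm_on p B S * pnorm p v"
proof -
  have vc: "v \<in> carrier_vec n" using v S by auto
  let ?N = "pnorm p v"
  have N: "0 \<le> ?N" by (rule pnorm_nonneg) (use vc n in auto)
  show ?thesis
  proof (cases "?N = 0")
    case True
    have "v = 0\<^sub>v n"
    proof (rule eq_vecI)
      fix i assume "i < dim_vec (0\<^sub>v n)"
      then show "v $ i = 0\<^sub>v n $ i" using abs_le_pnorm[OF p, of i v] vc True by auto
    qed (use vc in auto)
    then have z: "B *\<^sub>v v = 0\<^sub>v n" using B by auto
    have "pnorm p (0\<^sub>v n) = \<bar>0\<bar>" by (rule pnorm_single[OF p _ n]) auto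
    then show ?thesis using True z by simp
  next
    case False
    let ?v = "(1 / ?N) \<cdot>\<^sub>v v"
    have "pnorm p ?v = 1" using False N vc n by (subst pnorm_smult[OF p]) auto
    then have "pnorm p (B *\<^sub>v ?v) \<le> op_pnorm_on p B S"
      unfolding op_pnorm_on_def
      by (intro cSUP_upper op_pnorm_on_bdd[OF p n B S]) (use scale v in auto)
    moreover have "B *\<^sub>v ?v = (1 / ?N) \<cdot>\<^sub>v (B *\<^sub>v v)" using B vc by (simp add: mult_mat_vec)
    moreover have "pnorm p ((1 / ?N) \<cdot>\<^sub>v (B *\<^sub>v v)) = \<bar>1 / ?N\<bar> * pnorm p (B *\<^sub>v v)"
      by (rule pnorm_smult[OF p]) (use B n in auto)
    ultimately show ?thesis using False N by (simp add: field_simps)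
  qed
qed

lemma suminf_tail_bound:
  fixes a :: "nat \<Rightarrow> real"
  assumes "\<And>l. \<bar>a l\<bar> \<le> H * \<rho> ^ l" "0 \<le> \<rho>" "\<rho> < 1"
  shows "summable a" "\<bar>(\<Sum>l. a l) - (\<Sum>l<L. a l)\<bar> \<le> H * \<rho> ^ L / (1 - \<rho>)"
proof -
  have g: "summable (\<lambda>l. H * \<rho> ^ l)" by (intro summable_mult summable_geometric) (use assms in auto)
  show s: "summable a" by (rule summable_comparison_test'[OF g, of 0]) (use assms in auto)
  have gl: "(\<lambda>l. H * \<rho> ^ L * \<rho> ^ l) sums (H * \<rho> ^ L * (1 / (1 - \<rho>)))"
    by (intro sums_mult geometric_sums) (use assms in auto)
  have le: "\<bar>a (l + L)\<bar> \<le> H * \<rho> ^ L * \<rho> ^ l" for l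
    using assms(1)[of "l + L"] by (simp add: power_add mult_ac)
  have sa: "summable (\<lambda>l. \<bar>a (l + L)\<bar>)"
    by (rule summable_comparison_test'[OF sums_summable[OF gl], of 0]) (use le in auto)
  have "(\<Sum>l. a l) - (\<Sum>l<L. a l) = (\<Sum>l. a (l + L))"
    using suminf_split_initial_segment[OF s, of L] by simp
  also have "\<bar>\<dots>\<bar> \<le> (\<Sum>l. \<bar>a (l + L)\<bar>)" by (rule summable_rabs[OF sa])
  also have "\<dots> \<le> (\<Sum>l. H * \<rho> ^ L * \<rho> ^ l)"
    by (rule suminf_le[OF le sa sums_summable[OF gl]])
  also have "\<dots> = H * \<rho> ^ L / (1 - \<rho>)" using sums_unique[OF gl] by simp
  finally show "\<bar>(\<Sum>l. a l) - (\<Sum>l<L. a l)\<bar> \<le> H * \<rho> ^ L / (1 - \<rho>)" .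
qed

section \<open>Truncation of the series\<close>

lemma mat_range_carrier: "B \<in> carrier_mat n m \<Longrightarrow> mat_range B \<subseteq> carrier_vec n"
  by (auto simp: mat_range_def intro: mult_mat_vec_carrier)

lemma zero_in_mat_range:
  assumes "B \<in> carrier_mat n m"
  shows "0\<^sub>v n \<in> mat_range B"
proof -
  have "B *\<^sub>v 0\<^sub>v m = 0\<^sub>v n" using assms by (intro eq_vecI) auto
  then show ?thesis using assms unfolding mat_range_def by (auto intro!: exI[of _ "0\<^sub>v m"])
qed

context rdd_instance
begin

lemma scaled_AT_carrier: "scaled_AT M p \<in> carrier_mat n n"
  unfolding scaled_AT_def Let_def
  by (intro mult_carrier_mat[of _ n n _ n] diag_powr_carrier[OF M] AT_carrier[OF M])

lemma AT_entry: "i < n \<Longrightarrow> k < n \<Longrightarrow> AT M $$ (i,k) = (if i = k then 0 else - M $$ (i,k))"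
  by (auto simp: AT_def diag_part_def dims)

lemma powr_minus_1: "0 < x \<Longrightarrow> x powr (-1) = 1 / (x::real)"
  by (simp add: powr_minus_divide)

lemma walk_matrix:
  defines "Wm \<equiv> (1/2) \<cdot>\<^sub>m (1\<^sub>m (dim_row M) + diag_powr M (-1) * AT M)"
  shows "Wm \<in> carrier_mat n n" "\<And>i k. i < n \<Longrightarrow> k < n \<Longrightarrow> Wm $$ (i,k) = W i k"
proof -
  have c: "diag_powr M (-1) * AT M \<in> carrier_mat n n"
    by (rule mult_carrier_mat[OF diag_powr_carrier[OF M] AT_carrier[OF M]])
  then show "Wm \<in> carrier_mat n n" by (simp add: Wm_def dims)
  fix i k assume ik: "i < n" "k < n"
  have "Wm $$ (i,k) = 1/2 * ((if i = k then 1 else 0) + M $$ (i,i) powr (-1) * AT M $$ (i,k))"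
  proof -
    define X where "X = diag_powr M (-1) * AT M"
    have "X \<in> carrier_mat n n" "X $$ (i,k) = M $$ (i,i) powr (-1) * AT M $$ (i,k)"
      unfolding X_def by (fact c, rule diag_powr_mult_mat[OF M AT_carrier[OF M] ik])
    then show ?thesis using ik by (simp add: Wm_def X_def[symmetric] dims)
  qed
  then show "Wm $$ (i,k) = W i k"
    using ik diag_pos[of i] by (cases "i = k") (auto simp: AT_entry powr_minus_1 walk_mat_def dims)
qed

lemma scaled_rhs:
  "(diag_powr M s *\<^sub>v b) \<in> carrier_vec n"
  "i < n \<Longrightarrow> (diag_powr M s *\<^sub>v b) $ i = (if i = w then d powr s else 0)"
proof -
  show "(diag_powr M s *\<^sub>v b) \<in> carrier_vec n"
    by (rule mult_mat_vec_carrier[OF diag_powr_carrier[OF M] unit_vec_carrier])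
  show "i < n \<Longrightarrow> (diag_powr M s *\<^sub>v b) $ i = (if i = w then d powr s else 0)"
    by (subst diag_powr_mult_vec[OF M unit_vec_carrier]) (use w in auto)
qed

lemma pnorm_scaled_rhs: "1 \<le> p \<Longrightarrow> pnorm p (diag_powr M s *\<^sub>v b) = d powr s"
  using pnorm_single[OF _ scaled_rhs(1) w scaled_rhs(2)] d_pos by simp

lemma x_star_eq: "i < n \<Longrightarrow> x_star M b $ i = 1/2 * (\<Sum>l. (app n W ^^ l) v0 i)"
proof -
  assume i: "i < n"
  have "((((1/2) \<cdot>\<^sub>m (1\<^sub>m (dim_row M) + diag_powr M (-1) * AT M)) ^\<^sub>m l) *\<^sub>v (diag_powr M (-1) *\<^sub>v b)) $ i
      = (app n W ^^ l) v0 i" for l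
  proof (rule trans)
    show "((((1/2) \<cdot>\<^sub>m (1\<^sub>m (dim_row M) + diag_powr M (-1) * AT M)) ^\<^sub>m l) *\<^sub>v (diag_powr M (-1) *\<^sub>v b)) $ i
      = (app n W ^^ l) (\<lambda>k. (diag_powr M (-1) *\<^sub>v b) $ k) i"
      by (rule pow_mat_mult_vec[OF walk_matrix _ i]) (auto simp: scaled_rhs(1))
    show "(app n W ^^ l) (\<lambda>k. (diag_powr M (-1) *\<^sub>v b) $ k) i = (app n W ^^ l) v0 i"
      by (rule app_pow_cong[OF _ i]) (use d_pos in \<open>simp add: scaled_rhs(2) powr_minus_1\<close>)
  qed
  then show ?thesis using i by (simp add: x_star_def Let_def dims)
qed

text \<open>Any \<open>p\<close> whose gap exceeds \<open>\<gamma> / 2\<close> will do; giving up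
  half of \<open>\<gamma>\<close> costs only a constant factor in \<open>L\<close>. Nonnegative
  operator norms bound the gaps by 1, which makes the real supremum meaningful.\<close>

lemma gamma_max_witness:
  assumes "0 < \<gamma>" "\<gamma> \<le> gamma_max M"
  obtains p where "1 \<le> p" and
    "op_pnorm_on p ((1/2) \<cdot>\<^sub>m (1\<^sub>m n + scaled_AT M p)) (mat_range (1\<^sub>m n - scaled_AT M p)) < 1 - \<gamma> / 2"
proof -
  let ?f = "\<lambda>p. 1 - op_pnorm_on p ((1/2) \<cdot>\<^sub>m (1\<^sub>m n + scaled_AT M p)) (mat_range (1\<^sub>m n - scaled_AT M p))"
  have n: "0 < n" using w by simp
  have "?f p \<le> 1" if "1 \<le> p" for p
  proof -
    have "0 \<le> op_pnorm_on p ((1/2) \<cdot>\<^sub>m (1\<^sub>m n + scaled_AT M p)) (mat_range (1\<^sub>m n - scaled_AT M p))"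
      by (intro op_pnorm_on_nonneg[OF that n] mat_range_carrier zero_in_mat_range)
        (use scaled_AT_carrier[of p] in \<open>auto simp: minus_carrier_mat\<close>)
    then show ?thesis by simp
  qed
  then have "bdd_above (?f ` {1..\<infinity>})" by (intro bdd_aboveI[of _ 1]) auto
  moreover have "\<gamma> / 2 < (SUP p\<in>{1..\<infinity>}. ?f p)"
    using assms by (simp add: gamma_max_def dims)
  ultimately have "\<exists>p\<in>{1..\<infinity>}. \<gamma> / 2 < ?f p" by (subst (asm) less_cSUP_iff) auto
  then show ?thesis using that by force
qed

text \<open>\<open>D\<^sup>u W D\<^sup>-\<^sup>u\<close>, with \<open>u = 1/p\<close>, is the matrix whose restricted \<open>p\<close>-norm occurs in \<open>gamma_max\<close>, and
  \<open>b \<in> range M\<close> puts the rescaled right-hand side into the invariant subspace on which it contracts.\<close>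

lemma walk_decay:
  assumes \<gamma>: "0 < \<gamma>" "\<gamma> \<le> gamma_max M" and range: "b \<in> mat_range M"
  obtains u \<rho> where "0 \<le> u" "u \<le> 1" "0 \<le> \<rho>" "\<rho> \<le> 1 - \<gamma> / 2"
    "\<And>l i. i < n \<Longrightarrow> \<bar>(app n W ^^ l) v0 i\<bar> \<le> M $$ (i,i) powr (-u) * (d powr (u - 1) * \<rho> ^ l)"
proof -
  obtain p where p: "1 \<le> p" and op:
    "op_pnorm_on p ((1/2) \<cdot>\<^sub>m (1\<^sub>m n + scaled_AT M p)) (mat_range (1\<^sub>m n - scaled_AT M p)) < 1 - \<gamma> / 2"
    using gamma_max_witness[OF \<gamma>] by blast
  define A where "A = scaled_AT M p"
  define B where "B = (1/2) \<cdot>\<^sub>m (1\<^sub>m n + A)"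
  define S where "S = mat_range (1\<^sub>m n - A)"
  define u where "u = real_of_ereal (1 / p)"
  define \<rho> where "\<rho> = op_pnorm_on p B S"
  have u: "0 \<le> u" "u \<le> 1"
    using p by (cases rule: ereal_ge_1_cases; simp add: u_def one_ereal_def; fail)+
  have n: "0 < n" using w by simp
  have Ac: "A \<in> carrier_mat n n"
    unfolding A_def by (rule scaled_AT_carrier)
  then have IA: "1\<^sub>m n - A \<in> carrier_mat n n" by (rule minus_carrier_mat)
  have Bc: "B \<in> carrier_mat n n" using Ac by (simp add: B_def)
  have Sc: "S \<subseteq> carrier_vec n" unfolding S_def by (rule mat_range_carrier[OF IA])
  have Aent: "A $$ (i,k) = M $$ (i,i) powr (u - 1) * AT M $$ (i,k) * M $$ (k,k) powr (- u)"
    if "i < n" "k < n" for i k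
  proof -
    have "diag_powr M (- (1 - u)) * AT M \<in> carrier_mat n n"
      by (rule mult_carrier_mat[OF diag_powr_carrier[OF M] AT_carrier[OF M]])
    then show ?thesis
      unfolding A_def scaled_AT_def Let_def u_def[symmetric]
      using that by (simp add: mat_mult_diag_powr[OF M] diag_powr_mult_mat[OF M AT_carrier[OF M]])
  qed
  \<comment> \<open>Entrywise form of \<open>B D^u = D^u W\<close>.\<close>
  have Bent: "B $$ (i,k) * M $$ (k,k) powr u = M $$ (i,i) powr u * W i k" if ik: "i < n" "k < n" for i k
  proof -
    have B: "B $$ (i,k) = 1/2 * ((if i = k then 1 else 0) + A $$ (i,k))"
      using Ac ik by (simp add: B_def)
    have pw: "M $$ (k,k) powr (- u) * M $$ (k,k) powr u = 1" "M $$ (i,i) powr (u - 1) = M $$ (i,i) powr u / M $$ (i,i)"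
      using diag_pos[OF ik(1)] diag_pos[OF ik(2)] by (simp_all add: powr_add[symmetric] powr_diff)
    show ?thesis
    proof (cases "i = k")
      case True
      then have "AT M $$ (i,k) = 0" using ik by (simp add: AT_def diag_part_def dims)
      then have "B $$ (i,k) = 1/2" unfolding B using True ik by (simp add: Aent)
      then show ?thesis using True ik by (simp add: walk_mat_def dims)
    next
      case False
      have "B $$ (i,k) * M $$ (k,k) powr u = 1/2 * M $$ (i,i) powr (u - 1) * AT M $$ (i,k) * (M $$ (k,k) powr (- u) * M $$ (k,k) powr u)"
        using False ik by (simp add: B Aent)
      also have "\<dots> = 1/2 * (M $$ (i,i) powr u / M $$ (i,i)) * - M $$ (i,k)"
        unfolding pw using False ik by (simp add: AT_def diag_part_def dims)
      finally show ?thesis using False ik by (simp add: walk_mat_def dims)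
    qed
  qed
  \<comment> \<open>\<open>z l\<close> is \<open>B^l D^(u-1) b\<close>, shown below to be
    \<open>D^u W^l v0\<close>.\<close>
  define z where "z = rec_nat (diag_powr M (u - 1) *\<^sub>v b) (\<lambda>_ v. B *\<^sub>v v)"
  have z0: "z 0 = diag_powr M (u - 1) *\<^sub>v b" and zS: "z (Suc l) = B *\<^sub>v z l" for l
    by (simp_all add: z_def)
  have scale: "c \<cdot>\<^sub>v v \<in> S" if v: "v \<in> S" for c v
  proof -
    obtain x where x: "x \<in> carrier_vec n" "v = (1\<^sub>m n - A) *\<^sub>v x" using v Ac by (auto simp: S_def mat_range_def)
    then have "c \<cdot>\<^sub>v v = (1\<^sub>m n - A) *\<^sub>v (c \<cdot>\<^sub>v x)" using mult_mat_vec[OF IA x(1), of c] x(2) by simp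
    then show ?thesis using x Ac by (auto simp: S_def mat_range_def intro!: exI[of _ "c \<cdot>\<^sub>v x"])
  qed
  \<comment> \<open>Both factors are polynomials in \<open>A\<close>; their commuting makes the
    range of \<open>I - A\<close> invariant under \<open>B\<close>.\<close>
  have comm: "B * (1\<^sub>m n - A) = (1\<^sub>m n - A) * B"
  proof -
    have AA: "A * A \<in> carrier_mat n n" using Ac by simp
    have "(1\<^sub>m n + A) * (1\<^sub>m n - A) = (1\<^sub>m n - A) + (A - A * A)"
      using Ac IA by (simp add: add_mult_distrib_mat[OF _ Ac IA] mult_minus_distrib_mat[OF Ac _ Ac])
    also have "\<dots> = (1\<^sub>m n + A) - (A + A * A)"
      using Ac AA by (intro eq_matI) auto
    also have "\<dots> = (1\<^sub>m n - A) * (1\<^sub>m n + A)"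
      using Ac by (simp add: minus_mult_distrib_mat[OF one_carrier_mat Ac, of _ n] mult_add_distrib_mat[OF Ac one_carrier_mat Ac])
    finally have "(1\<^sub>m n + A) * (1\<^sub>m n - A) = (1\<^sub>m n - A) * (1\<^sub>m n + A)" .
    moreover have "B * (1\<^sub>m n - A) = (1/2) \<cdot>\<^sub>m ((1\<^sub>m n + A) * (1\<^sub>m n - A))"
      unfolding B_def using Ac by (intro mult_smult_assoc_mat[of _ n n _ n]) auto
    moreover have "(1\<^sub>m n - A) * B = (1/2) \<cdot>\<^sub>m ((1\<^sub>m n - A) * (1\<^sub>m n + A))"
      unfolding B_def using Ac by (intro mult_smult_distrib[of _ n n _ n]) auto
    ultimately show ?thesis by simp
  qed
  have inv: "B *\<^sub>v v \<in> S" if v: "v \<in> S" for v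
  proof -
    obtain x where x: "x \<in> carrier_vec n" "v = (1\<^sub>m n - A) *\<^sub>v x" using v Ac by (auto simp: S_def mat_range_def)
    have "B *\<^sub>v v = (B * (1\<^sub>m n - A)) *\<^sub>v x"
      unfolding x(2) using Bc Ac x by (intro assoc_mult_mat_vec[symmetric, of _ n n _ n]) auto
    also have "\<dots> = (1\<^sub>m n - A) *\<^sub>v (B *\<^sub>v x)"
      unfolding comm using Bc Ac x by (intro assoc_mult_mat_vec[of _ n n _ n]) auto
    finally show ?thesis using Bc Ac x by (auto simp: S_def mat_range_def intro!: exI[of _ "B *\<^sub>v x"])
  qed
  have start: "z 0 \<in> S"
  proof -
    obtain x where x: "x \<in> carrier_vec n" "b = M *\<^sub>v x" using range M by (auto simp: mat_range_def)
    \<comment> \<open>With \<open>b = M x\<close>, the identity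
      \<open>D^(u-1) M = (I - A) D^u\<close> exhibits \<open>z 0\<close> as the image of
      \<open>y\<close>.\<close>
    define y where "y = diag_powr M u *\<^sub>v x"
    have yc: "y \<in> carrier_vec n" unfolding y_def by (rule mult_mat_vec_carrier[OF diag_powr_carrier[OF M] x(1)])
    have "z 0 = (1\<^sub>m n - A) *\<^sub>v y"
    proof (rule eq_vecI)
      fix i assume "i < dim_vec ((1\<^sub>m n - A) *\<^sub>v y)"
      then have i: "i < n" using Ac by simp
      have e: "(1\<^sub>m n - A) $$ (i,k) * y $ k = M $$ (i,i) powr (u - 1) * (M $$ (i,k) * x $ k)" if k: "k < n" for k
      proof -
        have y: "y $ k = M $$ (k,k) powr u * x $ k" unfolding y_def by (rule diag_powr_mult_vec[OF M x(1) k])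
        have pw: "M $$ (k,k) powr (- u) * M $$ (k,k) powr u = 1" "M $$ (i,i) powr (u - 1) * M $$ (i,i) = M $$ (i,i) powr u"
          using diag_pos[OF i] diag_pos[OF k] by (simp_all add: powr_add[symmetric] powr_diff)
        show ?thesis
        proof (cases "i = k")
          case True
          then have "AT M $$ (i,k) = 0" using i k by (simp add: AT_def diag_part_def dims)
          then show ?thesis using True Ac k pw(2) by (simp add: Aent y mult.assoc[symmetric])
        next
          case False
          have "(1\<^sub>m n - A) $$ (i,k) * y $ k =
              - (M $$ (i,i) powr (u - 1) * AT M $$ (i,k) * (M $$ (k,k) powr (- u) * M $$ (k,k) powr u) * x $ k)"
            using False Ac i k by (simp add: Aent y)
          then show ?thesis unfolding pw using False i k by (simp add: AT_def diag_part_def dims)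
        qed
      qed
      have "z 0 $ i = M $$ (i,i) powr (u - 1) * (M *\<^sub>v x) $ i"
        unfolding z0 x(2)[symmetric] by (rule diag_powr_mult_vec[OF M unit_vec_carrier i])
      also have "\<dots> = (\<Sum>k<n. (1\<^sub>m n - A) $$ (i,k) * y $ k)"
        unfolding index_mult_mat_vec_sum[OF M x(1) i] sum_distrib_left using e by simp
      finally show "z 0 $ i = ((1\<^sub>m n - A) *\<^sub>v y) $ i"
        unfolding index_mult_mat_vec_sum[OF IA yc i] .
    qed (use Ac scaled_rhs(1) in \<open>simp add: z0 diag_powr_def dims\<close>)
    then show ?thesis using yc Ac by (auto simp: S_def mat_range_def intro!: exI[of _ y])
  qed
  have zl: "z l \<in> S" for l by (induction l) (auto simp: start zS inv)
  then have zc: "z l \<in> carrier_vec n" for l using Sc by auto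
  have \<rho>0: "0 \<le> \<rho>"
    unfolding \<rho>_def by (rule op_pnorm_on_nonneg[OF p n Bc Sc])
      (simp add: S_def zero_in_mat_range[OF IA])
  have norm: "pnorm p (z l) \<le> d powr (u - 1) * \<rho> ^ l" for l
  proof (induction l)
    case 0
    then show ?case using pnorm_scaled_rhs[OF p] by (simp add: z0)
  next
    case (Suc l)
    have "pnorm p (z (Suc l)) \<le> \<rho> * pnorm p (z l)"
      unfolding zS \<rho>_def by (rule op_pnorm_on_le[OF p n Bc Sc scale zl])
    also have "\<dots> \<le> \<rho> * (d powr (u - 1) * \<rho> ^ l)" using Suc \<rho>0 by (rule mult_left_mono)
    finally show ?case by (simp add: mult_ac)
  qed
  have eq: "M $$ (i,i) powr u * (app n W ^^ l) v0 i = z l $ i" if "i < n" for l i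
    using that
  proof (induction l arbitrary: i)
    case 0
    then show ?case using scaled_rhs(2)[OF 0] d_pos by (simp add: z0 powr_diff)
  next
    case (Suc l)
    have "M $$ (i,i) powr u * (app n W ^^ Suc l) v0 i = (\<Sum>k<n. (M $$ (i,i) powr u * W i k) * (app n W ^^ l) v0 k)"
      by (simp add: app_def sum_distrib_left mult_ac)
    also have "\<dots> = (\<Sum>k<n. B $$ (i,k) * z l $ k)"
      using Suc by (intro sum.cong refl) (simp add: Bent[symmetric] mult.assoc del: fun_upd_apply)
    also have "\<dots> = z (Suc l) $ i" unfolding zS index_mult_mat_vec_sum[OF Bc zc Suc.prems] ..
    finally show ?case .
  qed
  show ?thesis
  proof (rule that[OF u \<rho>0])
    show "\<rho> \<le> 1 - \<gamma> / 2" using op by (simp add: \<rho>_def A_def B_def S_def)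
    fix l i assume i: "i < n"
    have di: "0 < M $$ (i,i) powr u" using diag_pos[OF i] by simp
    have "\<bar>z l $ i\<bar> \<le> d powr (u - 1) * \<rho> ^ l"
      using abs_le_pnorm[OF p, of i "z l"] norm[of l] i zc[of l] by simp
    then have "M $$ (i,i) powr u * \<bar>(app n W ^^ l) v0 i\<bar> \<le> d powr (u - 1) * \<rho> ^ l"
      unfolding eq[OF i, symmetric] by (simp add: abs_mult)
    then show "\<bar>(app n W ^^ l) v0 i\<bar> \<le> M $$ (i,i) powr (-u) * (d powr (u - 1) * \<rho> ^ l)"
      using di by (simp add: powr_minus field_simps)
  qed
qed

text \<open>The omitted terms decay at rate \<open>1 - \<gamma> / 2\<close>. The constant 4 makes
  the exponent \<open>\<gamma> * L / 2\<close> at least \<open>2 * max 1 (ln X)\<close>, hence at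
  least \<open>ln X + 1\<close>; the extra 1 offsets the factor 2 in the tail bound
  \<open>2 / \<gamma>\<close> for \<open>1 / (1 - \<rho>)\<close>.\<close>

lemma truncation:
  assumes \<gamma>: "0 < \<gamma>" "\<gamma> \<le> gamma_max M" and range: "b \<in> mat_range M"
    and L_large: "4 * L_scale M t b \<gamma> (\<epsilon> * pnorm \<infinity> (diag_powr M (-1) *\<^sub>v b)) \<le> real L"
  shows "\<bar>target / 2 - t \<bullet> x_star M b\<bar> \<le> \<epsilon> / (2 * d)"
proof -
  obtain u \<rho> where u: "0 \<le> u" "u \<le> 1" and \<rho>: "0 \<le> \<rho>" "\<rho> \<le> 1 - \<gamma> / 2" and
    decay: "\<And>l i. i < n \<Longrightarrow> \<bar>(app n W ^^ l) v0 i\<bar> \<le> M $$ (i,i) powr (-u) * (d powr (u - 1) * \<rho> ^ l)"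
    using walk_decay[OF \<gamma> range] by blast
  have \<rho>1: "\<rho> < 1" using \<rho> \<gamma> by simp
  define y where "y l i = (app n W ^^ l) v0 i" for l i
  define a where "a l = (\<Sum>i<n. t $ i * y l i)" for l
  define D where "D = d_max M"
  define q where "q = pnorm \<infinity> (diag_powr M (-1) *\<^sub>v t)"
  \<comment> \<open>Bounds the first term of the series: at most \<open>norm0 t\<close> nonzero
    summands, each controlled by \<open>q\<close> and the diagonal spread
    \<open>D / d\<close>.\<close>
  define H where "H = real (norm0 t) * (q * (D / d))"
  have Dge: "M $$ (i,i) \<le> D" if "i < n" for i
    unfolding D_def d_max_def by (rule Max_ge) (use that dims in auto)
  have D0: "0 < D" using Dge[OF w] d_pos by linarith
  have q: "\<bar>t $ i\<bar> / M $$ (i,i) \<le> q" if "i < n" for i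
  proof -
    have "(diag_powr M (-1) *\<^sub>v t) $ i = t $ i / M $$ (i,i)"
      using diag_powr_mult_vec[OF M t that, of "-1"] diag_pos[OF that] by (simp add: powr_minus_1)
    moreover have "\<bar>(diag_powr M (-1) *\<^sub>v t) $ i\<bar> \<le> q"
      unfolding q_def by (rule abs_le_pnorm) (use that in \<open>auto simp: diag_powr_def dims\<close>)
    ultimately show ?thesis using diag_pos[OF that] by (simp add: abs_mult)
  qed
  have q0: "0 \<le> q" using q[OF w] d_pos by (meson abs_ge_zero divide_nonneg_pos order_trans)
  \<comment> \<open>The exponent is known only to lie between 0 and 1. Writing the left side as
    \<open>M(i,i)^(1-u) d^u / (M(i,i) d)\<close> and replacing both bases in the numerator by
    \<open>D\<close> eliminates it.\<close>
  have weight: "M $$ (i,i) powr (-u) * d powr (u - 1) \<le> D / d / M $$ (i,i)" if i: "i < n" for i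
  proof -
    note di = diag_pos[OF i]
    have "M $$ (i,i) powr (-u) = M $$ (i,i) powr (1 - u) / M $$ (i,i)"
      using di by (simp add: powr_diff powr_minus divide_inverse)
    also have "\<dots> \<le> D powr (1 - u) / M $$ (i,i)"
      using di Dge[OF i] u by (intro divide_right_mono powr_mono2) auto
    finally have 1: "M $$ (i,i) powr (-u) \<le> D powr (1 - u) / M $$ (i,i)" .
    have "d powr (u - 1) = d powr u / d" using d_pos by (simp add: powr_diff)
    also have "\<dots> \<le> D powr u / d"
      using d_pos Dge[OF w] u by (intro divide_right_mono powr_mono2) auto
    finally have "M $$ (i,i) powr (-u) * d powr (u - 1) \<le> (D powr (1 - u) / M $$ (i,i)) * (D powr u / d)"
      using 1 di by (intro mult_mono) auto
    also have "\<dots> = (D powr (1 - u) * D powr u) / d / M $$ (i,i)" by simp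
    also have "D powr (1 - u) * D powr u = D" using D0 by (simp add: powr_add[symmetric])
    finally show ?thesis .
  qed
  have a_le: "\<bar>a l\<bar> \<le> H * \<rho> ^ l" for l
  proof -
    have "\<bar>a l\<bar> \<le> (\<Sum>i<n. \<bar>t $ i * y l i\<bar>)" unfolding a_def by (rule sum_abs)
    also have "\<dots> \<le> (\<Sum>i<n. if t $ i \<noteq> 0 then q * (D / d) * \<rho> ^ l else 0)"
    proof (rule sum_mono)
      fix i assume "i \<in> {..<n}"
      then have i: "i < n" by simp
      note di = diag_pos[OF i]
      have "\<bar>t $ i * y l i\<bar> \<le> \<bar>t $ i\<bar> * ((M $$ (i,i) powr (-u) * d powr (u - 1)) * \<rho> ^ l)"
        unfolding abs_mult y_def using decay[OF i, of l] by (intro mult_left_mono) (auto simp: mult_ac)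
      also have "\<dots> \<le> \<bar>t $ i\<bar> * ((D / d / M $$ (i,i)) * \<rho> ^ l)"
        using weight[OF i] \<rho> by (intro mult_left_mono mult_right_mono) auto
      also have "\<dots> = (\<bar>t $ i\<bar> / M $$ (i,i)) * ((D / d) * \<rho> ^ l)" by simp
      also have "\<dots> \<le> q * ((D / d) * \<rho> ^ l)"
        using q[OF i] \<rho> D0 d_pos by (intro mult_right_mono) auto
      finally show "\<bar>t $ i * y l i\<bar> \<le> (if t $ i \<noteq> 0 then q * (D / d) * \<rho> ^ l else 0)"
        by (auto simp: mult_ac)
    qed
    also have "\<dots> = real (card ({..<n} \<inter> {i. t $ i \<noteq> 0})) * (q * (D / d) * \<rho> ^ l)"
      by (simp add: sum.If_cases)
    also have "{..<n} \<inter> {i. t $ i \<noteq> 0} = {i. i < dim_vec t \<and> t $ i \<noteq> 0}" by (auto simp: dims)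
    finally show ?thesis by (simp add: H_def norm0_def mult_ac)
  qed
  have sy: "summable (\<lambda>l. y l i)" if "i < n" for i
    by (rule suminf_tail_bound(1)[OF _ \<rho>(1) \<rho>1, of _ "M $$ (i,i) powr (-u) * d powr (u - 1)"])
      (use decay[OF that] in \<open>simp add: y_def mult_ac\<close>)
  have dimx: "dim_vec (x_star M b) = n" by (simp add: x_star_def Let_def dims)
  have "t \<bullet> x_star M b = (\<Sum>i<n. t $ i * (1/2 * (\<Sum>l. y l i)))"
    unfolding scalar_prod_def dimx atLeast0LessThan by (rule sum.cong) (auto simp: x_star_eq y_def)
  also have "\<dots> = 1/2 * (\<Sum>i<n. \<Sum>l. t $ i * y l i)"
    unfolding sum_distrib_left by (rule sum.cong) (auto simp: suminf_mult[OF sy])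
  also have "(\<Sum>i<n. \<Sum>l. t $ i * y l i) = (\<Sum>l. a l)"
    unfolding a_def by (rule suminf_sum[symmetric]) (auto intro: summable_mult sy)
  finally have x: "t \<bullet> x_star M b = 1/2 * (\<Sum>l. a l)" .
  have tgt: "target = (\<Sum>l<L. a l)" by (simp add: walk_sum_def a_def y_def)
  have H0: "0 \<le> H" using q0 D0 d_pos by (simp add: H_def)
  have "\<bar>(\<Sum>l. a l) - target\<bar> \<le> H * \<rho> ^ L / (1 - \<rho>)"
    unfolding tgt by (rule suminf_tail_bound(2)[OF a_le \<rho>(1) \<rho>1])
  also have "\<dots> \<le> H * exp (- (\<gamma> * real L / 2)) / (\<gamma> / 2)"
  proof (rule frac_le)
    have "\<rho> \<le> exp (- (\<gamma> / 2))" using \<rho>(2) exp_ge_add_one_self[of "- (\<gamma> / 2)"] by linarith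
    then have "\<rho> ^ L \<le> exp (- (\<gamma> / 2)) ^ L" using \<rho> by (intro power_mono)
    also have "\<dots> = exp (- (\<gamma> * real L / 2))" by (simp add: exp_of_nat_mult[symmetric] mult_ac)
    finally show "H * \<rho> ^ L \<le> H * exp (- (\<gamma> * real L / 2))" using H0 by (rule mult_left_mono)
  qed (use \<gamma> \<rho> H0 in auto)
  also have "\<dots> \<le> \<epsilon> / d"
  proof -
    \<comment> \<open>The argument of the logarithm in \<open>L_scale\<close> once
      \<open>norm0 b = 1\<close> and the norm \<open>1 / d\<close> are inserted.\<close>
    define X where "X = d * H / (\<gamma> * \<epsilon>)"
    have X0: "0 \<le> X" using d_pos H0 \<gamma> eps by (simp add: X_def)
    have nb: "norm0 b = 1"
    proof -
      have single: "{i. i < dim_vec b \<and> b $ i \<noteq> 0} = {w}" using w by (auto simp: unit_vec_def split: if_splits)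
      show ?thesis unfolding norm0_def single by simp
    qed
    have pb: "pnorm \<infinity> (diag_powr M (-1) *\<^sub>v b) = 1 / d"
      using pnorm_scaled_rhs[of \<infinity> "-1"] d_pos by (simp add: powr_minus_1)
    have "L_scale M t b \<gamma> (\<epsilon> * pnorm \<infinity> (diag_powr M (-1) *\<^sub>v b)) = 1 / \<gamma> * max 1 (ln X)"
      unfolding L_scale_def pb nb D_def[symmetric] q_def[symmetric] X_def H_def
      using d_pos by (simp add: field_simps)
    then have "4 * (1 / \<gamma> * max 1 (ln X)) \<le> real L" using L_large by simp
    then have "\<gamma> * (4 * (1 / \<gamma> * max 1 (ln X))) \<le> \<gamma> * real L" using \<gamma> by (intro mult_left_mono) auto
    then have m: "2 * max 1 (ln X) \<le> \<gamma> * real L / 2" using \<gamma> by simp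
    have "X * exp (- (\<gamma> * real L / 2)) \<le> 1/2"
    proof (cases "X = 0")
      case False
      then have "0 < X" using X0 by simp
      have e2: "exp (-1) \<le> (1/2 :: real)"
        using exp_ge_add_one_self[of "1::real"] by (simp add: exp_minus field_simps)
      have "exp (- (\<gamma> * real L / 2)) \<le> exp (- ln X + -1)" using m by simp
      also have "\<dots> = exp (-1) / X" using \<open>0 < X\<close> unfolding exp_add by (simp add: exp_minus field_simps)
      also have "\<dots> \<le> (1/2) / X" using e2 \<open>0 < X\<close> by (intro divide_right_mono) auto
      finally show ?thesis using \<open>0 < X\<close> by (simp add: field_simps)
    qed simp
    moreover have "H * exp (- (\<gamma> * real L / 2)) / (\<gamma> / 2) = 2 * (\<epsilon> / d) * (X * exp (- (\<gamma> * real L / 2)))"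
      using d_pos eps \<gamma> by (simp add: X_def field_simps)
    ultimately show ?thesis using d_pos eps
      mult_left_mono[of "X * exp (- (\<gamma> * real L / 2))" "1/2" "2 * (\<epsilon> / d)"] by simp
  qed
  finally have "\<bar>(\<Sum>l. a l) - target\<bar> \<le> \<epsilon> / d" .
  then show ?thesis unfolding x by (simp add: field_simps abs_minus_commute)
qed

end

section \<open>Average running time\<close>

text \<open>Double counting of the nonzero positions by columns.\<close>

lemma sum_length_col_list:
  assumes "M \<in> carrier_mat n n" "valid_access M acc"
  shows "(\<Sum>k<n. length (col_list acc k)) = nnz M"
proof -
  have dims: "dim_row M = n" "dim_col M = n" using assms by auto
  let ?C = "\<lambda>k. {j. j < n \<and> M $$ (j,k) \<noteq> 0}"
  have "length (col_list acc k) = card (?C k)" if "k < n" for k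
  proof -
    have "distinct (col_list acc k)" "set (col_list acc k) = ?C k"
      using assms(2) that by (simp_all add: valid_access_def dims)
    then show ?thesis using distinct_card[of "col_list acc k"] by simp
  qed
  then have "(\<Sum>k<n. length (col_list acc k)) = (\<Sum>k<n. card (?C k))" by simp
  also have "\<dots> = card (Sigma {..<n} ?C)" by simp
  also have "\<dots> = card ((\<lambda>(k,j). (j,k)) ` Sigma {..<n} ?C)"
    by (rule card_image[symmetric]) (auto simp: inj_on_def)
  also have "(\<lambda>(k,j). (j,k)) ` Sigma {..<n} ?C = {(i,j). i < n \<and> j < n \<and> M $$ (i,j) \<noteq> 0}"
    by (auto simp: image_iff)
  finally show ?thesis by (simp add: nnz_def dims)
qed

text \<open>The positive diagonal contributes \<open>n\<close> positions, so a constant charge per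
  column can be absorbed in \<open>nnz M\<close>.\<close>

lemma nnz_ge_dim:
  assumes "M \<in> carrier_mat n n" "RDD M"
  shows "n \<le> nnz M"
proof -
  have dims: "dim_row M = n" "dim_col M = n" using assms by auto
  let ?A = "{(i,j). i < n \<and> j < n \<and> M $$ (i,j) \<noteq> 0}"
  have "?A \<subseteq> {..<n} \<times> {..<n}" by auto
  then have fin: "finite ?A" by (rule finite_subset) auto
  have pos: "0 < M $$ (i,i)" if "i < n" for i using assms(2) that by (simp add: RDD_def dims)
  have nz: "M $$ (i,i) \<noteq> 0" if "i < n" for i using pos[OF that] by simp
  have "card ((\<lambda>i. (i,i)) ` {..<n}) = n" by (subst card_image) (auto simp: inj_on_def)
  moreover have "card ((\<lambda>i. (i,i)) ` {..<n}) \<le> card ?A"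
    by (rule card_mono[OF fin]) (use nz in auto)
  ultimately show ?thesis by (simp add: nnz_def dims)
qed

lemma f_row_ge_1:
  assumes "M \<in> carrier_mat n n" "valid_access M acc" "0 < n"
  shows "1 \<le> f_row M acc"
proof -
  have "step_time acc 0 \<le> f_row M acc" unfolding f_row_def by (rule Max_ge) (use assms in auto)
  moreover have "1 \<le> step_time acc 0" using assms by (auto simp: valid_access_def)
  ultimately show ?thesis by simp
qed

text \<open>The push cost and the sampling cost balance at threshold \<open>1/x\<close>, where both are \<open>L a x\<close>.\<close>

lemma cost_balance:
  fixes a f \<tau> \<epsilon> l :: real
  assumes "0 < a" "0 < f" "0 < \<tau>" "0 < \<epsilon>" "0 < l"
  defines "x \<equiv> (\<tau>^2 * l^4 * f / (a * \<epsilon>^2)) powr (1/3)"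
  shows "f powr (1/3) * a powr (2/3) * \<tau> powr (2/3) * l powr (7/3) * \<epsilon> powr (-2/3) = l * a * x"
    and "x^3 = \<tau>^2 * l^4 * f / (a * \<epsilon>^2)" and "0 < x"
proof -
  let ?X = "\<tau>^2 * l^4 * f / (a * \<epsilon>^2)"
  have X: "0 < ?X" using assms by simp
  have lnX: "ln ?X = 2 * ln \<tau> + 4 * ln l + ln f - ln a - 2 * ln \<epsilon>"
    using assms by (simp add: ln_mult ln_div ln_realpow)
  have x: "x = exp (1/3 * ln ?X)" using X unfolding x_def powr_def by (simp only: less_imp_neq[OF X, symmetric] if_False)
  have "l * a * x = exp (ln l) * exp (ln a) * exp (1/3 * (2 * ln \<tau> + 4 * ln l + ln f - ln a - 2 * ln \<epsilon>))"
    unfolding x lnX using assms by simp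
  also have "\<dots> = exp (1/3 * ln f) * exp (2/3 * ln a) * exp (2/3 * ln \<tau>) * exp (7/3 * ln l) * exp (-2/3 * ln \<epsilon>)"
    unfolding exp_add[symmetric] by (simp add: field_simps)
  finally show "f powr (1/3) * a powr (2/3) * \<tau> powr (2/3) * l powr (7/3) * \<epsilon> powr (-2/3) = l * a * x"
    using assms by (simp add: powr_def)
  have "x^3 = exp (ln ?X)" unfolding x exp_of_nat_mult[symmetric] by simp
  then show "x^3 = ?X" using X by simp
  show "0 < x" by (simp add: x)
qed

text \<open>Admissibility and minimality of \<open>h\<close> place \<open>x\<close> between
  \<open>h - 1\<close> and \<open>h\<close>, and \<open>F = l * a * x\<close> by
  \<open>cost_balance\<close>. The guard \<open>\<epsilon> < l * \<tau>\<close> makes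
  \<open>F^3 = l^5 * a^2 * f * (l * \<tau> / \<epsilon>)^2\<close> at least 1.\<close>

lemma average_cost:
  fixes a f \<tau> \<epsilon> l :: real and h :: nat
  assumes "1 \<le> a" "1 \<le> f" "0 < \<tau>" "0 < \<epsilon>" "1 \<le> l" "\<epsilon> < l * \<tau>" "1 \<le> h"
    and good: "\<tau>^2 * l^4 * f \<le> real h^3 * a * \<epsilon>^2"
    and least: "1 < h \<Longrightarrow> real (h - 1)^3 * a * \<epsilon>^2 < \<tau>^2 * l^4 * f"
  defines "F \<equiv> f powr (1/3) * a powr (2/3) * \<tau> powr (2/3) * l powr (7/3) * \<epsilon> powr (-2/3)"
    and "r \<equiv> \<tau> * l^2 / (real h * \<epsilon>)"
  shows "1 \<le> F" "l * a * real (h - 1) \<le> F" "real h \<le> 2 * F" "r^2 * (l * f) \<le> F"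
proof -
  define x where "x = (\<tau>^2 * l^4 * f / (a * \<epsilon>^2)) powr (1/3)"
  have F: "F = l * a * x" and x3: "x^3 = \<tau>^2 * l^4 * f / (a * \<epsilon>^2)" and x0: "0 < x"
    unfolding F_def x_def using assms by (intro cost_balance; simp)+
  have la: "1 \<le> l * a" using assms mult_mono[of 1 l 1 a] by simp
  have "1 \<le> (l * \<tau> / \<epsilon>)^2" using assms by (intro one_le_power) simp
  then have "1 * 1 * 1 * 1 \<le> l^5 * a^2 * f * (l * \<tau> / \<epsilon>)^2"
    using assms by (intro mult_mono one_le_power) auto
  also have "\<dots> = F^3"
    unfolding F power_mult_distrib x3 using assms by (simp add: field_simps power_numeral_reduce)
  finally have "1^3 \<le> F^3" by simp
  moreover have F0: "0 \<le> F" using F x0 la by simp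
  ultimately show F1: "1 \<le> F" by (subst (asm) power_mono_iff) auto
  have hx: "real (h - 1) \<le> x"
  proof (cases "h = 1")
    case False
    then have "real (h - 1)^3 < x^3" using least assms unfolding x3 by (simp add: field_simps)
    then show ?thesis using x0 by (meson less_imp_le power_less_imp_less_base)
  qed (use x0 in simp)
  have "x^3 \<le> real h^3" using good assms unfolding x3 by (simp add: field_simps)
  then have xh: "x \<le> real h" using x0 by (subst (asm) power_mono_iff) auto
  show "l * a * real (h - 1) \<le> F" unfolding F using hx la by (intro mult_left_mono) auto
  have "x \<le> F" unfolding F using la x0 by simp
  then show "real h \<le> 2 * F" using hx F1 assms by linarith
  have "r^2 * (l * f) = l * a * (x^3 / real h^2)"
    unfolding x3 r_def using assms by (simp add: field_simps power_numeral_reduce)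
  also have "\<dots> \<le> l * a * x"
  proof (rule mult_left_mono)
    have "x * x^2 \<le> x * real h^2" using xh x0 by (intro mult_left_mono power_mono) auto
    then show "x^3 / real h^2 \<le> x" using assms by (simp add: field_simps power_numeral_reduce)
  qed (use la in simp)
  finally show "r^2 * (l * f) \<le> F" by (simp add: F)
qed

text \<open>An admissible number exists by the Archimedean property and \<open>k \<le> k^3\<close>
  for positive \<open>k\<close>. Taking the least one makes \<open>h - 1\<close> inadmissible, which
  bounds \<open>h\<close> from above.\<close>

lemma exists_scale:
  fixes X Y :: real
  assumes "0 < Y"
  obtains h where "1 \<le> h" "X \<le> real h^3 * Y" "\<And>m. 1 \<le> m \<Longrightarrow> m < h \<Longrightarrow> real m^3 * Y < X"
proof -
  let ?P = "\<lambda>h. 1 \<le> h \<and> X \<le> real h^3 * Y"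
  obtain k :: nat where "X / Y \<le> real k" using real_arch_simple by blast
  then have "X \<le> real (Suc k) * Y" using assms by (simp add: field_simps)
  also have "\<dots> \<le> real (Suc k)^3 * Y" using assms by (intro mult_right_mono self_le_power) auto
  finally have ex: "?P (Suc k)" by simp
  show ?thesis
  proof (rule that[of "LEAST h. ?P h"])
    show "1 \<le> (LEAST h. ?P h)" "X \<le> real (LEAST h. ?P h)^3 * Y" using LeastI[of ?P, OF ex] by auto
    show "real m^3 * Y < X" if "1 \<le> m" "m < (LEAST h. ?P h)" for m
      using not_less_Least[OF that(2)] that(1) by auto
  qed
qed

section \<open>Accuracy and average cost combined\<close>

theorem theorem7p4:
  fixes Q :: "real poly"
  shows "\<exists>P c\<^sub>1. 0 < c\<^sub>1 \<and> (\<forall>c\<^sub>2\<ge>c\<^sub>1. \<exists>C>0.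
    \<forall>(n::nat) M t acc (\<epsilon>::real) (\<gamma>::real) (L::nat).
      M \<in> carrier_mat n n \<longrightarrow> t \<in> carrier_vec n \<longrightarrow> t \<noteq> 0\<^sub>v n \<longrightarrow>
      poly_bounded Q n (elements_mat M \<union> set\<^sub>v t) \<longrightarrow>
      RDD M \<longrightarrow> valid_access M acc \<longrightarrow>
      0 < \<epsilon> \<longrightarrow> 0 < \<gamma> \<longrightarrow> \<gamma> \<le> gamma_max M \<longrightarrow>
      (\<forall>w<n. let b = unit_vec n w;
                  K = L_scale M t b \<gamma> (\<epsilon> * pnorm \<infinity> (diag_powr M (-1) *\<^sub>v b))
              in c\<^sub>1 * K \<le> real L \<and> real L \<le> c\<^sub>2 * K) \<longrightarrow>
      (\<exists>T :: nat \<Rightarrow> nat.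
        (\<forall>w<n. let b = unit_vec n w;
                    run = exec M b t acc P (initial M t acc w L \<epsilon> \<gamma>)
                in halts_within run (T w) \<and>
                   (b \<in> mat_range M \<longrightarrow>
                      measure (measure_spmf run)
                        {s. \<bar>result s - t \<bullet> x_star M b\<bar>
                              \<le> \<epsilon> * pnorm \<infinity> (diag_powr M (-1) *\<^sub>v b)} \<ge> 3/4)) \<and>
        (\<Sum>w<n. real (T w)) / real n \<le>
          C * max 1 (real (f_row M acc) powr (1/3) * (real (nnz M) / real n) powr (2/3)
            * pnorm 1 t powr (2/3) * real L powr (7/3) * \<epsilon> powr (-2/3))))"
\<comment> \<open>The constant 4 is the one that \<open>truncation\<close> requires of
  \<open>L\<close>.\<close>
proof (rule exI[of _ estimator], rule exI[of _ 4], intro conjI allI impI)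
  show "0 < (4::real)" by simp
  fix c\<^sub>2 :: real
  show "\<exists>C>0. \<forall>(n::nat) M t acc (\<epsilon>::real) (\<gamma>::real) (L::nat).
      M \<in> carrier_mat n n \<longrightarrow> t \<in> carrier_vec n \<longrightarrow> t \<noteq> 0\<^sub>v n \<longrightarrow>
      poly_bounded Q n (elements_mat M \<union> set\<^sub>v t) \<longrightarrow>
      RDD M \<longrightarrow> valid_access M acc \<longrightarrow>
      0 < \<epsilon> \<longrightarrow> 0 < \<gamma> \<longrightarrow> \<gamma> \<le> gamma_max M \<longrightarrow>
      (\<forall>w<n. let b = unit_vec n w;
                  K = L_scale M t b \<gamma> (\<epsilon> * pnorm \<infinity> (diag_powr M (-1) *\<^sub>v b))
              in 4 * K \<le> real L \<and> real L \<le> c\<^sub>2 * K) \<longrightarrow>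
      (\<exists>T :: nat \<Rightarrow> nat.
        (\<forall>w<n. let b = unit_vec n w;
                    run = exec M b t acc estimator (initial M t acc w L \<epsilon> \<gamma>)
                in halts_within run (T w) \<and>
                   (b \<in> mat_range M \<longrightarrow>
                      measure (measure_spmf run)
                        {s. \<bar>result s - t \<bullet> x_star M b\<bar>
                              \<le> \<epsilon> * pnorm \<infinity> (diag_powr M (-1) *\<^sub>v b)} \<ge> 3/4)) \<and>
        (\<Sum>w<n. real (T w)) / real n \<le>
          C * max 1 (real (f_row M acc) powr (1/3) * (real (nnz M) / real n) powr (2/3)
            * pnorm 1 t powr (2/3) * real L powr (7/3) * \<epsilon> powr (-2/3)))"
  \<comment> \<open>The average cost is at most \<open>30 + 249 * F\<close>: 30 collects fixed
    overheads, and 249 is 4 for the search, 205 for sampling and 40 for pushes.\<close>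
  proof (rule exI[of _ 300], intro conjI allI impI)
    fix n :: nat and M :: "real mat" and t :: "real Matrix.vec" and acc :: access
      and \<epsilon> \<gamma> :: real and L :: nat
    assume M: "M \<in> carrier_mat n n" and t: "t \<in> carrier_vec n" and t0: "t \<noteq> 0\<^sub>v n"
      and RDD: "RDD M" and access: "valid_access M acc" and eps: "0 < \<epsilon>"
      and \<gamma>: "0 < \<gamma>" "\<gamma> \<le> gamma_max M"
      and LK: "\<forall>w<n. let b = unit_vec n w;
                  K = L_scale M t b \<gamma> (\<epsilon> * pnorm \<infinity> (diag_powr M (-1) *\<^sub>v b))
              in 4 * K \<le> real L \<and> real L \<le> c\<^sub>2 * K"
    have n: "0 < n" using t t0 by (cases n) auto
    have Lw: "4 * L_scale M t (unit_vec n w) \<gamma> (\<epsilon> * pnorm \<infinity> (diag_powr M (-1) *\<^sub>v unit_vec n w)) \<le> real L"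
      if "w < n" for w using LK that by (simp add: Let_def)
    have "0 < real L"
    proof -
      have "0 < L_scale M t (unit_vec n 0) \<gamma> (\<epsilon> * pnorm \<infinity> (diag_powr M (-1) *\<^sub>v unit_vec n 0))"
        unfolding L_scale_def using \<gamma> by (intro mult_pos_pos) auto
      then show ?thesis using Lw[OF n] by linarith
    qed
    then have L: "0 < L" by simp
    define \<tau> where "\<tau> = (\<Sum>i<n. \<bar>t $ i\<bar>)"
    have nnz: "n \<le> nnz M" by (rule nnz_ge_dim[OF M RDD])
    have f1: "1 \<le> f_row M acc" by (rule f_row_ge_1[OF M access n])
    have "0 < real (nnz M) * \<epsilon>^2" using nnz n eps by simp
    then obtain h where h: "1 \<le> h"
      "\<tau>^2 * real L^4 * real (f_row M acc) * real n \<le> real h^3 * (real (nnz M) * \<epsilon>^2)"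
      "\<And>m. 1 \<le> m \<Longrightarrow> m < h \<Longrightarrow>
        real m^3 * (real (nnz M) * \<epsilon>^2) < \<tau>^2 * real L^4 * real (f_row M acc) * real n"
      using exists_scale[of "real (nnz M) * \<epsilon>^2" "\<tau>^2 * real L^4 * real (f_row M acc) * real n"] by blast
    have inst: "rdd_instance M t acc n w L h \<epsilon>" if "w < n" for w
      using M t t0 RDD access eps L h(1) that by unfold_locales auto
    have inst0: "rdd_instance M t acc n 0 L h \<epsilon>" using inst[OF n] .
    have p1: "pnorm 1 t = \<tau>" unfolding \<tau>_def by (rule rdd_instance.pnorm_1[OF inst0])
    have \<tau>0: "0 < \<tau>" unfolding \<tau>_def by (rule rdd_instance.\<tau>_pos[OF inst0])
    \<comment> \<open>Only the push time depends on \<open>w\<close>; \<open>h\<close> and the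
      sampling cost are common to all \<open>w\<close>.\<close>
    define pt where "pt w = rdd_instance.push_time M acc n w L h" for w
    define sc where "sc = rdd_instance.sampling_cost M t acc n L h \<epsilon>"
    define T where "T w = (if \<epsilon> < real L * \<tau> then 20 + 2 * h + pt w + sc else 2)" for w
    have run: "halts_within (exec M (unit_vec n w) t acc estimator (initial M t acc w L \<epsilon> \<gamma>)) (T w) \<and>
        (unit_vec n w \<in> mat_range M \<longrightarrow>
          measure (measure_spmf (exec M (unit_vec n w) t acc estimator (initial M t acc w L \<epsilon> \<gamma>)))
            {s. \<bar>result s - t \<bullet> x_star M (unit_vec n w)\<bar>
               \<le> \<epsilon> * pnorm \<infinity> (diag_powr M (-1) *\<^sub>v unit_vec n w)} \<ge> 3/4)" if w: "w < n" for w
    proof -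
      interpret rdd_instance M t acc n w L h \<epsilon> by (rule inst[OF w])
      let ?s = "initial M t acc w L \<epsilon> \<gamma>"
      have spec: "ensures (run estimator ?s) (\<lambda>s'. clock s' \<le> T w)
          (\<lambda>s'. if \<bar>rreg s' 0 - target / 2\<bar> \<le> \<epsilon> / (2 * d) then 0 else 1) (1/4)"
        unfolding T_def \<tau>_def pt_def sc_def
        by (rule estimator_spec)
          (use h in \<open>auto simp: initial_def base_def dims pnorm_1 \<tau>_def mult.assoc\<close>)
      have pb: "pnorm \<infinity> (diag_powr M (-1) *\<^sub>v b) = 1 / d"
        using pnorm_scaled_rhs[of \<infinity> "-1"] d_pos by (simp add: powr_minus_1)
      show ?thesis
      proof (intro conjI impI)
        show "halts_within (run estimator ?s) (T w)" by (rule ensures_halts_within[OF spec])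
        assume range: "b \<in> mat_range M"
        have trunc: "\<bar>target / 2 - t \<bullet> x_star M b\<bar> \<le> \<epsilon> / (2 * d)"
          by (rule truncation[OF \<gamma> range Lw[OF w]])
        let ?A = "{s. \<bar>result s - t \<bullet> x_star M b\<bar> \<le> \<epsilon> * pnorm \<infinity> (diag_powr M (-1) *\<^sub>v b)}"
        have "s \<in> ?A" if "\<bar>rreg s 0 - target / 2\<bar> \<le> \<epsilon> / (2 * d)" for s
        proof -
          have "\<bar>rreg s 0 - t \<bullet> x_star M b\<bar> \<le> \<epsilon> / (2 * d) + \<epsilon> / (2 * d)" using that trunc by linarith
          then show ?thesis by (simp add: result_def pb)
        qed
        then have "ensures (run estimator ?s) (\<lambda>s'. clock s' \<le> T w) (\<lambda>s. if s \<in> ?A then 0 else 1) (1/4)"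
          by (intro ensures_conseq[OF spec]) auto
        then have "1 - 1/4 \<le> measure (measure_spmf (run estimator ?s)) ?A" by (rule ensures_measure_ge)
        then show "3/4 \<le> measure (measure_spmf (run estimator ?s)) ?A" by simp
      qed
    qed
    define F where "F = real (f_row M acc) powr (1/3) * (real (nnz M) / real n) powr (2/3)
            * \<tau> powr (2/3) * real L powr (7/3) * \<epsilon> powr (-2/3)"
    have "(\<Sum>w<n. real (T w)) / real n \<le> 300 * max 1 F"
    proof (cases "\<epsilon> < real L * \<tau>")
      case False
      then show ?thesis using n by (simp add: T_def)
    next
      case True
      interpret rdd_instance M t acc n 0 L h \<epsilon> by (rule inst0)
      define a where "a = real (nnz M) / real n"
      have a1: "1 \<le> a" using nnz n by (simp add: a_def)
      have good: "\<tau>^2 * real L^4 * real f\<^sub>r \<le> real h^3 * a * \<epsilon>^2"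
        using h(2) n by (simp add: a_def field_simps)
      have least: "real (h - 1)^3 * a * \<epsilon>^2 < \<tau>^2 * real L^4 * real f\<^sub>r" if "1 < h"
        using h(3)[of "h - 1"] that n by (simp add: a_def field_simps)
      have rt: "ratio = \<tau> * (real L)^2 / (real h * \<epsilon>)" by (simp add: ratio_def \<tau>_def)
      have L1: "1 \<le> real L" and fr1: "1 \<le> real f\<^sub>r" using L f1 by auto
      note avg = average_cost[OF a1 fr1 \<tau>0 eps L1 True h(1) good least]
      have F1: "1 \<le> F" and Fp: "real L * a * real (h - 1) \<le> F" and Fh: "real h \<le> 2 * F"
        and Fr: "ratio^2 * (real L * real f\<^sub>r) \<le> F"
        using avg unfolding F_def a_def[symmetric] rt by auto
      have sc: "real sc \<le> 10 + 205 * F"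
      proof (cases "1 < ratio")
        case False
        then show ?thesis using F1 by (simp add: sc_def sampling_cost_def)
      next
        case r: True
        have "1 \<le> ratio^2" using r by (intro one_le_power) simp
        \<comment> \<open>Rounding up adds less than 1, which is at most
          \<open>ratio^2\<close>.\<close>
        then have N: "real (nat \<lceil>4 * ratio^2\<rceil>) \<le> 5 * ratio^2" by linarith
        have Lf: "1 \<le> real L * real f\<^sub>r" "real L \<le> real L * real f\<^sub>r"
          using mult_mono[OF L1 fr1] mult_left_mono[OF fr1, of "real L"] by auto
        have S: "real sample_cost \<le> 41 * (real L * real f\<^sub>r)"
          using Lf by (simp add: sample_cost_def algebra_simps)
        have "real (nat \<lceil>4 * ratio^2\<rceil>) * real sample_cost \<le> (5 * ratio^2) * (41 * (real L * real f\<^sub>r))"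
          using N S by (intro mult_mono) auto
        also have "\<dots> = 205 * (ratio^2 * (real L * real f\<^sub>r))" by simp
        also have "\<dots> \<le> 205 * F" using Fr by simp
        finally show ?thesis using r by (simp add: sc_def sampling_cost_def)
      qed
      have pt: "real (\<Sum>w<n. pt w) \<le> 40 * F * real n"
      proof -
        have "pt w = (\<Sum>l<L. \<Sum>k<n. push_bound n W h w l k * push_cost k)" if "w < n" for w
          unfolding pt_def rdd_instance.push_time_def[OF inst[OF that]]
            rdd_instance.push_cost_def[OF inst[OF that]] push_cost_def ..
        then have "(\<Sum>w<n. pt w) = (\<Sum>w<n. \<Sum>l<L. \<Sum>k<n. push_bound n W h w l k * push_cost k)"
          by simp
        also have "\<dots> = (\<Sum>l<L. \<Sum>w<n. \<Sum>k<n. push_bound n W h w l k * push_cost k)"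
          by (rule sum.swap)
        \<comment> \<open>Averaging pays here: with the sum over \<open>w\<close> innermost, the
          push bounds of a fixed pair \<open>(l,k)\<close> add up to at most
          \<open>h - 1\<close>.\<close>
        also have "\<dots> = (\<Sum>l<L. \<Sum>k<n. (\<Sum>w<n. push_bound n W h w l k) * push_cost k)"
          unfolding sum_distrib_right by (rule sum.cong[OF refl], rule sum.swap)
        also have "\<dots> \<le> (\<Sum>l<L. \<Sum>k<n. (h - 1) * push_cost k)"
          by (intro sum_mono mult_right_mono sum_push_bound substochastic_W) (use h(1) in auto)
        also have "\<dots> = L * ((h - 1) * (10 * n + 30 * nnz M))"
          using sum_length_col_list[OF M access]
          by (simp add: push_cost_def sum_distrib_left[symmetric] sum.distrib)
        also have "\<dots> \<le> L * ((h - 1) * (40 * nnz M))" using nnz by (intro mult_left_mono) auto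
        finally have "real (\<Sum>w<n. pt w) \<le> real (L * ((h - 1) * (40 * nnz M)))" by (rule of_nat_mono)
        also have "\<dots> = 40 * (real L * a * real (h - 1)) * real n" using n by (simp add: a_def)
        also have "\<dots> \<le> 40 * F * real n" using Fp by (intro mult_right_mono mult_left_mono) auto
        finally show ?thesis .
      qed
      have "(\<Sum>w<n. real (T w)) = real n * (20 + 2 * real h + real sc) + real (\<Sum>w<n. pt w)"
        using True by (simp add: T_def sum.distrib algebra_simps)
      also have "\<dots> \<le> real n * (20 + 2 * (2 * F) + (10 + 205 * F)) + 40 * F * real n"
        using pt sc Fh by (intro add_mono mult_left_mono) auto
      also have "\<dots> = real n * (30 + 249 * F)" by (simp add: algebra_simps)
      also have "\<dots> \<le> real n * (300 * max 1 F)" using F1 by (intro mult_left_mono) auto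
      finally show ?thesis using n by (simp add: field_simps)
    qed
    then show "\<exists>T :: nat \<Rightarrow> nat.
        (\<forall>w<n. let b = unit_vec n w;
                    run = exec M b t acc estimator (initial M t acc w L \<epsilon> \<gamma>)
                in halts_within run (T w) \<and>
                   (b \<in> mat_range M \<longrightarrow>
                      measure (measure_spmf run)
                        {s. \<bar>result s - t \<bullet> x_star M b\<bar>
                              \<le> \<epsilon> * pnorm \<infinity> (diag_powr M (-1) *\<^sub>v b)} \<ge> 3/4)) \<and>
        (\<Sum>w<n. real (T w)) / real n \<le>
          300 * max 1 (real (f_row M acc) powr (1/3) * (real (nnz M) / real n) powr (2/3)
            * pnorm 1 t powr (2/3) * real L powr (7/3) * \<epsilon> powr (-2/3))"
      using run unfolding Let_def p1 F_def by (intro exI[of _ T]) blast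
  qed simp
qed

end
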